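(* Let $n\ge1$ and $l_1,\ldots,l_{n-1}>0$, and consider the kinematic model of a truck with multiple trailers $$\dot x_1=u_1\cos y_1,\quad \dot x_2=u_1\sin y_1,\quad \dot y_i=u_1\eta_i(y_2,\ldots,y_{i+1})\ (i=1,\ldots,n-1),\quad \dot y_n=u_2\qquad(\ast)$$ with $\eta_1(y_2)=l_1^{-1}\tan y_2$ and $\eta_i(y_2,\ldots,y_{i+1})=(l_i^{-1}\tan y_{i+1}-l_{i-1}^{-1}\sin y_i)\prod_{k=2}^i\sec y_k$ for $i=2,\ldots,n-1$, on the configuration manifold $\mathcal{Q}=\mathbb{R}^3\times(S^1)^{n-1}$. Then both control laws $u=U^+(t,q,x^D)$ and $u=U^-(t,q,x^D)$ defined in the context solve the problem of almost global stabilization of the distinguished point trajectories of $(\ast)$. That is, the manifold $\mathcal{K}=\{q\in\mathcal{Q}: \cos y_i\ne0,\ i=2,\ldots,n\}$ is dense in $\mathcal{Q}$ and, for each sign $\pm$, each $\mu\in\mathcal{C}$, each strongly admissible $x^D$, and each initial value $q(0)\in\mathcal{M}_\mu$, the solution $q=\mathrm{col}(x,y)$ of the closed-loop system $(\ast)$, $u=U^\pm(t,q,x^D)$ is defined and lies in $\mathcal{M}_\mu$ for all $t\ge0$, and, with $(q^D,u^D)=M_\mu^\pm(x^D)$, $q^D=\mathrm{col}(x^D,y^D)$, $$\lim_{t\to\infty}(x(t)-x^D(t))=0,\quad\lim_{t\to\infty}d(y(t),y^D(t))=0,\quad\lim_{t\to\infty}(u(t)-u^D(t))=0 .$$ Moreover,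 for all $t\ge0$, $u_1(t)>0$ under $U^+$ (forward motion of the tail-end trailer) and $u_1(t)<0$ under $U^-$ (backward motion of the tail-end trailer).
   Context: Coordinates on $\mathcal{Q}$ are $q=\mathrm{col}(x_1,x_2,y_1,\ldots,y_n)$, $x_1,x_2,y_1\in\mathbb{R}$, with $y_2,\ldots,y_n$ the angular coordinates on unit circles $S^1$. $\mathcal{C}=\{0,1\}^{n-1}$. For $\mu\in\mathcal{C}$, $\mathcal{M}_\mu=\mathbb{R}^2\times\mathcal{O}_\mu$, $\mathcal{O}_\mu=\{y\in\mathbb{R}\times(S^1)^{n-1}:\ \mu_{i-1}\pi-\pi/2<y_i<\mu_{i-1}\pi+\pi/2,\ i=2,\ldots,n\}$; $\mathcal{K}=\bigcup_\mu\mathcal{M}_\mu$ (disjoint union). On $\mathcal{O}_\mu$, $d(y',y'')=\sum_{i=1}^n|y_i'-y_i''|$ (angles represented in the indicated intervals). $x^D:[0,\infty)\to\mathbb{R}^2$ is strongly admissible if $x^D\in C^{n+1}$, $\inf_{t\ge0}|\dot x^D(t)|>0$, and its derivatives of orders $1,\ldots,n+1$ are bounded. Put $h_1=\mathrm{col}(\eta_1,\ldots,\eta_{n-1},0)$, $h_2=\mathrm{col}(0,\ldots,0,1)$, and, with $L_h$ the Lie derivative, $$S(y)=\mathrm{col}(L_{h_1}^0y_1,\ldots,L_{h_1}^{n-1}y_1),\quad F(y)=\begin{pmatrix}1&0\\ L_{h_1}^ny_1&L_{h_2}L_{h_1}^{n-1}y_1\end{pmatrix},\quad F_2=\begin{pmatrix}0&0\\0&1\end{pmatrix}F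 .$$ On each $\mathcal{O}_\mu$, $S$ is a diffeomorphism onto $\mathbb{R}^n$ and $F$ is nonsingular; $S_\mu$ denotes the restriction of $S$ to $\mathcal{O}_\mu$. Maneuvering operators $M_\mu^\pm$: given $x^D$, put $v_1^D(t)=\pm|\dot x^D(t)|$; let $s_1^D$ solve $$\dot s_1=\frac{\ddot x_2^D(t)\cos s_1-\ddot x_1^D(t)\sin s_1}{v_1^D(t)}$$ with initial value satisfying $\dot x^D(0)=v_1^D(0)\,\mathrm{col}(\cos s_1^D(0),\sin s_1^D(0))$, where $-\pi<s_1^D(0)\le\pi$ for the sign $+$ and $0\le s_1^D(0)<2\pi$ for the sign $-$. Put $s_i^D=\dot s_{i-1}^D/v_1^D$ for $i=2,\ldots,n$, $v_2^D=\dot s_n^D$, $y^D=S_\mu^{-1}(s^D)$, $u^D=F(y^D)^{-1}v^D$, $q^D=\mathrm{col}(x^D,y^D)$, $M_\mu^\pm(x^D)=(q^D,u^D)$. Control laws: for $q=\mathrm{col}(x,y)\in\mathcal{M}_\mu$ and $(q^D,u^D)=M_\mu^\pm(x^D)$, $U^\pm(t,q,x^D)=\Phi(q,q^D(t),u^D(t))$, where $$\Phi(q,q^D,u^D)=F(y)^{-1}\left\{|u_1^D|\,\Psi\big(x-x^D,\,S(y)-S(y^D),\,S(y^D),\,F(y^D)u^D\big)+F_2(y^D)u^D\right\}.$$ Function $\Psi$. Fix arbitrary parameters $\gamma>0$, $\delta_1,\ldots,\delta_n>0$. Let $\bar w\in\{-1,1\}$, $\xi\in\mathbb{R}^2$,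 $\sigma_1,\ldots,\sigma_n\in\mathbb{R}$, $a=(a_1,\ldots,a_{n+1})\in\mathbb{R}^{n+1}$, $z^0=\xi$, $z^i=\mathrm{col}(\xi,\sigma_1,\ldots,\sigma_i)$, and $G(a_1)=\begin{pmatrix}\cos a_1&-\sin a_1\\ \sin a_1&\cos a_1\end{pmatrix}$. Define $$c=-\frac{\tanh(\gamma|\xi|)}{|\xi|}G(a_1)^{-1}\xi+\bar w\begin{pmatrix}1\\0\end{pmatrix}$$ (first term $0$ for $\xi=0$; $c_1$ always has the sign of $\bar w$), $\lambda=\bar w|c|$, $\alpha_0=\arctan(c_2/c_1)$, $V_0=\sinh^2(\gamma|\xi|)$. Let $b_i=(\lambda-\bar w)a_{i+1}$, $\beta_i=\lambda$ for $1\le i\le n-1$, and $b_n=0$, $\beta_n=1$. Let $$B_0(z^0,\sigma_1)=-\bar w\begin{pmatrix}\cos a_1\\ \sin a_1\end{pmatrix}+\lambda G(a_1)\begin{pmatrix}\cos\sigma_1\\ \sin\sigma_1\end{pmatrix},\quad B_i(z^i,\sigma_{i+1})=\mathrm{col}\big(B_{i-1}(z^{i-1},\sigma_i),\,b_i+\beta_i\sigma_{i+1}\big),\ 1\le i\le n-1$$ (dependence on $a,\bar w$ suppressed), and let $D_i(z^i,\zeta,\eta)=\frac{B_i(z^i,\zeta)-B_i(z^i,\eta)}{\zeta-\eta}$ for $\zeta\ne\eta$, $D_i(z^i,\zeta,\zeta)=\frac{\partial B_i}{\partial\zeta}(z^i,\zeta)$. For $i=1,\ldots,n$ define recursively $$\alpha_i=\beta_i^{-1}\Big[\frac{\partial\alpha_{i-1}}{\partial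 z^{i-1}}B_{i-1}(z^{i-1},\sigma_i)+\bar w\sum_{j=1}^{i}\frac{\partial\alpha_{i-1}}{\partial a_j}a_{j+1}-\delta_i^{-1}\frac{\partial V_{i-1}}{\partial z^{i-1}}D_{i-1}(z^{i-1},\sigma_i,\alpha_{i-1})-b_i-\gamma(\sigma_i-\alpha_{i-1})\Big],$$ $$V_i=V_{i-1}+\tfrac12\delta_i(\sigma_i-\alpha_{i-1})^2,$$ where $\alpha_i$ depends on $(z^i,a_1,\ldots,a_{i+1},\bar w)$ and derivatives with respect to $z$ are row vectors. For $\bar s\in\mathbb{R}^n$ and $\bar v\in\mathbb{R}^2$ with $\bar v_1\ne0$, $\Psi(\xi,\sigma,\bar s,\bar v)=\mathrm{col}(\lambda,\alpha_n)$ evaluated at $z^n=\mathrm{col}(\xi,\sigma)$, $(a_1,\ldots,a_n)=\bar s$, $a_{n+1}=\bar v_2/\bar v_1$, $\bar w=\mathrm{sign}\,\bar v_1$. *)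

theory Defs
  imports "HOL-Analysis.Analysis"
begin

text \<open>
  Vectors whose length depends on \<open>n\<close> are functions \<open>nat \<Rightarrow> real\<close>
  indexed from 1; \<open>\<real>\<^sup>n\<close> is \<open>{1..n} \<rightarrow>\<^sub>E UNIV\<close>, so that equality of vectors and inverse
  functions make sense.
\<close>

definition partial :: "nat \<Rightarrow> ((nat \<Rightarrow> real) \<Rightarrow> real) \<Rightarrow> (nat \<Rightarrow> real) \<Rightarrow> real" where
  "partial k f x = deriv (\<lambda>t. f (x(k := t))) (x k)"

text \<open>One-sided at \<open>t = 0\<close>: reference trajectories live on \<open>[0,\<infinity>)\<close>.\<close>

definition tderiv :: "(real \<Rightarrow> 'a::real_normed_vector) \<Rightarrow> real \<Rightarrow> 'a" where
  "tderiv f t = vector_derivative f (at t within {0..})"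


section \<open>Configuration manifold\<close>

text \<open>\<open>S\<^sup>1\<close> is the unit circle in the complex plane; the angle \<open>y\<close> corresponds to \<open>cis y\<close>.\<close>

type_synonym config = "(real^2) \<times> real \<times> (nat \<Rightarrow> complex)"

definition Q_topology :: "nat \<Rightarrow> config topology" where
  "Q_topology n = prod_topology euclidean (prod_topology euclidean
     (product_topology (\<lambda>_. top_of_set (sphere 0 1)) {2..n}))"

definition K_set :: "nat \<Rightarrow> config set" where
  "K_set n = {(x, y1, \<theta>). (x, y1, \<theta>) \<in> topspace (Q_topology n) \<and> (\<forall>i\<in>{2..n}. Re (\<theta> i) \<noteq> 0)}"

definition modes :: "nat \<Rightarrow> (nat \<Rightarrow> nat) set" where
  "modes n = {1..n-1} \<rightarrow>\<^sub>E {0, 1}"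

text \<open>The cells \<open>\<O>\<^sub>\<mu>\<close> and \<open>\<M>\<^sub>\<mu>\<close> in coordinates, angles being represented in the intervals
  prescribed by \<open>\<mu>\<close>. These intervals are disjoint and open, so on the union of the cells the real
  coordinates form a global chart, whose inverse is \<open>to_Q\<close>.\<close>

type_synonym coords = "(real^2) \<times> (nat \<Rightarrow> real)"

definition cell :: "nat \<Rightarrow> (nat \<Rightarrow> nat) \<Rightarrow> (nat \<Rightarrow> real) set" where
  "cell n \<mu> = {y \<in> {1..n} \<rightarrow>\<^sub>E UNIV. \<forall>i\<in>{2..n}.
     real (\<mu> (i - 1)) * pi - pi/2 < y i \<and> y i < real (\<mu> (i - 1)) * pi + pi/2}"

definition M_cell :: "nat \<Rightarrow> (nat \<Rightarrow> nat) \<Rightarrow> coords set" where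
  "M_cell n \<mu> = UNIV \<times> cell n \<mu>"

definition to_Q :: "nat \<Rightarrow> coords \<Rightarrow> config" where
  "to_Q n = (\<lambda>(x, y). (x, y 1, \<lambda>i\<in>{2..n}. cis (y i)))"

definition mode_of :: "nat \<Rightarrow> coords \<Rightarrow> (nat \<Rightarrow> nat)" where
  "mode_of n q = (THE \<mu>. \<mu> \<in> modes n \<and> q \<in> M_cell n \<mu>)"

definition dist_y :: "nat \<Rightarrow> (nat \<Rightarrow> real) \<Rightarrow> (nat \<Rightarrow> real) \<Rightarrow> real" where
  "dist_y n y' y'' = (\<Sum>i=1..n. \<bar>y' i - y'' i\<bar>)"


section \<open>Kinematic model\<close>

definition eta :: "(nat \<Rightarrow> real) \<Rightarrow> nat \<Rightarrow> (nat \<Rightarrow> real) \<Rightarrow> real" where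
  "eta l i y =
     (if i = 1 then tan (y 2) / l 1
      else (tan (y (i + 1)) / l i - sin (y i) / l (i - 1)) * (\<Prod>k=2..i. 1 / cos (y k)))"

definition h1 :: "nat \<Rightarrow> (nat \<Rightarrow> real) \<Rightarrow> (nat \<Rightarrow> real) \<Rightarrow> nat \<Rightarrow> real" where
  "h1 n l y i = (if 1 \<le> i \<and> i < n then eta l i y else 0)"

definition h2 :: "nat \<Rightarrow> (nat \<Rightarrow> real) \<Rightarrow> nat \<Rightarrow> real" where
  "h2 n y i = (if i = n then 1 else 0)"

definition lie :: "nat \<Rightarrow> ((nat \<Rightarrow> real) \<Rightarrow> nat \<Rightarrow> real) \<Rightarrow>
    ((nat \<Rightarrow> real) \<Rightarrow> real) \<Rightarrow> (nat \<Rightarrow> real) \<Rightarrow> real" where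
  "lie n h f y = (\<Sum>i=1..n. partial i f y * h y i)"

definition S_map :: "nat \<Rightarrow> (nat \<Rightarrow> real) \<Rightarrow> (nat \<Rightarrow> real) \<Rightarrow> (nat \<Rightarrow> real)" where
  "S_map n l y = (\<lambda>i\<in>{1..n}. (lie n (h1 n l) ^^ (i - 1)) (\<lambda>y. y 1) y)"

definition F_mat :: "nat \<Rightarrow> (nat \<Rightarrow> real) \<Rightarrow> (nat \<Rightarrow> real) \<Rightarrow> real^2^2" where
  "F_mat n l y = vector
     [vector [1, 0],
      vector [(lie n (h1 n l) ^^ n) (\<lambda>y. y 1) y,
              lie n (h2 n) ((lie n (h1 n l) ^^ (n - 1)) (\<lambda>y. y 1)) y]]"

definition F2_mat :: "nat \<Rightarrow> (nat \<Rightarrow> real) \<Rightarrow> (nat \<Rightarrow> real) \<Rightarrow> real^2^2" where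
  "F2_mat n l y = vector [vector [0, 0], vector [0, 1]] ** F_mat n l y"


section \<open>Reference trajectories and maneuvering operators\<close>

definition strongly_admissible :: "nat \<Rightarrow> (real \<Rightarrow> real^2) \<Rightarrow> bool" where
  "strongly_admissible n xD \<longleftrightarrow>
     (\<forall>k\<le>n. \<forall>t\<ge>0. (tderiv ^^ k) xD differentiable (at t within {0..})) \<and>
     continuous_on {0..} ((tderiv ^^ (n + 1)) xD) \<and>
     (INF t\<in>{0..}. norm (tderiv xD t)) > 0 \<and>
     (\<forall>k\<in>{1..n+1}. bounded ((tderiv ^^ k) xD ` {0..}))"

text \<open>The sign \<open>\<plusminus>\<close> is a real number \<open>\<epsilon> \<in> {1, -1}\<close>.\<close>

definition v1_ref :: "real \<Rightarrow> (real \<Rightarrow> real^2) \<Rightarrow> real \<Rightarrow> real" where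
  "v1_ref \<epsilon> xD t = \<epsilon> * norm (tderiv xD t)"

definition is_s1_ref :: "real \<Rightarrow> (real \<Rightarrow> real^2) \<Rightarrow> (real \<Rightarrow> real) \<Rightarrow> bool" where
  "is_s1_ref \<epsilon> xD s \<longleftrightarrow>
     (\<forall>t\<ge>0. (s has_real_derivative
        ((tderiv ^^ 2) xD t $ 2 * cos (s t) - (tderiv ^^ 2) xD t $ 1 * sin (s t)) / v1_ref \<epsilon> xD t)
        (at t within {0..})) \<and>
     tderiv xD 0 = v1_ref \<epsilon> xD 0 *\<^sub>R vector [cos (s 0), sin (s 0)] \<and>
     (if \<epsilon> = 1 then -pi < s 0 \<and> s 0 \<le> pi else 0 \<le> s 0 \<and> s 0 < 2 * pi)"

text \<open>The choice is unique on \<open>[0,\<infinity>)\<close>, and only values at \<open>t \<ge> 0\<close> are used.\<close>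

definition s1_ref :: "real \<Rightarrow> (real \<Rightarrow> real^2) \<Rightarrow> real \<Rightarrow> real" where
  "s1_ref \<epsilon> xD = (SOME s. is_s1_ref \<epsilon> xD s)"

definition s_ref :: "real \<Rightarrow> (real \<Rightarrow> real^2) \<Rightarrow> nat \<Rightarrow> real \<Rightarrow> real" where
  "s_ref \<epsilon> xD i = ((\<lambda>s t. tderiv s t / v1_ref \<epsilon> xD t) ^^ (i - 1)) (s1_ref \<epsilon> xD)"

definition v_ref :: "nat \<Rightarrow> real \<Rightarrow> (real \<Rightarrow> real^2) \<Rightarrow> real \<Rightarrow> real^2" where
  "v_ref n \<epsilon> xD t = vector [v1_ref \<epsilon> xD t, tderiv (s_ref \<epsilon> xD n) t]"

definition y_ref :: "nat \<Rightarrow> (nat \<Rightarrow> real) \<Rightarrow> real \<Rightarrow> (nat \<Rightarrow> nat) \<Rightarrow> (real \<Rightarrow> real^2) \<Rightarrow>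
    real \<Rightarrow> (nat \<Rightarrow> real)" where
  "y_ref n l \<epsilon> \<mu> xD t = inv_into (cell n \<mu>) (S_map n l) (\<lambda>i\<in>{1..n}. s_ref \<epsilon> xD i t)"

definition u_ref :: "nat \<Rightarrow> (nat \<Rightarrow> real) \<Rightarrow> real \<Rightarrow> (nat \<Rightarrow> nat) \<Rightarrow> (real \<Rightarrow> real^2) \<Rightarrow>
    real \<Rightarrow> real^2" where
  "u_ref n l \<epsilon> \<mu> xD t = matrix_inv (F_mat n l (y_ref n l \<epsilon> \<mu> xD t)) *v v_ref n \<epsilon> xD t"

definition maneuver :: "nat \<Rightarrow> (nat \<Rightarrow> real) \<Rightarrow> real \<Rightarrow> (nat \<Rightarrow> nat) \<Rightarrow> (real \<Rightarrow> real^2) \<Rightarrow>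
    (real \<Rightarrow> coords) \<times> (real \<Rightarrow> real^2)" where
  "maneuver n l \<epsilon> \<mu> xD = ((\<lambda>t. (xD t, y_ref n l \<epsilon> \<mu> xD t)), u_ref n l \<epsilon> \<mu> xD)"


section \<open>The function \<open>\<Psi>\<close>\<close>

definition G_rot :: "real \<Rightarrow> real^2^2" where
  "G_rot \<phi> = vector [vector [cos \<phi>, - sin \<phi>], vector [sin \<phi>, cos \<phi>]]"

text \<open>The vector \<open>z\<^sup>i\<close> is stored flat: \<open>\<xi> = (z 1, z 2)\<close> and \<open>\<sigma>\<^sub>j = z (j + 2)\<close>. Functions of \<open>z\<^sup>i\<close>
  take an argument \<open>z :: nat \<Rightarrow> real\<close> of which only the coordinates \<open>1, \<dots>, i + 2\<close> matter; the
  same convention holds for \<open>a\<close>. The argument \<open>w\<close> is \<open>w\<close>-bar.\<close>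

definition xi_of :: "(nat \<Rightarrow> real) \<Rightarrow> real^2" where
  "xi_of z = vector [z 1, z 2]"

definition c_vec :: "real \<Rightarrow> real \<Rightarrow> (nat \<Rightarrow> real) \<Rightarrow> (nat \<Rightarrow> real) \<Rightarrow> real^2" where
  "c_vec \<gamma> w a z =
     (if xi_of z = 0 then 0
      else - (tanh (\<gamma> * norm (xi_of z)) / norm (xi_of z)) *\<^sub>R (matrix_inv (G_rot (a 1)) *v xi_of z))
     + w *\<^sub>R vector [1, 0]"

definition lam :: "real \<Rightarrow> real \<Rightarrow> (nat \<Rightarrow> real) \<Rightarrow> (nat \<Rightarrow> real) \<Rightarrow> real" where
  "lam \<gamma> w a z = w * norm (c_vec \<gamma> w a z)"

definition b_coef :: "nat \<Rightarrow> real \<Rightarrow> real \<Rightarrow> nat \<Rightarrow> (nat \<Rightarrow> real) \<Rightarrow> (nat \<Rightarrow> real) \<Rightarrow> real" where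
  "b_coef n \<gamma> w i a z = (if i < n then (lam \<gamma> w a z - w) * a (i + 1) else 0)"

definition beta_coef :: "nat \<Rightarrow> real \<Rightarrow> real \<Rightarrow> nat \<Rightarrow> (nat \<Rightarrow> real) \<Rightarrow> (nat \<Rightarrow> real) \<Rightarrow> real" where
  "beta_coef n \<gamma> w i a z = (if i < n then lam \<gamma> w a z else 1)"

text \<open>\<open>B_fun n \<gamma> w i a z \<zeta> k\<close> is the \<open>k\<close>-th component, \<open>1 \<le> k \<le> i + 2\<close>, of \<open>B\<^sub>i (z\<^sup>i, \<zeta>)\<close>.\<close>

fun B_fun :: "nat \<Rightarrow> real \<Rightarrow> real \<Rightarrow> nat \<Rightarrow> (nat \<Rightarrow> real) \<Rightarrow> (nat \<Rightarrow> real) \<Rightarrow> real \<Rightarrow> nat \<Rightarrow> real" where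
  "B_fun n \<gamma> w 0 a z \<zeta> k =
     (let B0 = (- w) *\<^sub>R vector [cos (a 1), sin (a 1)]
               + lam \<gamma> w a z *\<^sub>R (G_rot (a 1) *v vector [cos \<zeta>, sin \<zeta>]) :: real^2
      in if k = 1 then B0 $ 1 else B0 $ 2)"
| "B_fun n \<gamma> w (Suc i) a z \<zeta> k =
     (if k \<le> i + 2 then B_fun n \<gamma> w i a z (z (i + 3)) k
      else b_coef n \<gamma> w (Suc i) a z + beta_coef n \<gamma> w (Suc i) a z * \<zeta>)"

definition D_fun :: "nat \<Rightarrow> real \<Rightarrow> real \<Rightarrow> nat \<Rightarrow> (nat \<Rightarrow> real) \<Rightarrow> (nat \<Rightarrow> real) \<Rightarrow>
    real \<Rightarrow> real \<Rightarrow> nat \<Rightarrow> real" where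
  "D_fun n \<gamma> w i a z \<zeta> \<eta> k =
     (if \<zeta> \<noteq> \<eta> then (B_fun n \<gamma> w i a z \<zeta> k - B_fun n \<gamma> w i a z \<eta> k) / (\<zeta> - \<eta>)
      else deriv (\<lambda>\<zeta>. B_fun n \<gamma> w i a z \<zeta> k) \<zeta>)"

text \<open>In the step from \<open>i\<close> to \<open>Suc i\<close>, \<open>z\<^sup>i\<close> has \<open>i + 2\<close> coordinates and \<open>\<sigma>\<^bsub>i+1\<^esub> = z (i + 3)\<close>.\<close>

fun alpha :: "nat \<Rightarrow> real \<Rightarrow> (nat \<Rightarrow> real) \<Rightarrow> real \<Rightarrow> nat \<Rightarrow> (nat \<Rightarrow> real) \<Rightarrow> (nat \<Rightarrow> real) \<Rightarrow> real"
and V_fun :: "nat \<Rightarrow> real \<Rightarrow> (nat \<Rightarrow> real) \<Rightarrow> real \<Rightarrow> nat \<Rightarrow> (nat \<Rightarrow> real) \<Rightarrow> (nat \<Rightarrow> real) \<Rightarrow> real"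
where
  "alpha n \<gamma> \<delta> w 0 = (\<lambda>a z. arctan (c_vec \<gamma> w a z $ 2 / c_vec \<gamma> w a z $ 1))"
| "alpha n \<gamma> \<delta> w (Suc i) = (\<lambda>a z.
     inverse (beta_coef n \<gamma> w (Suc i) a z) *
     ((\<Sum>k=1..i+2. partial k (alpha n \<gamma> \<delta> w i a) z * B_fun n \<gamma> w i a z (z (i + 3)) k)
      + w * (\<Sum>j=1..Suc i. partial j (\<lambda>a. alpha n \<gamma> \<delta> w i a z) a * a (j + 1))
      - inverse (\<delta> (Suc i)) *
          (\<Sum>k=1..i+2. partial k (V_fun n \<gamma> \<delta> w i a) z
                        * D_fun n \<gamma> w i a z (z (i + 3)) (alpha n \<gamma> \<delta> w i a z) k)
      - b_coef n \<gamma> w (Suc i) a z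
      - \<gamma> * (z (i + 3) - alpha n \<gamma> \<delta> w i a z)))"
| "V_fun n \<gamma> \<delta> w 0 = (\<lambda>a z. (sinh (\<gamma> * norm (xi_of z)))\<^sup>2)"
| "V_fun n \<gamma> \<delta> w (Suc i) = (\<lambda>a z.
     V_fun n \<gamma> \<delta> w i a z + 1/2 * \<delta> (Suc i) * (z (i + 3) - alpha n \<gamma> \<delta> w i a z)\<^sup>2)"

definition Psi :: "nat \<Rightarrow> real \<Rightarrow> (nat \<Rightarrow> real) \<Rightarrow>
    real^2 \<Rightarrow> (nat \<Rightarrow> real) \<Rightarrow> (nat \<Rightarrow> real) \<Rightarrow> real^2 \<Rightarrow> real^2" where
  "Psi n \<gamma> \<delta> \<xi> \<sigma> s v =
     (let z = (\<lambda>k. if k = 1 then \<xi> $ 1 else if k = 2 then \<xi> $ 2 else \<sigma> (k - 2));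
          a = (\<lambda>i. if i \<le> n then s i else v $ 2 / v $ 1);
          w = sgn (v $ 1)
      in vector [lam \<gamma> w a z, alpha n \<gamma> \<delta> w n a z])"


section \<open>Control laws and closed loop\<close>

definition Phi :: "nat \<Rightarrow> (nat \<Rightarrow> real) \<Rightarrow> real \<Rightarrow> (nat \<Rightarrow> real) \<Rightarrow>
    coords \<Rightarrow> coords \<Rightarrow> real^2 \<Rightarrow> real^2" where
  "Phi n l \<gamma> \<delta> = (\<lambda>(x, y) (x', y') u'.
     matrix_inv (F_mat n l y) *v
       (\<bar>u' $ 1\<bar> *\<^sub>R Psi n \<gamma> \<delta> (x - x') (\<lambda>i. S_map n l y i - S_map n l y' i)
                        (S_map n l y') (F_mat n l y' *v u')
        + F2_mat n l y' *v u'))"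

definition U_law :: "nat \<Rightarrow> (nat \<Rightarrow> real) \<Rightarrow> real \<Rightarrow> (nat \<Rightarrow> real) \<Rightarrow> real \<Rightarrow>
    real \<Rightarrow> coords \<Rightarrow> (real \<Rightarrow> real^2) \<Rightarrow> real^2" where
  "U_law n l \<gamma> \<delta> \<epsilon> t q xD =
     (case maneuver n l \<epsilon> (mode_of n q) xD of (qD, uD) \<Rightarrow> Phi n l \<gamma> \<delta> q (qD t) (uD t))"

text \<open>Solutions take values in the whole domain \<open>\<K>\<close> of the closed-loop vector field; that they
  remain in one cell is not part of the definition.\<close>

definition closed_loop_solution :: "nat \<Rightarrow> (nat \<Rightarrow> real) \<Rightarrow> real \<Rightarrow> (nat \<Rightarrow> real) \<Rightarrow> real \<Rightarrow>
    (real \<Rightarrow> real^2) \<Rightarrow> real set \<Rightarrow> (real \<Rightarrow> coords) \<Rightarrow> bool" where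
  "closed_loop_solution n l \<gamma> \<delta> \<epsilon> xD I q \<longleftrightarrow>
     (\<forall>t\<in>I. q t \<in> (\<Union>\<mu>\<in>modes n. M_cell n \<mu>) \<and>
       (let y = snd (q t); u = U_law n l \<gamma> \<delta> \<epsilon> t (q t) xD in
         ((\<lambda>\<tau>. fst (q \<tau>) $ 1) has_real_derivative u $ 1 * cos (y 1)) (at t within I) \<and>
         ((\<lambda>\<tau>. fst (q \<tau>) $ 2) has_real_derivative u $ 1 * sin (y 1)) (at t within I) \<and>
         (\<forall>i\<in>{1..n-1}. ((\<lambda>\<tau>. snd (q \<tau>) i) has_real_derivative u $ 1 * eta l i y) (at t within I)) \<and>
         ((\<lambda>\<tau>. snd (q \<tau>) n) has_real_derivative u $ 2) (at t within I)))"

end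

(* In the coordinates s = S(y) the model becomes the chain x' = v1 (cos s1, sin s1),
   s_i' = v1 s_{i+1}, s_n' = v2, and under the control law the error z = (x - xD, s - sD)
   satisfies z' = |v1D| B_n(z, alpha_n). The recursion for alpha_i is the backstepping
   construction: it makes V_n' = -2 gamma |v1D| V_n along solutions, so V_n decays exponentially.
   Its sublevel sets are bounded uniformly along the reference, hence solutions exist for all
   time, and since alpha_i vanishes at z = 0, convergence propagates from xi to sigma_1, ...,
   sigma_n. The inverse of S on a cell is explicit (one arctan per coordinate), and Lipschitz
   bounds on compact sets carry the limits over to y and u. *)

theory Submission
  imports Defs
begin

section \<open>A class of smooth functions of finitely many coordinates\<close>

text \<open>The recursion for \<open>alpha\<close> is written with \<open>deriv\<close>, whose value
  means nothing without differentiability, so joint smoothness of all \<alpha>_i and V_i in z and a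
  has to precede every identity about them. Two ingredients look singular: the expressions in
  |\<xi>| at \<xi> = 0, and D_i, defined by cases at \<zeta> = \<eta>. One entire function,
  \<open>sinhc\<close>, removes both singularities.

  The rate 2\<gamma> comes from the match between the saturated feedback and V_0: for \<sigma>_1 =
  \<alpha>_0 the position error shrinks radially at speed tanh(\<gamma>|\<xi>|) per unit of |v_1^D|,
  and the radial derivative 2\<gamma> sinh cosh of sinh^2 times -tanh is -2\<gamma> sinh^2. The
  saturation tanh < 1 also keeps c away from 0, hence \<lambda> of constant sign; this gives the
  direction of motion.

  The heading s_1^D may wind without bound, while s_2^D, ..., s_{n+1}^D are bounded. Uniform
  constants therefore rest on 2 pi periodicity in a_1 and on the fact that F and the angles y_2,
  ..., y_n do not depend on the heading.\<close>

definition entire :: "(real \<Rightarrow> real) \<Rightarrow> bool" where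
  "entire g \<longleftrightarrow> (\<exists>c. \<forall>x. summable (\<lambda>k. c k * x ^ k) \<and> g x = (\<Sum>k. c k * x ^ k))"

lemma entire_deriv:
  assumes "entire g"
  obtains g' where "entire g'" "\<And>x. (g has_real_derivative g' x) (at x)"
proof -
  obtain c where c: "\<And>x. summable (\<lambda>k. c k * x ^ k)" "\<And>x. g x = (\<Sum>k. c k * x ^ k)"
    using assms unfolding entire_def by blast
  define g' where "g' x = (\<Sum>k. diffs c k * x ^ k)" for x
  have s: "summable (\<lambda>k. diffs c k * x ^ k)" for x :: real
    by (rule termdiff_converges_all) (use c(1) in simp)
  have "DERIV (\<lambda>x. \<Sum>k. c k * x ^ k) x :> g' x" for x
    unfolding g'_def by (rule termdiffs_strong_converges_everywhere) (use c(1) in simp)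
  moreover have "g = (\<lambda>x. \<Sum>k. c k * x ^ k)"
    using c(2) by blast
  ultimately have "\<And>x. (g has_real_derivative g' x) (at x)"
    by simp
  moreover have "entire g'"
    unfolding entire_def using s g'_def by blast
  ultimately show ?thesis using that by blast
qed

lemma entire_continuous: "entire g \<Longrightarrow> continuous_on S g"
  by (meson DERIV_isCont continuous_at_imp_continuous_on entire_deriv)

lemma entire_sin: "entire sin"
  unfolding entire_def
  using sin_converges[where 'a = real] by (intro exI[of _ sin_coeff]) (auto simp: sums_iff)

lemma entire_cos: "entire cos"
  unfolding entire_def
  using cos_converges[where 'a = real] by (intro exI[of _ cos_coeff]) (auto simp: sums_iff)

text \<open>A syntactic stand-in for \<open>C\<^sup>\<infinity>\<close>: the class is closed under partial derivatives because entire
  functions are, and the chain rule, locality and continuity follow by induction, so that no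
  multivariate calculus is needed. A set of variables \<open>I\<close> on which the function depends is part of
  the predicate.\<close>

inductive smooth :: "'i set \<Rightarrow> ('i \<Rightarrow> real) set \<Rightarrow> (('i \<Rightarrow> real) \<Rightarrow> real) \<Rightarrow> bool"
  for I :: "'i set" and U :: "('i \<Rightarrow> real) set" where
  smooth_const: "smooth I U (\<lambda>x. c)"
| smooth_coord: "i \<in> I \<Longrightarrow> smooth I U (\<lambda>x. x i)"
| smooth_add: "smooth I U f \<Longrightarrow> smooth I U g \<Longrightarrow> smooth I U (\<lambda>x. f x + g x)"
| smooth_mult: "smooth I U f \<Longrightarrow> smooth I U g \<Longrightarrow> smooth I U (\<lambda>x. f x * g x)"
| smooth_inverse: "smooth I U f \<Longrightarrow> (\<And>x. x \<in> U \<Longrightarrow> f x \<noteq> 0) \<Longrightarrow> smooth I U (\<lambda>x. inverse (f x))"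
| smooth_arctan: "smooth I U f \<Longrightarrow> smooth I U (\<lambda>x. arctan (f x))"
| smooth_entire: "entire g \<Longrightarrow> smooth I U f \<Longrightarrow> smooth I U (\<lambda>x. g (f x))"

lemma smooth_uminus: "smooth I U f \<Longrightarrow> smooth I U (\<lambda>x. - f x)"
  using smooth_mult[OF smooth_const[of I U "-1"]] by fastforce

lemma smooth_diff: "smooth I U f \<Longrightarrow> smooth I U g \<Longrightarrow> smooth I U (\<lambda>x. f x - g x)"
  using smooth_add[OF _ smooth_uminus] by fastforce

lemma smooth_divide:
  "smooth I U f \<Longrightarrow> smooth I U g \<Longrightarrow> (\<And>x. x \<in> U \<Longrightarrow> g x \<noteq> 0) \<Longrightarrow> smooth I U (\<lambda>x. f x / g x)"
  unfolding divide_inverse by (intro smooth_mult smooth_inverse)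

lemma smooth_power: "smooth I U f \<Longrightarrow> smooth I U (\<lambda>x. f x ^ m)"
  by (induction m) (auto intro: smooth_const smooth_mult)

lemma smooth_sum: "(\<And>j. j \<in> J \<Longrightarrow> smooth I U (f j)) \<Longrightarrow> smooth I U (\<lambda>x. \<Sum>j\<in>J. f j x)"
  by (induction J rule: infinite_finite_induct) (auto intro: smooth_const smooth_add)

lemma smooth_prod: "(\<And>j. j \<in> J \<Longrightarrow> smooth I U (f j)) \<Longrightarrow> smooth I U (\<lambda>x. \<Prod>j\<in>J. f j x)"
  by (induction J rule: infinite_finite_induct) (auto intro: smooth_const smooth_mult)

lemma smooth_sin: "smooth I U f \<Longrightarrow> smooth I U (\<lambda>x. sin (f x))"
  and smooth_cos: "smooth I U f \<Longrightarrow> smooth I U (\<lambda>x. cos (f x))"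
  using smooth_entire entire_sin entire_cos by blast+

lemma smooth_tan:
  "smooth I U f \<Longrightarrow> (\<And>x. x \<in> U \<Longrightarrow> cos (f x) \<noteq> 0) \<Longrightarrow> smooth I U (\<lambda>x. tan (f x))"
  unfolding tan_def by (intro smooth_divide smooth_sin smooth_cos)

lemmas smooth_intros = smooth_const smooth_coord smooth_add smooth_mult smooth_inverse
  smooth_arctan smooth_uminus smooth_diff smooth_divide smooth_power smooth_sum smooth_prod
  smooth_sin smooth_cos smooth_tan

lemma smooth_compose:
  assumes "smooth I U f" "\<And>i. i \<in> I \<Longrightarrow> smooth J W (\<lambda>x. Y x i)" "\<And>x. x \<in> W \<Longrightarrow> Y x \<in> U"
  shows "smooth J W (\<lambda>x. f (Y x))"
  using assms(1) by induction (use assms(2,3) in \<open>auto intro: smooth.intros\<close>)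

lemma smooth_mono:
  assumes "smooth I U f" "I \<subseteq> J" "W \<subseteq> U"
  shows "smooth J W f"
  by (rule smooth_compose[OF assms(1), of J W "\<lambda>x. x"]) (use assms(2,3) in \<open>auto intro: smooth_coord\<close>)

lemma smooth_local:
  assumes "smooth I U f" "\<And>i. i \<in> I \<Longrightarrow> x i = y i"
  shows "f x = f y"
  using assms(1) by induction (use assms(2) in auto)

lemma smooth_continuous: "smooth I U f \<Longrightarrow> continuous_on U f"
proof (induction rule: smooth.induct)
  case (smooth_coord i)
  then show ?case
    by (intro continuous_on_subset[OF continuous_on_product_coordinates]) simp
next
  case (smooth_entire g f)
  then show ?case
    by (intro continuous_on_compose2[OF entire_continuous[of g UNIV]]) auto
qed (auto intro!: continuous_intros)

section \<open>Partial derivatives and the chain rule along curves\<close>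

text \<open>A version of \<open>partial\<close> for arbitrary index types: functions of z and a
  together will be treated as functions on the sum type \<open>nat + nat\<close>.\<close>

definition pd :: "'i \<Rightarrow> (('i \<Rightarrow> real) \<Rightarrow> real) \<Rightarrow> ('i \<Rightarrow> real) \<Rightarrow> real" where
  "pd i f x = deriv (\<lambda>t. f (x(i := t))) (x i)"

lemma partial_eq_pd: "partial = pd"
  by (intro ext) (simp add: partial_def pd_def)

text \<open>The chain rule along curves is taken as the definition of a gradient, which avoids
  Frechet derivatives on a function space. Derivatives are within an arbitrary set, so one-sided
  derivatives at time 0 are included.\<close>

definition has_grad :: "'i set \<Rightarrow> ('i \<Rightarrow> real) set \<Rightarrow> (('i \<Rightarrow> real) \<Rightarrow> real) \<Rightarrow>
    ('i \<Rightarrow> ('i \<Rightarrow> real) \<Rightarrow> real) \<Rightarrow> bool" where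
  "has_grad I U f f' \<longleftrightarrow> (\<forall>c c' t S. c t \<in> U \<longrightarrow>
     (\<forall>i\<in>I. ((\<lambda>s. c s i) has_real_derivative c' i) (at t within S)) \<longrightarrow>
     ((\<lambda>s. f (c s)) has_real_derivative (\<Sum>i\<in>I. f' i (c t) * c' i)) (at t within S))"

lemma has_gradI:
  assumes "\<And>c c' t S. c t \<in> U \<Longrightarrow>
     (\<And>i. i\<in>I \<Longrightarrow> ((\<lambda>s. c s i) has_real_derivative c' i) (at t within S)) \<Longrightarrow>
     ((\<lambda>s. f (c s)) has_real_derivative (\<Sum>i\<in>I. f' i (c t) * c' i)) (at t within S)"
  shows "has_grad I U f f'"
  unfolding has_grad_def using assms by blast

lemma has_gradD:
  assumes "has_grad I U f f'" "c t \<in> U"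
     "\<And>i. i\<in>I \<Longrightarrow> ((\<lambda>s. c s i) has_real_derivative c' i) (at t within S)"
   shows "((\<lambda>s. f (c s)) has_real_derivative (\<Sum>i\<in>I. f' i (c t) * c' i)) (at t within S)"
  using assms unfolding has_grad_def by blast

text \<open>Each candidate gradient is again built by the operations of the class, so a single
  induction gives both the chain rule and closure under differentiation.\<close>

lemma smooth_has_grad:
  assumes "finite I" "smooth I U f"
  shows "\<exists>f'. (\<forall>i. smooth I U (f' i)) \<and> has_grad I U f f'"
  using assms(2)
proof induction
  case (smooth_const c)
  show ?case
    by (rule exI[of _ "\<lambda>i x. 0"]) (simp add: has_grad_def smooth.smooth_const)
next
  case (smooth_coord i)
  then show ?case
    using assms(1)
    by (intro exI[of _ "\<lambda>j x. if j = i then 1 else 0"])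
      (simp add: has_grad_def smooth.smooth_const if_distribR if_distrib cong: if_cong)
next
  case (smooth_add f g)
  then obtain f' g' where fg: "\<And>i. smooth I U (f' i)" "has_grad I U f f'"
    "\<And>i. smooth I U (g' i)" "has_grad I U g g'"
    by blast
  show ?case
  proof (intro exI[of _ "\<lambda>i x. f' i x + g' i x"] conjI allI has_gradI)
    fix c :: "real \<Rightarrow> 'a \<Rightarrow> real" and c' t S
    assume c: "c t \<in> U" "\<And>i. i \<in> I \<Longrightarrow> ((\<lambda>s. c s i) has_real_derivative c' i) (at t within S)"
    show "((\<lambda>s. f (c s) + g (c s)) has_real_derivative
          (\<Sum>i\<in>I. (f' i (c t) + g' i (c t)) * c' i)) (at t within S)"
      by (rule DERIV_cong[OF DERIV_add[OF has_gradD[OF fg(2) c] has_gradD[OF fg(4) c]]])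
        (simp_all add: sum.distrib ring_distribs)
  qed (rule smooth.smooth_add[OF fg(1,3)])
next
  case (smooth_mult f g)
  then obtain f' g' where fg: "\<And>i. smooth I U (f' i)" "has_grad I U f f'"
    "\<And>i. smooth I U (g' i)" "has_grad I U g g'"
    by blast
  show ?case
  proof (intro exI[of _ "\<lambda>i x. f' i x * g x + g' i x * f x"] conjI allI has_gradI)
    fix c :: "real \<Rightarrow> 'a \<Rightarrow> real" and c' t S
    assume c: "c t \<in> U" "\<And>i. i \<in> I \<Longrightarrow> ((\<lambda>s. c s i) has_real_derivative c' i) (at t within S)"
    show "((\<lambda>s. f (c s) * g (c s)) has_real_derivative
          (\<Sum>i\<in>I. (f' i (c t) * g (c t) + g' i (c t) * f (c t)) * c' i)) (at t within S)"
      by (rule DERIV_cong[OF DERIV_mult[OF has_gradD[OF fg(2) c] has_gradD[OF fg(4) c]]])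
        (simp_all add: sum.distrib sum_distrib_left sum_distrib_right algebra_simps)
  qed (rule smooth.smooth_add[OF smooth.smooth_mult[OF fg(1) smooth_mult.hyps(2)] smooth.smooth_mult[OF fg(3) smooth_mult.hyps(1)]])
next
  case (smooth_inverse f)
  then obtain f' where f: "\<And>i. smooth I U (f' i)" "has_grad I U f f'"
    by blast
  show ?case
  proof (intro exI[of _ "\<lambda>i x. - (inverse (f x) * f' i x * inverse (f x))"] conjI allI has_gradI)
    fix c :: "real \<Rightarrow> 'a \<Rightarrow> real" and c' t S
    assume c: "c t \<in> U" "\<And>i. i \<in> I \<Longrightarrow> ((\<lambda>s. c s i) has_real_derivative c' i) (at t within S)"
    show "((\<lambda>s. inverse (f (c s))) has_real_derivative
          (\<Sum>i\<in>I. - (inverse (f (c t)) * f' i (c t) * inverse (f (c t))) * c' i)) (at t within S)"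
      by (rule DERIV_cong[OF DERIV_inverse'[OF has_gradD[OF f(2) c] smooth_inverse.hyps(2)[OF c(1)]]])
        (simp_all add: sum_distrib_left sum_distrib_right mult_ac flip: sum_negf)
  qed (rule smooth_uminus[OF smooth.smooth_mult[OF smooth.smooth_mult[OF _ f(1)]]],
      (rule smooth.smooth_inverse[OF smooth_inverse.hyps], assumption)+)
next
  case (smooth_arctan f)
  then obtain f' where f: "\<And>i. smooth I U (f' i)" "has_grad I U f f'"
    by blast
  have nz: "1 + (f x)\<^sup>2 \<noteq> 0" for x
    by (metis power_one sum_power2_eq_zero_iff zero_neq_one)
  show ?case
  proof (intro exI[of _ "\<lambda>i x. inverse (1 + (f x)\<^sup>2) * f' i x"] conjI allI)
    show "smooth I U (\<lambda>x. inverse (1 + (f x)\<^sup>2) * f' i x)" for i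
      by (rule smooth_mult[OF smooth_inverse[OF smooth_add[OF smooth_const smooth_power[OF smooth_arctan.hyps]] nz] f(1)])
    show "has_grad I U (\<lambda>x. arctan (f x)) (\<lambda>i x. inverse (1 + (f x)\<^sup>2) * f' i x)"
    proof (rule has_gradI)
      fix c :: "real \<Rightarrow> 'a \<Rightarrow> real" and c' t S
      assume c: "c t \<in> U" "\<And>i. i \<in> I \<Longrightarrow> ((\<lambda>s. c s i) has_real_derivative c' i) (at t within S)"
      show "((\<lambda>s. arctan (f (c s))) has_real_derivative
          (\<Sum>i\<in>I. inverse (1 + (f (c t))\<^sup>2) * f' i (c t) * c' i)) (at t within S)"
        by (rule DERIV_cong[OF DERIV_chain2[OF DERIV_arctan has_gradD[OF f(2) c]]])
          (simp_all add: sum_distrib_left mult.assoc)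
    qed
  qed
next
  case (smooth_entire g f)
  then obtain f' where f: "\<And>i. smooth I U (f' i)" "has_grad I U f f'"
    by blast
  obtain g' where g: "entire g'" "\<And>x. (g has_real_derivative g' x) (at x)"
    using entire_deriv[OF smooth_entire.hyps(1)] by metis
  show ?case
  proof (intro exI[of _ "\<lambda>i x. g' (f x) * f' i x"] conjI allI)
    show "smooth I U (\<lambda>x. g' (f x) * f' i x)" for i
      by (rule smooth_mult[OF smooth.smooth_entire[OF g(1) smooth_entire.hyps(2)] f(1)])
    show "has_grad I U (\<lambda>x. g (f x)) (\<lambda>i x. g' (f x) * f' i x)"
    proof (rule has_gradI)
      fix c :: "real \<Rightarrow> 'a \<Rightarrow> real" and c' t S
      assume c: "c t \<in> U" "\<And>i. i \<in> I \<Longrightarrow> ((\<lambda>s. c s i) has_real_derivative c' i) (at t within S)"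
      show "((\<lambda>s. g (f (c s))) has_real_derivative
          (\<Sum>i\<in>I. g' (f (c t)) * f' i (c t) * c' i)) (at t within S)"
        by (rule DERIV_cong[OF DERIV_chain2[OF g(2) has_gradD[OF f(2) c]]])
          (simp_all add: sum_distrib_left mult.assoc)
    qed
  qed
qed

lemma has_grad_line:
  assumes "finite I" "has_grad I U f f'" "x \<in> U"
  shows "((\<lambda>t. f (x(i := t))) has_real_derivative (if i \<in> I then f' i x else 0)) (at (x i))"
proof -
  have "((\<lambda>t. (x(i := t)) j) has_real_derivative (if j = i then 1 else 0)) (at (x i))" for j
    by auto
  from has_gradD[OF assms(2), of "\<lambda>t. x(i := t)" "x i" "\<lambda>j. if j = i then 1 else 0", OF _ this]
  show ?thesis
    using assms(1,3) by (simp add: if_distribR if_distrib cong: if_cong)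
qed

lemma smooth_line:
  assumes "finite I" "smooth I U f" "x \<in> U"
  shows "((\<lambda>t. f (x(i := t))) has_real_derivative pd i f x) (at (x i))"
  using smooth_has_grad[OF assms(1,2)] has_grad_line[OF assms(1) _ assms(3)] DERIV_imp_deriv
  unfolding pd_def by metis

lemma pd_outside: "smooth I U f \<Longrightarrow> i \<notin> I \<Longrightarrow> pd i f x = 0"
proof -
  assume "smooth I U f" "i \<notin> I"
  then have "(\<lambda>t. f (x(i := t))) = (\<lambda>t. f x)"
    by (intro ext) (auto elim!: smooth_local)
  then show ?thesis by (simp add: pd_def)
qed

text \<open>Membership in the class concerns a formula for the total function, whereas
  \<open>pd\<close> is under control only at points of U. Hence the partial derivative is only shown
  to agree on U with a member of the class.\<close>

lemma smooth_pd_ex: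
  assumes "finite I" "smooth I U f"
  obtains g where "smooth I U g" "\<And>x. x \<in> U \<Longrightarrow> pd i f x = g x"
proof -
  obtain f' where f: "\<And>i. smooth I U (f' i)" "has_grad I U f f'"
    using smooth_has_grad[OF assms] by blast
  have "pd i f x = (if i \<in> I then f' i x else 0)" if "x \<in> U" for x
    using DERIV_imp_deriv[OF has_grad_line[OF assms(1) f(2) that]] by (simp add: pd_def)
  then show ?thesis
    using that[of "if i \<in> I then f' i else (\<lambda>x. 0)"] f(1) smooth_const[of I U 0]
    by (cases "i \<in> I") auto
qed

lemma smooth_pd:
  assumes "finite I" "smooth I UNIV f"
  shows "smooth I UNIV (pd i f)"
proof -
  obtain g where "smooth I UNIV g" "\<And>x. pd i f x = g x"
    using smooth_pd_ex[OF assms] by auto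
  then have "pd i f = g"
    by blast
  with \<open>smooth I UNIV g\<close> show ?thesis
    by simp
qed

lemma smooth_chain:
  assumes "finite I" "smooth I U f" "c t \<in> U"
     "\<And>i. i\<in>I \<Longrightarrow> ((\<lambda>s. c s i) has_real_derivative c' i) (at t within S)"
   shows "((\<lambda>s. f (c s)) has_real_derivative (\<Sum>i\<in>I. pd i f (c t) * c' i)) (at t within S)"
proof -
  obtain f' where f: "\<And>i. smooth I U (f' i)" "has_grad I U f f'"
    using smooth_has_grad[OF assms(1,2)] by blast
  have "pd i f (c t) = f' i (c t)" if "i \<in> I" for i
    using DERIV_imp_deriv[OF has_grad_line[OF assms(1) f(2) assms(3), of i]] that
    by (simp add: pd_def)
  then show ?thesis
    using has_gradD[OF f(2) assms(3,4)] by simp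
qed

section \<open>Uniform bounds and Lipschitz constants on boxes\<close>

text \<open>The box is compact in the product topology by Tychonoff, and the function is continuous.
  Coordinates outside I may be unbounded; by locality they can be replaced by 0.\<close>

lemma smooth_bounded:
  assumes "smooth I UNIV f"
  obtains M where "M \<ge> 0" "\<And>x. (\<And>i. i \<in> I \<Longrightarrow> \<bar>x i\<bar> \<le> R) \<Longrightarrow> \<bar>f x\<bar> \<le> M"
proof -
  have "compact (Pi\<^sub>E UNIV (\<lambda>i::'a. {-R..R}))"
    using compactin_PiE[of "\<lambda>i::'a. euclideanreal" UNIV "\<lambda>i. {-R..R}"]
    by (simp add: euclidean_product_topology)
  then have "bounded (f ` Pi\<^sub>E UNIV (\<lambda>i. {-R..R}))"
    by (intro compact_imp_bounded compact_continuous_image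
        continuous_on_subset[OF smooth_continuous[OF assms]]) auto
  then obtain M where M: "\<And>x. x \<in> Pi\<^sub>E UNIV (\<lambda>i. {-R..R}) \<Longrightarrow> \<bar>f x\<bar> \<le> M"
    unfolding bounded_iff by auto
  show ?thesis
  \<comment> \<open>The value at 0 covers R < 0, where the hypothesis on x forces I to be empty and
    f to be constant.\<close>
  proof (rule that[of "max M \<bar>f (\<lambda>_. 0)\<bar>"])
    fix x assume x: "\<And>i. i \<in> I \<Longrightarrow> \<bar>x i\<bar> \<le> R"
    define y where "y = (\<lambda>i. if i \<in> I then x i else 0)"
    have eq: "f x = f y"
      by (rule smooth_local[OF assms]) (simp add: y_def)
    show "\<bar>f x\<bar> \<le> max M \<bar>f (\<lambda>_. 0)\<bar>"
    proof (cases "R \<ge> 0")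
      case True
      then have "y \<in> Pi\<^sub>E UNIV (\<lambda>i. {-R..R})"
        using x by (fastforce simp: y_def PiE_def abs_le_iff)
      then show ?thesis
        using M eq by (metis max.coboundedI1)
    next
      case False
      then have "I = {}"
        using x by fastforce
      then show ?thesis
        using eq by (simp add: y_def)
    qed
  qed auto
qed

text \<open>Mean value theorem on the segment from y to x, which stays in the box by convexity and
  on which the partial derivatives are bounded.\<close>

lemma smooth_Lipschitz:
  assumes "finite I" "smooth I UNIV f"
  obtains L where "L \<ge> 0" "\<And>x y. (\<And>i. i \<in> I \<Longrightarrow> \<bar>x i\<bar> \<le> R) \<Longrightarrow> (\<And>i. i \<in> I \<Longrightarrow> \<bar>y i\<bar> \<le> R)
    \<Longrightarrow> \<bar>f x - f y\<bar> \<le> L * (\<Sum>i\<in>I. \<bar>x i - y i\<bar>)"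
proof -
  have "\<exists>M. M \<ge> 0 \<and> (\<forall>x. (\<forall>i\<in>I. \<bar>x i\<bar> \<le> R) \<longrightarrow> \<bar>pd j f x\<bar> \<le> M)" for j
    using smooth_bounded[OF smooth_pd[OF assms], of R j] by metis
  then obtain M where M: "\<And>j. M j \<ge> 0" "\<And>j x. (\<forall>i\<in>I. \<bar>x i\<bar> \<le> R) \<Longrightarrow> \<bar>pd j f x\<bar> \<le> M j"
    by metis
  show ?thesis
  proof (rule that[of "\<Sum>j\<in>I. M j"])
    show "0 \<le> (\<Sum>j\<in>I. M j)"
      by (simp add: M(1) sum_nonneg)
    fix x y assume xy: "\<And>i. i \<in> I \<Longrightarrow> \<bar>x i\<bar> \<le> R" "\<And>i. i \<in> I \<Longrightarrow> \<bar>y i\<bar> \<le> R"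
    define c where "c = (\<lambda>s i. y i + s * (x i - y i))"
    have "((\<lambda>s. f (c s)) has_real_derivative (\<Sum>i\<in>I. pd i f (c s) * (x i - y i))) (at s)" for s
      by (rule smooth_chain[OF assms]) (auto simp: c_def intro!: derivative_eq_intros)
    then have "\<exists>z. z > 0 \<and> z < 1 \<and> f (c 1) - f (c 0) = (1 - 0) * (\<Sum>i\<in>I. pd i f (c z) * (x i - y i))"
      by (intro MVT2) auto
    then obtain s where s: "0 < s" "s < 1" "f (c 1) - f (c 0) = (\<Sum>i\<in>I. pd i f (c s) * (x i - y i))"
      by auto
    have "\<bar>c s i\<bar> \<le> R" if "i \<in> I" for i
    proof -
      have "\<bar>c s i\<bar> = \<bar>(1 - s) * y i + s * x i\<bar>"
        by (simp add: c_def algebra_simps)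
      also have "\<dots> \<le> (1 - s) * \<bar>y i\<bar> + s * \<bar>x i\<bar>"
        using s(1,2) abs_triangle_ineq[of "(1 - s) * y i" "s * x i"] by (simp add: abs_mult)
      also have "\<dots> \<le> (1 - s) * R + s * R"
        using s(1,2) xy[OF that] by (intro add_mono mult_left_mono) auto
      finally show ?thesis by (simp add: algebra_simps)
    qed
    then have b: "\<bar>pd i f (c s)\<bar> \<le> M i" for i
      using M(2) by blast
    have "f (c 1) = f x" "f (c 0) = f y"
      by (simp_all add: c_def)
    then have "\<bar>f x - f y\<bar> = \<bar>\<Sum>i\<in>I. pd i f (c s) * (x i - y i)\<bar>"
      using s(3) by simp
    also have "\<dots> \<le> (\<Sum>i\<in>I. \<bar>pd i f (c s)\<bar> * \<bar>x i - y i\<bar>)"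
      using sum_abs[of "\<lambda>i. pd i f (c s) * (x i - y i)" I] by (simp add: abs_mult)
    also have "\<dots> \<le> (\<Sum>i\<in>I. (\<Sum>j\<in>I. M j) * \<bar>x i - y i\<bar>)"
    proof (intro sum_mono mult_right_mono)
      fix i assume "i \<in> I"
      then have "M i \<le> (\<Sum>j\<in>I. M j)"
        using assms(1) M(1) by (intro member_le_sum) auto
      then show "\<bar>pd i f (c s)\<bar> \<le> (\<Sum>j\<in>I. M j)"
        using b[of i] by linarith
    qed auto
    finally show "\<bar>f x - f y\<bar> \<le> (\<Sum>j\<in>I. M j) * (\<Sum>i\<in>I. \<bar>x i - y i\<bar>)"
      by (simp add: sum_distrib_left)
  qed
qed

section \<open>Ordinary differential equations\<close>

text \<open>Since t < t + 1, the two filters agree near t. Facts obtained on compact intervals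
  thereby pass to the half-line.\<close>

lemma DERIV_within_atLeast:
  assumes "(f has_real_derivative D) (at t within {a..t+1})"
  shows "(f has_real_derivative D) (at t within {a::real..})"
proof -
  have "at t within {a..} = at t within {a..t+1}"
    by (rule at_within_nhd[of t "{..<t+1}"]) auto
  then show ?thesis using assms by simp
qed

lemma DERIV_nonpos_imp_le_atLeastAtMost:
  fixes f :: "real \<Rightarrow> real"
  assumes "a \<le> b" "\<And>t. a \<le> t \<Longrightarrow> t \<le> b \<Longrightarrow> (f has_real_derivative f' t) (at t within {a..b})"
    "\<And>t. a \<le> t \<Longrightarrow> t \<le> b \<Longrightarrow> f' t \<le> 0"
  shows "f b \<le> f a"
proof (rule DERIV_nonpos_imp_decreasing_open[OF assms(1)])
  show "\<exists>y. DERIV f t :> y \<and> y \<le> 0" if "a < t" "t < b" for t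
    using assms(2,3)[of t] that by (auto simp: at_within_Icc_at)
  show "continuous_on {a..b} f"
    using assms(2) by (intro DERIV_continuous_on) auto
qed

text \<open>Gronwall's inequality for E, the sum of the squares of the d_i: from E' \<le> K E the
  function E exp(-K t) is nonincreasing, and it starts at 0. In the applications d is the difference
  of two solutions.\<close>

lemma differential_inequality_unique:
  fixes d d' :: "'i \<Rightarrow> real \<Rightarrow> real"
  assumes I: "finite I" "i \<in> I" and T: "T \<ge> 0"
    and d: "\<And>i t. i \<in> I \<Longrightarrow> 0 \<le> t \<Longrightarrow> t \<le> T \<Longrightarrow> (d i has_real_derivative d' i t) (at t within {0..T})"
    and d0: "\<And>i. i \<in> I \<Longrightarrow> d i 0 = 0"
    and L: "\<And>i t. i \<in> I \<Longrightarrow> 0 \<le> t \<Longrightarrow> t \<le> T \<Longrightarrow> \<bar>d' i t\<bar> \<le> L * (\<Sum>j\<in>I. \<bar>d j t\<bar>)" "L \<ge> 0"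
  shows "d i T = 0"
proof -
  define E where "E t = (\<Sum>i\<in>I. (d i t)\<^sup>2)" for t
  define E' where "E' t = (\<Sum>i\<in>I. 2 * d i t * d' i t)" for t
  \<comment> \<open>The factor \<open>card I\<close> comes from Cauchy-Schwarz, which bounds the
    square of the sum of the |d_j| by a multiple of E.\<close>
  define K where "K = 2 * L * card I"
  have E: "(E has_real_derivative E' t) (at t within {0..T})" if "0 \<le> t" "t \<le> T" for t
    unfolding E_def[abs_def] E'_def
    using d that by (auto intro!: derivative_eq_intros simp: mult_ac)
  have bound: "E' t \<le> K * E t" if t: "0 \<le> t" "t \<le> T" for t
  proof -
    have "E' t \<le> (\<Sum>i\<in>I. 2 * \<bar>d i t\<bar> * (L * (\<Sum>j\<in>I. \<bar>d j t\<bar>)))"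
      unfolding E'_def
    proof (rule sum_mono)
      fix i assume i: "i \<in> I"
      have "2 * d i t * d' i t \<le> 2 * (\<bar>d i t\<bar> * \<bar>d' i t\<bar>)"
        by (simp add: abs_mult[symmetric])
      also have "\<dots> \<le> 2 * (\<bar>d i t\<bar> * (L * (\<Sum>j\<in>I. \<bar>d j t\<bar>)))"
        using L(1)[OF i t] by (intro mult_left_mono) auto
      finally show "2 * d i t * d' i t \<le> 2 * \<bar>d i t\<bar> * (L * (\<Sum>j\<in>I. \<bar>d j t\<bar>))"
        by (simp add: mult_ac)
    qed
    also have "\<dots> = 2 * L * (\<Sum>j\<in>I. \<bar>d j t\<bar>)\<^sup>2"
      by (simp add: power2_eq_square sum_distrib_left sum_distrib_right mult_ac)
    also have "\<dots> \<le> 2 * L * ((\<Sum>j\<in>I. \<bar>d j t\<bar>\<^sup>2) * card I)"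
      using L(2) sum_squared_le_sum_of_squares[of "\<lambda>j. \<bar>d j t\<bar>" I] I by (intro mult_left_mono) auto
    finally show ?thesis by (simp add: K_def E_def mult_ac)
  qed
  have "E T * exp (- K * T) \<le> E 0 * exp (- K * 0)"
  proof (rule DERIV_nonpos_imp_le_atLeastAtMost[OF T, of "\<lambda>t. E t * exp (- K * t)"])
    fix t assume t: "0 \<le> t" "t \<le> T"
    show "((\<lambda>t. E t * exp (- K * t)) has_real_derivative (E' t - K * E t) * exp (- K * t))
        (at t within {0..T})"
      by (auto intro!: derivative_eq_intros E t simp: algebra_simps)
    show "(E' t - K * E t) * exp (- K * t) \<le> 0"
      using bound[OF t] by (simp add: mult_le_0_iff)
  qed
  then have "E T \<le> 0"
    using d0 by (simp add: E_def mult_le_0_iff)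
  moreover have "(d i T)\<^sup>2 \<le> E T"
    unfolding E_def using I by (intro member_le_sum[of i I "\<lambda>i. (d i T)\<^sup>2"]) auto
  ultimately have "(d i T)\<^sup>2 \<le> 0"
    by linarith
  then show ?thesis by simp
qed

text \<open>Banach's fixed point theorem for the Picard operator, with the norm weighted by
  \<open>exp (- K t)\<close> so that the operator contracts on the whole half-line at once. An \<open>N\<close>-tuple of
  functions is encoded in a single continuous function on \<open>\<real> \<times> \<real>\<close>, piecewise linear in the
  first argument between the integers, because the library's completeness result for bounded
  continuous functions needs a metric domain.\<close>

lemma ode_global_solution:
  fixes g :: "nat \<Rightarrow> real \<Rightarrow> (nat \<Rightarrow> real) \<Rightarrow> real"
  assumes cont: "\<And>i x. i \<in> {1..N} \<Longrightarrow> (\<And>j. continuous_on {0..} (x j)) \<Longrightarrow>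
      continuous_on {0..} (\<lambda>t. g i t (\<lambda>j. x j t))"
    and bound: "\<And>i t x. i \<in> {1..N} \<Longrightarrow> t \<ge> 0 \<Longrightarrow> \<bar>g i t x\<bar> \<le> M"
    and lip: "\<And>i t x y. i \<in> {1..N} \<Longrightarrow> t \<ge> 0 \<Longrightarrow>
      \<bar>g i t x - g i t y\<bar> \<le> L * (\<Sum>j=1..N. \<bar>x j - y j\<bar>)" and L: "L \<ge> 0" and M: "M \<ge> 0"
  obtains x where "\<And>i. i \<in> {1..N} \<Longrightarrow> x i 0 = ini i"
    "\<And>i t. i \<in> {1..N} \<Longrightarrow> t \<ge> 0 \<Longrightarrow>
      (x i has_real_derivative g i t (\<lambda>j. x j t)) (at t within {0..})"
proof -
  \<comment> \<open>The contraction constant will be N (N L) / K: one N from the sum in the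
    Lipschitz bound, one from adding the N components. The choice makes it at most 1/2, and the
    summand 1 keeps K positive when N or L is 0.\<close>
  define K where "K = 2 * (N * (N * L)) + 1"
  have K: "K > 0" using L by (simp add: K_def add_nonneg_pos)
  \<comment> \<open>Reads off the j-th component at the integer point j and undoes the exponential
    weight.\<close>
  define st :: "((real \<times> real) \<Rightarrow>\<^sub>C real) \<Rightarrow> nat \<Rightarrow> real \<Rightarrow> real" where
    "st X = (\<lambda>j s. exp (K * s) * apply_bcontfun X (real j, s))" for X
  define tent where "tent i r = max 0 (1 - \<bar>r - real i\<bar>)" for i :: nat and r
  have tent: "0 \<le> tent i r" "tent i r \<le> 1" for i r
    by (simp_all add: tent_def)
  have tent_nat: "tent i (real j) = (if i = j then 1 else 0)" for i j
    by (auto simp: tent_def)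
  define P where "P X i t = ini i + integral {0..t} (\<lambda>s. g i s (\<lambda>j. st X j s))" for X i t
  \<comment> \<open>The Picard iterate, weighted and encoded again. Negative times take the value at
    0, so that the result is continuous on the whole plane.\<close>
  define op where "op X = (\<lambda>(r, t). \<Sum>i=1..N. tent i r * (exp (- K * max t 0) * P X i (max t 0)))" for X
  have st_cont: "continuous_on S (st X j)" for X j S
    unfolding st_def
    by (intro continuous_intros continuous_on_compose2[OF continuous_on_apply_bcontfun[of UNIV X]]) auto
  have gc: "continuous_on {0..t} (\<lambda>s. g i s (\<lambda>j. st X j s))" if "i \<in> {1..N}" for X i t
    by (rule continuous_on_subset[OF cont[OF that st_cont]]) auto
  have gi: "(\<lambda>s. g i s (\<lambda>j. st X j s)) integrable_on {0..t}" if "i \<in> {1..N}" for X i t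
    by (rule integrable_continuous_interval[OF gc[OF that]])
  have Pd: "(P X i has_real_derivative g i t (\<lambda>j. st X j t)) (at t within {0..})"
    if "i \<in> {1..N}" "t \<ge> 0" for X i t
  proof (rule DERIV_within_atLeast)
    have "((\<lambda>t. integral {0..t} (\<lambda>s. g i s (\<lambda>j. st X j s))) has_real_derivative
        g i t (\<lambda>j. st X j t)) (at t within {0..t+1})"
      by (rule integral_has_real_derivative[OF gc[OF that(1)]]) (use that in auto)
    then show "(P X i has_real_derivative g i t (\<lambda>j. st X j t)) (at t within {0..t+1})"
      unfolding P_def[abs_def] by (auto intro!: derivative_eq_intros)
  qed
  have op_cont: "continuous_on UNIV (op X)" for X
  proof -
    have "continuous_on UNIV (\<lambda>p. P X i (max (snd p) 0))" if "i \<in> {1..N}" for i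
    proof -
      have "continuous_on {0..} (P X i)"
        using Pd[OF that] by (intro DERIV_continuous_on) auto
      then show ?thesis
        by (rule continuous_on_compose2) (auto intro!: continuous_intros)
    qed
    then show ?thesis
      unfolding op_def tent_def case_prod_beta by (intro continuous_intros) auto
  qed
  have exp_int: "((\<lambda>s. exp (K * s)) has_integral (exp (K * t) - 1) / K) {0..t}" if "t \<ge> 0" for t
  proof -
    have "((\<lambda>s. exp (K * s)) has_integral (exp (K * t) / K - exp (K * 0) / K)) {0..t}"
      using K that
      by (intro fundamental_theorem_of_calculus)
        (auto intro!: derivative_eq_intros simp flip: has_real_derivative_iff_has_vector_derivative)
    then show ?thesis by (simp add: diff_divide_distrib)
  qed
  have op_bound: "\<bar>op X p\<bar> \<le> (\<Sum>i=1..N. \<bar>ini i\<bar> + M / K)" for X p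
  proof -
    obtain r t0 where p: "p = (r, t0)" by (cases p)
    define t where "t = max t0 0"
    have t: "t \<ge> 0" by (simp add: t_def)
    have comp: "\<bar>tent i r * (exp (- K * t) * P X i t)\<bar> \<le> \<bar>ini i\<bar> + M / K" if i: "i \<in> {1..N}" for i
    proof -
      have "norm (integral {0..t} (\<lambda>s. g i s (\<lambda>j. st X j s))) \<le> M * (t - 0)"
        by (rule integral_bound[OF t gc[OF i]]) (use bound i in auto)
      then have "\<bar>P X i t\<bar> \<le> \<bar>ini i\<bar> + M * t"
        by (simp add: P_def)
      then have "\<bar>tent i r * (exp (- K * t) * P X i t)\<bar> \<le> 1 * (exp (- K * t) * (\<bar>ini i\<bar> + M * t))"
        using tent[of i r] unfolding abs_mult by (intro mult_mono) auto
      also have "\<dots> = exp (- K * t) * \<bar>ini i\<bar> + M * (exp (- K * t) * t)"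
        by (simp add: algebra_simps)
      \<comment> \<open>The weight absorbs the linear growth of the integral: t exp(-K t) \<le> 1 /
        K because K t \<le> exp(K t).\<close>
      also have "\<dots> \<le> 1 * \<bar>ini i\<bar> + M * (1 / K)"
      proof (intro add_mono mult_right_mono mult_left_mono M)
        show "exp (- K * t) \<le> 1"
          using K t by simp
        have "K * t \<le> exp (K * t)"
          using exp_ge_add_one_self[of "K * t"] by linarith
        then show "exp (- K * t) * t \<le> 1 / K"
          using K by (simp add: exp_minus field_simps)
      qed auto
      finally show ?thesis by simp
    qed
    have "\<bar>op X p\<bar> \<le> (\<Sum>i=1..N. \<bar>tent i r * (exp (- K * t) * P X i t)\<bar>)"
      unfolding op_def p case_prod_conv t_def by (rule sum_abs)
    also have "\<dots> \<le> (\<Sum>i=1..N. \<bar>ini i\<bar> + M / K)"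
      by (rule sum_mono[OF comp])
    finally show ?thesis .
  qed
  have op_bcont: "op X \<in> bcontfun" for X
  proof -
    have "bounded (range (op X))"
      using op_bound[of X] by (intro boundedI) (auto simp del: sum.cl_ivl_Suc)
    then show ?thesis
      using op_cont by (simp add: bcontfun_def)
  qed
  define F where "F X = Bcontfun (op X)" for X
  have F: "apply_bcontfun (F X) = op X" for X
    unfolding F_def by (rule Bcontfun_inverse[OF op_bcont])
  have contr: "dist (F X) (F Y) \<le> 1/2 * dist X Y" for X Y
  proof (rule dist_bound)
    fix p :: "real \<times> real"
    obtain r t0 where p: "p = (r, t0)" by (cases p)
    define t where "t = max t0 0"
    have t: "t \<ge> 0" by (simp add: t_def)
    define d where "d = dist X Y"
    have comp: "\<bar>tent i r * (exp (- K * t) * P X i t) - tent i r * (exp (- K * t) * P Y i t)\<bar> \<le> N * L / K * d"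
      if i: "i \<in> {1..N}" for i
    proof -
      define h where "h X = (\<lambda>s. g i s (\<lambda>j. st X j s))" for X
      have le: "\<bar>h X s - h Y s\<bar> \<le> (N * L * d) * exp (K * s)" if "s \<in> {0..t}" for s
      proof -
        have "\<bar>h X s - h Y s\<bar> \<le> L * (\<Sum>j=1..N. \<bar>st X j s - st Y j s\<bar>)"
          unfolding h_def using lip[OF i] that by auto
        also have "\<dots> \<le> L * (\<Sum>j=1..N. exp (K * s) * d)"
        proof (intro mult_left_mono L sum_mono)
          fix j
          have "\<bar>st X j s - st Y j s\<bar> = exp (K * s) * dist (X (real j, s)) (Y (real j, s))"
            by (simp add: st_def dist_real_def abs_mult flip: right_diff_distrib)
          also have "\<dots> \<le> exp (K * s) * d"
            unfolding d_def by (intro mult_left_mono dist_bounded) auto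
          finally show "\<bar>st X j s - st Y j s\<bar> \<le> exp (K * s) * d" .
        qed
        finally show ?thesis by (simp add: mult_ac)
      qed
      have hi: "h X integrable_on {0..t}" for X
        unfolding h_def by (rule gi[OF i])
      have "\<bar>P X i t - P Y i t\<bar> = \<bar>integral {0..t} (\<lambda>s. h X s - h Y s)\<bar>"
        unfolding P_def h_def by (subst integral_diff) (use gi[OF i] in auto)
      also have "\<dots> \<le> integral {0..t} (\<lambda>s. (N * L * d) * exp (K * s))"
        unfolding real_norm_def[symmetric]
        by (rule integral_norm_bound_integral[OF integrable_diff[OF hi hi]
              has_integral_integrable[OF has_integral_mult_right[OF exp_int[OF t]]]])
          (use le in auto)
      also have "\<dots> = (N * L * d) * ((exp (K * t) - 1) / K)"
        using integral_unique[OF has_integral_mult_right[OF exp_int[OF t]]] by simp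
      finally have *: "\<bar>P X i t - P Y i t\<bar> \<le> (N * L * d) * ((exp (K * t) - 1) / K)" .
      have "\<bar>tent i r * (exp (- K * t) * P X i t) - tent i r * (exp (- K * t) * P Y i t)\<bar> =
          tent i r * (exp (- K * t) * \<bar>P X i t - P Y i t\<bar>)"
        using tent[of i r] by (simp add: abs_mult flip: right_diff_distrib)
      also have "\<dots> \<le> 1 * (exp (- K * t) * ((N * L * d) * (exp (K * t) / K)))"
      proof (intro mult_mono order_trans[OF *] mult_left_mono)
        show "(exp (K * t) - 1) / K \<le> exp (K * t) / K"
          using K by (simp add: divide_right_mono)
      qed (use L K tent t in \<open>auto simp: d_def\<close>)
      also have "\<dots> = N * L / K * d"
        by (simp add: exp_minus field_simps)
      finally show ?thesis .
    qed
    have "dist (F X p) (F Y p) = \<bar>\<Sum>i=1..N. tent i r * (exp (- K * t) * P X i t) -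
        tent i r * (exp (- K * t) * P Y i t)\<bar>"
      by (simp add: F op_def p t_def dist_real_def flip: sum_subtractf)
    also have "\<dots> \<le> (\<Sum>i=1..N. N * L / K * d)"
      by (rule order_trans[OF sum_abs sum_mono[OF comp]])
    also have "\<dots> = (N * (N * L) / K) * d"
      by simp
    also have "\<dots> \<le> 1/2 * d"
      using K L by (intro mult_right_mono) (auto simp: K_def field_simps d_def)
    finally show "dist (F X p) (F Y p) \<le> 1/2 * dist X Y"
      by (simp add: d_def)
  qed
  obtain X where X: "F X = X"
    using banach_fix_type[of "1/2" F] contr by auto
  have eq: "st X i t = P X i t" if "i \<in> {1..N}" "t \<ge> 0" for i t
  proof -
    have "apply_bcontfun X (real i, t) = (\<Sum>j=1..N. tent j (real i) * (exp (- K * t) * P X j t))"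
      using that(2) F[of X] unfolding X by (simp add: op_def)
    also have "\<dots> = (\<Sum>j=1..N. if j = i then exp (- K * t) * P X i t else 0)"
      by (intro sum.cong) (auto simp: tent_nat)
    finally have "apply_bcontfun X (real i, t) = exp (- K * t) * P X i t"
      using that(1) by simp
    then show ?thesis
      by (simp add: st_def exp_minus)
  qed
  show ?thesis
  proof (rule that[of "st X"])
    fix i assume i: "i \<in> {1..N}"
    show "st X i 0 = ini i"
      using eq[OF i, of 0] by (simp add: P_def)
    fix t :: real assume t: "t \<ge> 0"
    show "(st X i has_real_derivative g i t (\<lambda>j. st X j t)) (at t within {0..})"
      by (rule has_field_derivative_transform_within[OF Pd[OF i t] zero_less_one])
        (use t i eq in auto)
  qed
qed

section \<open>Smoothness of the control law\<close>

lemma matrix_inv_eqI: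
  fixes A B :: "real^'n^'n"
  assumes "A ** B = mat 1" "B ** A = mat 1"
  shows "matrix_inv A = B"
proof -
  have "A ** matrix_inv A = mat 1 \<and> matrix_inv A ** A = mat 1"
    unfolding matrix_inv_def by (rule someI[of _ B]) (use assms in auto)
  then show ?thesis
    using assms by (metis matrix_mul_assoc matrix_mul_lid matrix_mul_rid)
qed

text \<open>\<open>sinhc r = sinh (sqrt r) / sqrt r\<close> is entire. It expresses \<open>tanh (\<gamma> \<bar>\<xi>\<bar>) / \<bar>\<xi>\<bar>\<close> and
  \<open>sinh\<^sup>2 (\<gamma> \<bar>\<xi>\<bar>)\<close> through \<open>\<bar>\<xi>\<bar>\<^sup>2\<close>, and, for negative \<open>r\<close>, the divided differences of \<open>sin\<close> and \<open>cos\<close>.\<close>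

definition sinhc :: "real \<Rightarrow> real" where
  "sinhc r = (\<Sum>k. r ^ k / fact (2 * k + 1))"

lemma summable_sinhc: "summable (\<lambda>k. r ^ k / fact (2 * k + 1) :: real)"
proof (rule summable_comparison_test'[OF summable_exp[of "\<bar>r\<bar>"]])
  fix k :: nat
  have "fact k \<le> (fact (2 * k + 1) :: real)"
    by (rule fact_mono) simp
  then have "\<bar>r\<bar> ^ k / fact (2 * k + 1) \<le> \<bar>r\<bar> ^ k / fact k"
    by (intro divide_left_mono) auto
  then show "norm (r ^ k / fact (2 * k + 1)) \<le> inverse (fact k) * \<bar>r\<bar> ^ k"
    by (simp add: abs_mult power_abs divide_inverse mult.commute del: fact_Suc)
qed

lemma entire_sinhc: "entire sinhc"
  unfolding entire_def sinhc_def
  by (rule exI[of _ "\<lambda>k. inverse (fact (2 * k + 1))"])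
    (use summable_sinhc in \<open>simp add: divide_inverse mult.commute\<close>)

lemma sinhc_sums: "(\<lambda>k. r ^ k / fact (2 * k + 1)) sums sinhc r"
  unfolding sinhc_def by (rule summable_sums[OF summable_sinhc])

lemma sinh_eq_sinhc: "sinh x = x * sinhc (x\<^sup>2)" for x :: real
proof -
  define h where "h = (\<lambda>n. if even n then 0 else x ^ n /\<^sub>R fact n)"
  have "(\<lambda>k. h (2 * k + 1)) sums sinh x"
    unfolding h_def
    by (subst sums_mono_reindex) (auto simp: strict_mono_def sinh_converges elim!: oddE)
  moreover have "h (2 * k + 1) = x * ((x\<^sup>2) ^ k / fact (2 * k + 1))" for k
  proof -
    have "x ^ (2 * k + 1) = x * (x\<^sup>2) ^ k"
      by (simp add: power_mult)
    then show ?thesis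
      by (simp add: h_def divide_inverse mult_ac del: fact_Suc power_Suc)
  qed
  ultimately have "(\<lambda>k. x * ((x\<^sup>2) ^ k / fact (2 * k + 1))) sums sinh x"
    by (simp only:)
  then show ?thesis
    by (rule sums_unique2[OF _ sums_mult[OF sinhc_sums]])
qed

lemma sin_eq_sinhc: "sin x = x * sinhc (- x\<^sup>2)" for x :: real
proof -
  have "(- 1) ^ k / fact (2 * k + 1) * x ^ (2 * k + 1) = x * ((- x\<^sup>2) ^ k / fact (2 * k + 1))" for k
  proof -
    have "x ^ (2 * k + 1) = x * (x\<^sup>2) ^ k"
      by (simp add: power_mult)
    then show ?thesis
      by (simp add: power_minus[of "x\<^sup>2"] mult_ac del: fact_Suc power_Suc)
  qed
  then have "(\<lambda>k. x * ((- x\<^sup>2) ^ k / fact (2 * k + 1))) sums sin x"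
    using sin_paired[of x] by (simp only:)
  then show ?thesis
    by (rule sums_unique2[OF _ sums_mult[OF sinhc_sums]])
qed

lemma sinhc_0: "sinhc 0 = 1"
  unfolding sinhc_def using suminf_finite[of "{0}" "\<lambda>k. 0 ^ k / fact (2 * k + 1) :: real"] by auto

text \<open>The half-angle formula makes positivity visible: 1 plus a nonnegative term is a safe
  denominator.\<close>

lemma cosh_eq_sinhc: "cosh x = 1 + x\<^sup>2 / 2 * (sinhc (x\<^sup>2 / 4))\<^sup>2" for x :: real
proof -
  have "cosh x = 1 + 2 * (sinh (x / 2))\<^sup>2"
    using cosh_double_cosh[of "x / 2"] cosh_square_eq[of "x / 2"] by simp
  then show ?thesis
    by (simp add: sinh_eq_sinhc power_mult_distrib power_divide)
qed

section \<open>Smooth formulas for c, \<lambda>, B_0 and D_0\<close>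

text \<open>For r > 0 this is tanh(\<gamma> sqrt r) / sqrt r, written so that it is smooth across r
  = 0; it is applied to r = |\<xi>|^2.\<close>

definition kappa :: "real \<Rightarrow> real \<Rightarrow> real" where
  "kappa \<gamma> r = \<gamma> * sinhc (\<gamma>\<^sup>2 * r) / (1 + \<gamma>\<^sup>2 * r / 2 * (sinhc (\<gamma>\<^sup>2 * r / 4))\<^sup>2)"

lemma kappa_eq: "x * kappa \<gamma> (x\<^sup>2) = tanh (\<gamma> * x)"
  unfolding kappa_def tanh_def cosh_eq_sinhc sinh_eq_sinhc
  by (simp add: power_mult_distrib mult_ac)

definition sqnorm :: "(nat \<Rightarrow> real) \<Rightarrow> real" where
  "sqnorm z = (z 1)\<^sup>2 + (z 2)\<^sup>2"

lemma sqnorm_nonneg: "sqnorm z \<ge> 0"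
  by (simp add: sqnorm_def)

lemma xi_of_nth: "xi_of z $ 1 = z 1" "xi_of z $ 2 = z 2"
  by (simp_all add: xi_of_def)

lemma norm_xi_of: "norm (xi_of z) = sqrt (sqnorm z)"
  by (simp add: norm_eq_sqrt_inner inner_vec_def sum_2 xi_of_def sqnorm_def power2_eq_square)

lemma xi_of_eq_0_iff: "xi_of z = 0 \<longleftrightarrow> sqnorm z = 0"
  using norm_xi_of[of z] by (metis norm_eq_zero real_sqrt_eq_zero_cancel_iff)

lemma matrix_inv_G_rot:
  "matrix_inv (G_rot \<phi>) *v v = vector [cos \<phi> * v $ 1 + sin \<phi> * v $ 2, - sin \<phi> * v $ 1 + cos \<phi> * v $ 2]"
proof -
  have "matrix_inv (G_rot \<phi>) = vector [vector [cos \<phi>, sin \<phi>], vector [- sin \<phi>, cos \<phi>]]"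
    by (rule matrix_inv_eqI)
      (simp_all add: vec_eq_iff matrix_matrix_mult_def G_rot_def mat_def sum_2 forall_2
        flip: power2_eq_square)
  then show ?thesis
    by (simp add: vec_eq_iff forall_2 matrix_vector_mult_def sum_2)
qed

text \<open>The case split of the definition at \<xi> = 0 disappears, because there the factor z_1,
  z_2 already makes the first term vanish.\<close>

lemma c_vec_components:
  "c_vec \<gamma> w a z $ 1 = w - kappa \<gamma> (sqnorm z) * (cos (a 1) * z 1 + sin (a 1) * z 2)"
  "c_vec \<gamma> w a z $ 2 = - kappa \<gamma> (sqnorm z) * (- sin (a 1) * z 1 + cos (a 1) * z 2)"
proof -
  define r where "r = sqrt (sqnorm z)"
  have r: "r \<ge> 0" "r\<^sup>2 = sqnorm z"
    by (simp_all add: r_def sqnorm_nonneg)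
  have "c_vec \<gamma> w a z $ 1 = w - kappa \<gamma> (sqnorm z) * (cos (a 1) * z 1 + sin (a 1) * z 2) \<and>
    c_vec \<gamma> w a z $ 2 = - kappa \<gamma> (sqnorm z) * (- sin (a 1) * z 1 + cos (a 1) * z 2)"
  proof (cases "xi_of z = 0")
    case True
    then have "z 1 = 0 \<and> z 2 = 0"
      by (simp add: xi_of_def vec_eq_iff forall_2)
    then show ?thesis
      using True by (simp add: c_vec_def)
  next
    case False
    then have "r \<noteq> 0"
      by (simp add: r_def xi_of_eq_0_iff)
    then have "tanh (\<gamma> * r) / r = kappa \<gamma> (sqnorm z)"
      using kappa_eq[of r \<gamma>] r by (simp add: field_simps)
    then show ?thesis
      using False by (simp add: c_vec_def norm_xi_of matrix_inv_G_rot xi_of_nth flip: r_def)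
  qed
  then show "c_vec \<gamma> w a z $ 1 = w - kappa \<gamma> (sqnorm z) * (cos (a 1) * z 1 + sin (a 1) * z 2)"
    "c_vec \<gamma> w a z $ 2 = - kappa \<gamma> (sqnorm z) * (- sin (a 1) * z 1 + cos (a 1) * z 2)" by auto
qed

text \<open>Rotation preserves length, so the first rotated component m of \<xi> satisfies |m| \<le>
  r = |\<xi>|, and the correction to w has modulus at most |tanh(\<gamma> r)| < 1.\<close>

lemma c_vec_1_sign:
  assumes "w = 1 \<or> w = -1"
  shows "w * c_vec \<gamma> w a z $ 1 > 0"
proof -
  define r where "r = sqrt (sqnorm z)"
  have r: "r \<ge> 0" "r\<^sup>2 = sqnorm z"
    by (simp_all add: r_def sqnorm_nonneg)
  define k where "k = kappa \<gamma> (sqnorm z)"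
  define m where "m = cos (a 1) * z 1 + sin (a 1) * z 2"
  define q where "q = - sin (a 1) * z 1 + cos (a 1) * z 2"
  have "m\<^sup>2 + q\<^sup>2 = ((cos (a 1))\<^sup>2 + (sin (a 1))\<^sup>2) * sqnorm z"
    unfolding m_def q_def sqnorm_def by algebra
  then have "m\<^sup>2 + q\<^sup>2 = r\<^sup>2"
    using sin_cos_squared_add2[of "a 1"] by (simp only: r mult_1)
  then have "m\<^sup>2 \<le> r\<^sup>2"
    using zero_le_power2[of q] by linarith
  then have "\<bar>m\<bar> \<le> r"
    using r(1) abs_le_square_iff[of m r] by simp
  then have "\<bar>k * m\<bar> \<le> \<bar>k * r\<bar>"
    using r(1) by (simp add: abs_mult mult_left_mono)
  also have "k * r = tanh (\<gamma> * r)"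
    using kappa_eq[of r \<gamma>] r(2) by (simp add: k_def mult.commute)
  also have "\<bar>tanh (\<gamma> * r)\<bar> < 1"
    using tanh_real_lt_1[of "\<gamma> * r"] tanh_real_gt_neg1[of "\<gamma> * r"] by linarith
  finally have "\<bar>k * m\<bar> < 1" .
  then show ?thesis
    using assms by (auto simp: c_vec_components k_def m_def)
qed

lemma norm_vec2: "norm (v :: real^2) = sqrt ((v $ 1)\<^sup>2 + (v $ 2)\<^sup>2)"
  by (simp add: norm_eq_sqrt_inner inner_vec_def sum_2 power2_eq_square)

text \<open>\<open>lam\<close> and \<alpha>_0 are polar coordinates of c with a signed radius. An
  arctangent suffices for the angle because c_1 has the sign of w and so never vanishes.\<close>

lemma lam_cos_sin:
  assumes w: "w = 1 \<or> w = -1"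
  shows "lam \<gamma> w a z * cos (arctan (c_vec \<gamma> w a z $ 2 / c_vec \<gamma> w a z $ 1)) = c_vec \<gamma> w a z $ 1"
    "lam \<gamma> w a z * sin (arctan (c_vec \<gamma> w a z $ 2 / c_vec \<gamma> w a z $ 1)) = c_vec \<gamma> w a z $ 2"
    "w * lam \<gamma> w a z > 0"
proof -
  define c1 c2 where "c1 = c_vec \<gamma> w a z $ 1" and "c2 = c_vec \<gamma> w a z $ 2"
  have c1: "w * c1 > 0" "c1 \<noteq> 0"
    using c_vec_1_sign[OF w, of \<gamma> a z] by (auto simp: c1_def)
  have s: "sqrt (1 + (c2 / c1)\<^sup>2) > 0"
    by (simp add: add_pos_nonneg)
  have "c1\<^sup>2 + c2\<^sup>2 = c1\<^sup>2 * (1 + (c2 / c1)\<^sup>2)"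
    using c1 by (simp add: field_simps power_divide)
  then have "lam \<gamma> w a z = w * (\<bar>c1\<bar> * sqrt (1 + (c2 / c1)\<^sup>2))"
    by (simp add: lam_def norm_vec2 real_sqrt_mult flip: c1_def c2_def)
  also have "w * \<bar>c1\<bar> = c1"
    using w c1 by auto
  then have "w * (\<bar>c1\<bar> * sqrt (1 + (c2 / c1)\<^sup>2)) = c1 * sqrt (1 + (c2 / c1)\<^sup>2)"
    by (simp flip: mult.assoc)
  finally have l: "lam \<gamma> w a z = c1 * sqrt (1 + (c2 / c1)\<^sup>2)" .
  show "lam \<gamma> w a z * cos (arctan (c_vec \<gamma> w a z $ 2 / c_vec \<gamma> w a z $ 1)) = c_vec \<gamma> w a z $ 1"
    using s by (simp add: l cos_arctan flip: c1_def c2_def)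
  show "lam \<gamma> w a z * sin (arctan (c_vec \<gamma> w a z $ 2 / c_vec \<gamma> w a z $ 1)) = c_vec \<gamma> w a z $ 2"
    using s c1 by (simp add: l sin_arctan flip: c1_def c2_def)
  show "w * lam \<gamma> w a z > 0"
    using s c1 unfolding l by (simp flip: mult.assoc)
qed

lemma lam_nonzero: "w = 1 \<or> w = -1 \<Longrightarrow> lam \<gamma> w a z \<noteq> 0"
  using lam_cos_sin(3)[of w \<gamma> a z] by auto

text \<open>The definition of \<open>lam\<close> uses a norm, hence a square root, which the class
  \<open>smooth\<close> does not contain; this quotient is built from operations of the
  class.\<close>

lemma lam_eq:
  assumes w: "w = 1 \<or> w = -1"
  shows "lam \<gamma> w a z = c_vec \<gamma> w a z $ 1 / cos (arctan (c_vec \<gamma> w a z $ 2 / c_vec \<gamma> w a z $ 1))"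
  using lam_cos_sin(1)[OF w, of \<gamma> a z] cos_arctan_not_zero by (metis nonzero_mult_div_cancel_right)

lemma B_fun_0:
  "B_fun n \<gamma> w 0 a z \<zeta> k = (if k = 1 then - w * cos (a 1) + lam \<gamma> w a z * cos (a 1 + \<zeta>)
     else - w * sin (a 1) + lam \<gamma> w a z * sin (a 1 + \<zeta>))"
  by (simp add: G_rot_def matrix_vector_mult_def sum_2 cos_add sin_add Let_def)

text \<open>The origin of c: rotating c back by a_1 gives the reference direction plus a radial
  correction. With \<sigma>_1 = \<alpha>_0 the reference velocity cancels and \<xi> is driven
  straight towards 0.\<close>

lemma B_fun_0_alpha_0:
  assumes w: "w = 1 \<or> w = -1" and k: "k = 1 \<or> k = 2"
  shows "B_fun n \<gamma> w 0 a z (alpha n \<gamma> \<delta> w 0 a z) k = - kappa \<gamma> (sqnorm z) * z k"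
proof -
  define K where "K = kappa \<gamma> (sqnorm z)"
  define C S where "C = cos (a 1)" and "S = sin (a 1)"
  have CS: "C * C + S * S = 1"
    by (simp add: C_def S_def flip: power2_eq_square)
  have "lam \<gamma> w a z * cos (a 1 + alpha n \<gamma> \<delta> w 0 a z) = C * c_vec \<gamma> w a z $ 1 - S * c_vec \<gamma> w a z $ 2"
    "lam \<gamma> w a z * sin (a 1 + alpha n \<gamma> \<delta> w 0 a z) = S * c_vec \<gamma> w a z $ 1 + C * c_vec \<gamma> w a z $ 2"
    using lam_cos_sin(1,2)[OF w, of \<gamma> a z, symmetric]
    by (simp_all add: cos_add sin_add algebra_simps C_def S_def)
  moreover have "C * (w - K * (C * z 1 + S * z 2)) - S * (- K * (- S * z 1 + C * z 2)) =
      w * C - K * (C * C + S * S) * z 1"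
    "S * (w - K * (C * z 1 + S * z 2)) + C * (- K * (- S * z 1 + C * z 2)) =
      w * S - K * (C * C + S * S) * z 2"
    by (simp_all add: algebra_simps)
  ultimately show ?thesis
    using k CS unfolding B_fun_0 c_vec_components by (auto simp: C_def S_def K_def)
qed

lemma sin_diff_sinhc: "sin x - sin y = (x - y) * (sinhc (- ((x - y) / 2)\<^sup>2) * cos ((x + y) / 2))"
  and cos_diff_sinhc: "cos x - cos y = (x - y) * - (sinhc (- ((x - y) / 2)\<^sup>2) * sin ((x + y) / 2))"
  for x y :: real
proof -
  have "sin x - sin y = 2 * sin ((x - y) / 2) * cos ((x + y) / 2)"
    by (rule sin_diff_sin)
  then show "sin x - sin y = (x - y) * (sinhc (- ((x - y) / 2)\<^sup>2) * cos ((x + y) / 2))"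
    by (simp add: sin_eq_sinhc[of "(x - y) / 2"])
  have "sin ((y - x) / 2) = - sin ((x - y) / 2)"
    by (metis minus_diff_eq minus_divide_left sin_minus)
  then have "cos x - cos y = - (2 * sin ((x - y) / 2) * sin ((x + y) / 2))"
    using cos_diff_cos[of x y] by simp
  then show "cos x - cos y = (x - y) * - (sinhc (- ((x - y) / 2)\<^sup>2) * sin ((x + y) / 2))"
    by (simp add: sin_eq_sinhc[of "(x - y) / 2"])
qed

text \<open>One formula serves both branches of the definition: sum-to-product formulas split off
  the factor \<zeta> - \<eta>, and what remains has the right value at \<zeta> = \<eta> because
  \<open>sinhc 0 = 1\<close>.\<close>

lemma D_fun_0:
  "D_fun n \<gamma> w 0 a z \<zeta> \<eta> k = lam \<gamma> w a z * sinhc (- ((\<zeta> - \<eta>) / 2)\<^sup>2) *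
     (if k = 1 then - sin (a 1 + (\<zeta> + \<eta>) / 2) else cos (a 1 + (\<zeta> + \<eta>) / 2))"
proof -
  have m: "(a 1 + \<zeta> + (a 1 + \<eta>)) / 2 = a 1 + (\<zeta> + \<eta>) / 2"
    by (simp add: field_simps)
  show ?thesis
  proof (cases "\<zeta> = \<eta>")
    case True
    have "((\<lambda>\<zeta>. B_fun n \<gamma> w 0 a z \<zeta> k) has_real_derivative
        lam \<gamma> w a z * (if k = 1 then - sin (a 1 + \<zeta>) else cos (a 1 + \<zeta>))) (at \<zeta>)"
      unfolding B_fun_0 by (auto intro!: derivative_eq_intros)
    then show ?thesis
      using True by (simp add: D_fun_def DERIV_imp_deriv sinhc_0 del: B_fun.simps)
  next
    case False
    define K where "K = sinhc (- ((\<zeta> - \<eta>) / 2)\<^sup>2)"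
    have "cos (a 1 + \<zeta>) - cos (a 1 + \<eta>) = (\<zeta> - \<eta>) * - (K * sin (a 1 + (\<zeta> + \<eta>) / 2))"
      "sin (a 1 + \<zeta>) - sin (a 1 + \<eta>) = (\<zeta> - \<eta>) * (K * cos (a 1 + (\<zeta> + \<eta>) / 2))"
      using cos_diff_sinhc[of "a 1 + \<zeta>" "a 1 + \<eta>"] sin_diff_sinhc[of "a 1 + \<zeta>" "a 1 + \<eta>"]
      unfolding m K_def by simp_all
    then have "B_fun n \<gamma> w 0 a z \<zeta> k - B_fun n \<gamma> w 0 a z \<eta> k = (\<zeta> - \<eta>) * (lam \<gamma> w a z * K *
        (if k = 1 then - sin (a 1 + (\<zeta> + \<eta>) / 2) else cos (a 1 + (\<zeta> + \<eta>) / 2)))"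
      unfolding B_fun_0 by (auto simp: mult_ac simp flip: right_diff_distrib)
    then show ?thesis
      using False by (simp add: D_fun_def K_def)
  qed
qed

lemma D_fun_Suc:
  "D_fun n \<gamma> w (Suc i) a z \<zeta> \<eta> k = (if k \<le> i + 2 then 0 else beta_coef n \<gamma> w (Suc i) a z)"
proof (cases "\<zeta> = \<eta>")
  case True
  have "((\<lambda>\<zeta>. b_coef n \<gamma> w (Suc i) a z + beta_coef n \<gamma> w (Suc i) a z * \<zeta>) has_real_derivative
      beta_coef n \<gamma> w (Suc i) a z) (at \<zeta>)"
    by (auto intro!: derivative_eq_intros)
  then show ?thesis
    using True by (auto simp: D_fun_def DERIV_imp_deriv)
next
  case False
  then show ?thesis
    by (auto simp: D_fun_def field_simps)
qed

lemma B_fun_diff: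
  "B_fun n \<gamma> w i a z \<zeta> k = B_fun n \<gamma> w i a z \<eta> k + (\<zeta> - \<eta>) * D_fun n \<gamma> w i a z \<zeta> \<eta> k"
  by (simp add: D_fun_def)

text \<open>\<open>Inl j\<close> stands for \<open>z j\<close> and \<open>Inr j\<close> for \<open>a j\<close>.\<close>

definition vars :: "nat \<Rightarrow> nat \<Rightarrow> (nat + nat) set" where
  "vars m k = Inl ` {1..m} \<union> Inr ` {1..k}"

lemma finite_vars: "finite (vars m k)"
  by (simp add: vars_def)

lemma vars_mono: "m \<le> m' \<Longrightarrow> k \<le> k' \<Longrightarrow> vars m k \<subseteq> vars m' k'"
  by (auto simp: vars_def)

lemma vars_iff: "Inl j \<in> vars m k \<longleftrightarrow> 1 \<le> j \<and> j \<le> m" "Inr j \<in> vars m k \<longleftrightarrow> 1 \<le> j \<and> j \<le> k"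
  by (auto simp: vars_def)

lemma sum_vars: "(\<Sum>v\<in>vars m k. f v) = (\<Sum>j=1..m. f (Inl j)) + (\<Sum>j=1..k. f (Inr j))"
  unfolding vars_def by (subst sum.union_disjoint) (auto simp: sum.reindex)

section \<open>Calculus for functions of z and a\<close>

text \<open>Both arguments are packed into one tuple so that repeated derivatives in z and in a stay
  within a single class. The number m counts variables of z and k variables of a, although f takes a
  before z.\<close>

definition smooth_az :: "nat \<Rightarrow> nat \<Rightarrow> ((nat \<Rightarrow> real) \<Rightarrow> (nat \<Rightarrow> real) \<Rightarrow> real) \<Rightarrow> bool" where
  "smooth_az m k f \<longleftrightarrow> smooth (vars m k) UNIV (\<lambda>p. f (\<lambda>j. p (Inr j)) (\<lambda>j. p (Inl j)))"

lemma smooth_az_mono: "smooth_az m k f \<Longrightarrow> m \<le> m' \<Longrightarrow> k \<le> k' \<Longrightarrow> smooth_az m' k' f"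
  unfolding smooth_az_def by (erule smooth_mono) (simp_all add: vars_mono)

lemma smooth_az_const: "smooth_az m k (\<lambda>a z. c)"
  and smooth_az_z: "1 \<le> j \<Longrightarrow> j \<le> m \<Longrightarrow> smooth_az m k (\<lambda>a z. z j)"
  and smooth_az_a: "1 \<le> j \<Longrightarrow> j \<le> k \<Longrightarrow> smooth_az m k (\<lambda>a z. a j)"
  unfolding smooth_az_def by (auto intro: smooth_intros simp: vars_iff)

context
  fixes m k :: nat and f g :: "(nat \<Rightarrow> real) \<Rightarrow> (nat \<Rightarrow> real) \<Rightarrow> real"
  assumes f: "smooth_az m k f" and g: "smooth_az m k g"
begin

lemma smooth_az_add: "smooth_az m k (\<lambda>a z. f a z + g a z)"
  and smooth_az_diff: "smooth_az m k (\<lambda>a z. f a z - g a z)"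
  and smooth_az_mult: "smooth_az m k (\<lambda>a z. f a z * g a z)"
  and smooth_az_divide: "(\<And>a z. g a z \<noteq> 0) \<Longrightarrow> smooth_az m k (\<lambda>a z. f a z / g a z)"
  using f g unfolding smooth_az_def
  by (auto intro: smooth_add smooth_diff smooth_mult smooth_divide)

end

context
  fixes m k :: nat and f :: "(nat \<Rightarrow> real) \<Rightarrow> (nat \<Rightarrow> real) \<Rightarrow> real"
  assumes f: "smooth_az m k f"
begin

lemma smooth_az_uminus: "smooth_az m k (\<lambda>a z. - f a z)"
  and smooth_az_power: "smooth_az m k (\<lambda>a z. f a z ^ e)"
  and smooth_az_inverse: "(\<And>a z. f a z \<noteq> 0) \<Longrightarrow> smooth_az m k (\<lambda>a z. inverse (f a z))"
  and smooth_az_arctan: "smooth_az m k (\<lambda>a z. arctan (f a z))"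
  and smooth_az_cos: "smooth_az m k (\<lambda>a z. cos (f a z))"
  and smooth_az_sin: "smooth_az m k (\<lambda>a z. sin (f a z))"
  and smooth_az_entire: "entire h \<Longrightarrow> smooth_az m k (\<lambda>a z. h (f a z))"
  using f unfolding smooth_az_def
  by (auto intro: smooth_uminus smooth_power smooth_inverse smooth_arctan smooth_cos smooth_sin
      smooth_entire)

end

lemma smooth_az_sum:
  "(\<And>j. j \<in> J \<Longrightarrow> smooth_az m k (f j)) \<Longrightarrow> smooth_az m k (\<lambda>a z. \<Sum>j\<in>J. f j a z)"
  unfolding smooth_az_def by (rule smooth_sum)

lemmas smooth_az_intros = smooth_az_const smooth_az_z smooth_az_a smooth_az_add smooth_az_diff
  smooth_az_mult smooth_az_divide smooth_az_uminus smooth_az_power smooth_az_inverse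
  smooth_az_arctan smooth_az_cos smooth_az_sin smooth_az_sum

lemma pd_Inl:
  "pd (Inl j) (\<lambda>p. f (\<lambda>i. p (Inr i)) (\<lambda>i. p (Inl i))) p =
   partial j (f (\<lambda>i. p (Inr i))) (\<lambda>i. p (Inl i))"
proof -
  have "(\<lambda>i. (p(Inl j := t)) (Inl i)) = (\<lambda>i. p (Inl i))(j := t)" for t
    by auto
  then show ?thesis by (simp add: pd_def partial_def del: fun_upd_apply) simp
qed

lemma pd_Inr:
  "pd (Inr j) (\<lambda>p. f (\<lambda>i. p (Inr i)) (\<lambda>i. p (Inl i))) p =
   partial j (\<lambda>a. f a (\<lambda>i. p (Inl i))) (\<lambda>i. p (Inr i))"
proof -
  have "(\<lambda>i. (p(Inr j := t)) (Inr i)) = (\<lambda>i. p (Inr i))(j := t)" for t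
    by auto
  then show ?thesis by (simp add: pd_def partial_def del: fun_upd_apply) simp
qed

lemma smooth_az_partial_z:
  assumes "smooth_az m k f"
  shows "smooth_az m k (\<lambda>a z. partial j (f a) z)"
  using smooth_pd[OF finite_vars assms[unfolded smooth_az_def], of "Inl j"]
  unfolding smooth_az_def pd_Inl[abs_def] by simp

lemma smooth_az_partial_a:
  assumes "smooth_az m k f"
  shows "smooth_az m k (\<lambda>a z. partial j (\<lambda>a. f a z) a)"
  using smooth_pd[OF finite_vars assms[unfolded smooth_az_def], of "Inr j"]
  unfolding smooth_az_def pd_Inr[abs_def] by simp

lemma smooth_az_kappa: "smooth_az 2 k (\<lambda>a z. kappa \<gamma> (sqnorm z))"
  unfolding kappa_def
proof -
  have sq: "smooth_az 2 k (\<lambda>a z. sqnorm z)"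
    unfolding sqnorm_def by (intro smooth_az_add smooth_az_power smooth_az_z) auto
  have "0 \<le> \<gamma>\<^sup>2 * sqnorm z / 2 * (sinhc (\<gamma>\<^sup>2 * sqnorm z / 4))\<^sup>2" for z
    using sqnorm_nonneg[of z] by (intro mult_nonneg_nonneg divide_nonneg_nonneg) auto
  then have "1 + \<gamma>\<^sup>2 * sqnorm z / 2 * (sinhc (\<gamma>\<^sup>2 * sqnorm z / 4))\<^sup>2 > 0" for z
    by (intro add_pos_nonneg) auto
  then have "1 + \<gamma>\<^sup>2 * sqnorm z / 2 * (sinhc (\<gamma>\<^sup>2 * sqnorm z / 4))\<^sup>2 \<noteq> 0" for z
    by (metis less_irrefl)
  then show "smooth_az 2 k (\<lambda>a z. \<gamma> * sinhc (\<gamma>\<^sup>2 * sqnorm z) /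
      (1 + \<gamma>\<^sup>2 * sqnorm z / 2 * (sinhc (\<gamma>\<^sup>2 * sqnorm z / 4))\<^sup>2))"
    by (intro smooth_az_divide smooth_az_mult smooth_az_add smooth_az_const smooth_az_power
        smooth_az_entire[OF _ entire_sinhc] sq) auto
qed

lemma smooth_az_c_vec:
  "smooth_az 2 1 (\<lambda>a z. c_vec \<gamma> w a z $ 1)" "smooth_az 2 1 (\<lambda>a z. c_vec \<gamma> w a z $ 2)"
  unfolding c_vec_components by (intro smooth_az_intros smooth_az_kappa; simp)+

lemma smooth_az_alpha_0:
  assumes w: "w = 1 \<or> w = -1"
  shows "smooth_az 2 1 (alpha n \<gamma> \<delta> w 0)"
proof -
  have "c_vec \<gamma> w a z $ 1 \<noteq> 0" for a z
    using c_vec_1_sign[OF w, of \<gamma> a z] by auto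
  then show ?thesis
    unfolding alpha.simps by (intro smooth_az_arctan smooth_az_divide smooth_az_c_vec)
qed

lemma smooth_az_lam:
  assumes w: "w = 1 \<or> w = -1"
  shows "smooth_az 2 1 (\<lambda>a z. lam \<gamma> w a z)"
  unfolding lam_eq[OF w]
proof (intro smooth_az_divide smooth_az_cos smooth_az_c_vec)
  show "smooth_az 2 1 (\<lambda>a z. arctan (c_vec \<gamma> w a z $ 2 / c_vec \<gamma> w a z $ 1))"
    using smooth_az_alpha_0[OF w, of undefined \<gamma> undefined] unfolding alpha.simps .
qed simp

lemma smooth_az_line_z:
  assumes "smooth_az m k f"
  shows "((\<lambda>t. f a (z(j := t))) has_real_derivative partial j (f a) z) (at (z j))"
proof -
  define p where "p = case_sum z a"
  have "(\<lambda>i. (p(Inl j := t)) (Inl i)) = z(j := t)" "(\<lambda>i. (p(Inl j := t)) (Inr i)) = a" for t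
    by (auto simp: p_def)
  then show ?thesis
    using smooth_line[OF finite_vars assms[unfolded smooth_az_def] UNIV_I, of p "Inl j"]
    unfolding pd_Inl by (simp add: p_def del: fun_upd_apply)
qed

lemma smooth_az_line_a:
  assumes "smooth_az m k f"
  shows "((\<lambda>t. f (a(j := t)) z) has_real_derivative partial j (\<lambda>a. f a z) a) (at (a j))"
proof -
  define p where "p = case_sum z a"
  have "(\<lambda>i. (p(Inr j := t)) (Inl i)) = z" "(\<lambda>i. (p(Inr j := t)) (Inr i)) = a(j := t)" for t
    by (auto simp: p_def)
  then show ?thesis
    using smooth_line[OF finite_vars assms[unfolded smooth_az_def] UNIV_I, of p "Inr j"]
    unfolding pd_Inr by (simp add: p_def del: fun_upd_apply)
qed

lemma smooth_az_local:
  assumes "smooth_az m k f" "\<And>j. 1 \<le> j \<Longrightarrow> j \<le> m \<Longrightarrow> z j = z' j" "\<And>j. 1 \<le> j \<Longrightarrow> j \<le> k \<Longrightarrow> a j = a' j"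
  shows "f a z = f a' z'"
  using smooth_local[OF assms(1)[unfolded smooth_az_def], of "case_sum z a" "case_sum z' a'"] assms(2,3)
  by (force simp: vars_def)

lemma smooth_az_partial_a_outside:
  assumes "smooth_az m k f" "j > k"
  shows "partial j (\<lambda>a. f a z) a = 0"
proof -
  have "(\<lambda>t. f (a(j := t)) z) = (\<lambda>t. f a z)"
    using assms(2) by (intro ext smooth_az_local[OF assms(1)]) auto
  then show ?thesis by (simp add: partial_def)
qed

lemma smooth_az_chain:
  assumes "smooth_az m k f"
    "\<And>j. 1 \<le> j \<Longrightarrow> j \<le> m \<Longrightarrow> ((\<lambda>s. z s j) has_real_derivative z' j) (at t within S)"
    "\<And>j. 1 \<le> j \<Longrightarrow> j \<le> k \<Longrightarrow> ((\<lambda>s. a s j) has_real_derivative a' j) (at t within S)"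
  shows "((\<lambda>s. f (a s) (z s)) has_real_derivative
    (\<Sum>j=1..m. partial j (f (a t)) (z t) * z' j) +
    (\<Sum>j=1..k. partial j (\<lambda>a. f a (z t)) (a t) * a' j)) (at t within S)"
proof -
  define c where "c = (\<lambda>s. case_sum (z s) (a s))"
  have "((\<lambda>s. c s v) has_real_derivative case_sum z' a' v) (at t within S)" if "v \<in> vars m k" for v
    using that assms(2,3) by (cases v) (auto simp: c_def vars_iff)
  from smooth_chain[OF finite_vars assms(1)[unfolded smooth_az_def] UNIV_I, where c = c, OF this]
  show ?thesis
    unfolding sum_vars pd_Inl pd_Inr by (simp add: c_def)
qed

lemma smooth_az_continuous_on:
  assumes "smooth_az m k f" "\<And>j. continuous_on S (\<lambda>t. z t j)" "\<And>j. continuous_on S (\<lambda>t. a t j)"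
  shows "continuous_on S (\<lambda>t. f (a t) (z t))"
proof -
  have "continuous_on S (\<lambda>t. case_sum (z t) (a t))"
  proof (rule continuous_on_coordinatewise_then_product)
    show "continuous_on S (\<lambda>t. case_sum (z t) (a t) v)" for v
      by (cases v) (use assms(2,3) in auto)
  qed
  from continuous_on_compose2[OF smooth_continuous[OF assms(1)[unfolded smooth_az_def]] this]
  show ?thesis by simp
qed

text \<open>No bound on a_1 is assumed: by periodicity it can be shifted by a multiple of 2 pi into
  a fixed interval without changing f, and then the Lipschitz bound on a box applies. Both values
  use the same a, so only differences in z remain.\<close>

lemma smooth_az_Lipschitz:
  assumes f: "smooth_az m k f"
    and per: "\<And>a z e. f (a(1 := a 1 + 2 * pi * of_int e)) z = f a z"
  obtains L where "L \<ge> 0" "\<And>a z z'. (\<And>j. 2 \<le> j \<Longrightarrow> j \<le> k \<Longrightarrow> \<bar>a j\<bar> \<le> R) \<Longrightarrow>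
    (\<And>j. 1 \<le> j \<Longrightarrow> j \<le> m \<Longrightarrow> \<bar>z j\<bar> \<le> R) \<Longrightarrow> (\<And>j. 1 \<le> j \<Longrightarrow> j \<le> m \<Longrightarrow> \<bar>z' j\<bar> \<le> R) \<Longrightarrow>
    \<bar>f a z - f a z'\<bar> \<le> L * (\<Sum>j=1..m. \<bar>z j - z' j\<bar>)"
proof -
  \<comment> \<open>The bound 2 pi is for the reduced a_1, the bound R for all other
    coordinates.\<close>
  define R' where "R' = max R (2 * pi)"
  obtain L where L: "L \<ge> 0" "\<And>x y. (\<And>i. i \<in> vars m k \<Longrightarrow> \<bar>x i\<bar> \<le> R') \<Longrightarrow>
      (\<And>i. i \<in> vars m k \<Longrightarrow> \<bar>y i\<bar> \<le> R') \<Longrightarrow>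
      \<bar>f (\<lambda>j. x (Inr j)) (\<lambda>j. x (Inl j)) - f (\<lambda>j. y (Inr j)) (\<lambda>j. y (Inl j))\<bar> \<le>
      L * (\<Sum>i\<in>vars m k. \<bar>x i - y i\<bar>)"
    by (rule smooth_Lipschitz[OF finite_vars f[unfolded smooth_az_def], of R']) blast
  show ?thesis
  proof (rule that[OF L(1)])
    fix a z z' :: "nat \<Rightarrow> real"
    assume a: "\<And>j. 2 \<le> j \<Longrightarrow> j \<le> k \<Longrightarrow> \<bar>a j\<bar> \<le> R"
      and z: "\<And>j. 1 \<le> j \<Longrightarrow> j \<le> m \<Longrightarrow> \<bar>z j\<bar> \<le> R"
      and z': "\<And>j. 1 \<le> j \<Longrightarrow> j \<le> m \<Longrightarrow> \<bar>z' j\<bar> \<le> R"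
    define e where "e = \<lfloor>a 1 / (2 * pi)\<rfloor>"
    define b where "b = a(1 := a 1 + 2 * pi * of_int (- e))"
    have e: "real_of_int e \<le> a 1 / (2 * pi)" "a 1 / (2 * pi) < real_of_int e + 1"
      unfolding e_def by linarith+
    have "real_of_int e * (2 * pi) \<le> a 1" "a 1 < (real_of_int e + 1) * (2 * pi)"
      using e by (simp_all add: pos_le_divide_eq pos_divide_less_eq)
    then have b1: "\<bar>b 1\<bar> \<le> 2 * pi"
      by (simp add: b_def algebra_simps)
    have bj: "\<bar>b j\<bar> \<le> R'" if "1 \<le> j" "j \<le> k" for j
      using b1 a[of j] that by (cases "j = 1") (auto simp: R'_def b_def)
    have feq: "f a u = f b u" for u
      unfolding b_def by (rule per[symmetric])
    have zb: "\<bar>case_sum u b i\<bar> \<le> R'"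
      if "i \<in> vars m k" "\<And>j. 1 \<le> j \<Longrightarrow> j \<le> m \<Longrightarrow> \<bar>u j\<bar> \<le> R" for u i
      using that bj by (cases i) (force simp: vars_iff R'_def)+
    have "\<bar>f b z - f b z'\<bar> \<le> L * (\<Sum>i\<in>vars m k. \<bar>case_sum z b i - case_sum z' b i\<bar>)"
      using L(2)[of "case_sum z b" "case_sum z' b"] zb z z' by simp
    then show "\<bar>f a z - f a z'\<bar> \<le> L * (\<Sum>j=1..m. \<bar>z j - z' j\<bar>)"
      by (simp add: feq sum_vars)
  qed
qed

locale backstepping =
  fixes n :: nat and \<gamma> w :: real and \<delta> :: "nat \<Rightarrow> real"
  assumes n: "n \<ge> 1" and \<gamma>: "\<gamma> > 0" and w: "w = 1 \<or> w = -1"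
    and \<delta>: "\<And>i. 1 \<le> i \<Longrightarrow> i \<le> n \<Longrightarrow> \<delta> i > 0"
begin

lemma beta_coef_nonzero: "beta_coef n \<gamma> w i a z \<noteq> 0"
  using lam_nonzero[OF w] by (simp add: beta_coef_def)

lemma smooth_az_beta: "smooth_az 2 1 (\<lambda>a z. beta_coef n \<gamma> w i a z)"
  using smooth_az_lam[OF w] smooth_az_const by (cases "i < n") (auto simp: beta_coef_def)

lemma smooth_az_b: "smooth_az 2 (i + 1) (\<lambda>a z. b_coef n \<gamma> w i a z)"
proof (cases "i < n")
  case True
  have "smooth_az 2 (i + 1) (\<lambda>a z. (lam \<gamma> w a z - w) * a (i + 1))"
    by (intro smooth_az_mult smooth_az_diff smooth_az_const smooth_az_a
        smooth_az_mono[OF smooth_az_lam[OF w]]) auto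
  then show ?thesis using True by (simp add: b_coef_def)
qed (simp add: b_coef_def smooth_az_const)

lemma smooth_az_B_fun: "smooth_az (i + 3) (i + 1) (\<lambda>a z. B_fun n \<gamma> w i a z (z (i + 3)) k)"
proof (induction i)
  case 0
  have l: "smooth_az 3 1 (\<lambda>a z. lam \<gamma> w a z)"
    by (rule smooth_az_mono[OF smooth_az_lam[OF w]]) auto
  have s: "smooth_az 3 1 (\<lambda>a z. a 1 + z 3)" "smooth_az 3 1 (\<lambda>a z. a 1)"
    by (intro smooth_az_add smooth_az_a smooth_az_z; simp)+
  have "smooth_az 3 1 (\<lambda>a z. - w * cos (a 1) + lam \<gamma> w a z * cos (a 1 + z 3))"
    "smooth_az 3 1 (\<lambda>a z. - w * sin (a 1) + lam \<gamma> w a z * sin (a 1 + z 3))"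
    by (intro smooth_az_add smooth_az_mult smooth_az_cos smooth_az_sin smooth_az_const l s)+
  then show ?case
    unfolding B_fun_0 by (cases "k = 1") auto
next
  case (Suc i)
  show ?case
  proof (cases "k \<le> i + 2")
    case True
    then show ?thesis
      using smooth_az_mono[OF Suc.IH, of "Suc i + 3" "Suc i + 1"] by simp
  next
    case False
    have "smooth_az (Suc i + 3) (Suc i + 1)
        (\<lambda>a z. b_coef n \<gamma> w (Suc i) a z + beta_coef n \<gamma> w (Suc i) a z * z (Suc i + 3))"
      by (intro smooth_az_add smooth_az_mult smooth_az_z smooth_az_mono[OF smooth_az_b]
          smooth_az_mono[OF smooth_az_beta]) auto
    then show ?thesis using False by simp
  qed
qed

text \<open>The second point of the divided difference is a general f because the lemma is applied
  with f = \<alpha>_i inside the induction that establishes the smoothness of \<alpha>_i.\<close>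

lemma smooth_az_D_fun:
  assumes "smooth_az (i + 2) (i + 1) f"
  shows "smooth_az (i + 3) (i + 1) (\<lambda>a z. D_fun n \<gamma> w i a z (z (i + 3)) (f a z) k)"
proof (cases i)
  case 0
  have l: "smooth_az 3 1 (\<lambda>a z. lam \<gamma> w a z)"
    by (rule smooth_az_mono[OF smooth_az_lam[OF w]]) auto
  have f: "smooth_az 3 1 f"
    by (rule smooth_az_mono[OF assms]) (auto simp: 0)
  have z: "smooth_az 3 1 (\<lambda>a z. z 3)" and a: "smooth_az 3 1 (\<lambda>a z. a 1)"
    by (intro smooth_az_z smooth_az_a; simp)+
  have s: "smooth_az 3 1 (\<lambda>a z. sinhc (- ((z 3 - f a z) / 2)\<^sup>2))"
    by (intro smooth_az_entire[OF _ entire_sinhc] smooth_az_uminus smooth_az_power smooth_az_divide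
        smooth_az_diff smooth_az_const f z) auto
  have m: "smooth_az 3 1 (\<lambda>a z. a 1 + (z 3 + f a z) / 2)"
    by (intro smooth_az_add smooth_az_divide smooth_az_const f z a) auto
  have "smooth_az 3 1 (\<lambda>a z. lam \<gamma> w a z * sinhc (- ((z 3 - f a z) / 2)\<^sup>2) * - sin (a 1 + (z 3 + f a z) / 2))"
    "smooth_az 3 1 (\<lambda>a z. lam \<gamma> w a z * sinhc (- ((z 3 - f a z) / 2)\<^sup>2) * cos (a 1 + (z 3 + f a z) / 2))"
    by (intro smooth_az_mult smooth_az_uminus smooth_az_sin smooth_az_cos l s m)+
  then show ?thesis
    unfolding 0 D_fun_0 by (cases "k = 1") auto
next
  case (Suc j)
  show ?thesis
    unfolding Suc D_fun_Suc
    by (cases "k \<le> j + 2") (auto intro: smooth_az_const smooth_az_mono[OF smooth_az_beta])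
qed

lemma V_fun_0: "V_fun n \<gamma> \<delta> w 0 a z = \<gamma>\<^sup>2 * sqnorm z * (sinhc (\<gamma>\<^sup>2 * sqnorm z))\<^sup>2"
  by (simp add: norm_xi_of sinh_eq_sinhc power_mult_distrib sqnorm_nonneg)

lemma smooth_az_V_0: "smooth_az 2 k (V_fun n \<gamma> \<delta> w 0)"
proof -
  have "smooth_az 2 k (\<lambda>a z. sqnorm z)"
    unfolding sqnorm_def by (intro smooth_az_add smooth_az_power smooth_az_z) auto
  then show ?thesis
    unfolding V_fun_0[abs_def]
    by (intro smooth_az_mult smooth_az_const smooth_az_power smooth_az_entire[OF _ entire_sinhc])
qed

text \<open>The two must be proved together, since \<alpha>_{i+1} contains derivatives of V_i and
  V_{i+1} contains \<alpha>_i. The counts differ by one: V_i involves a_1, ..., a_i only, \<alpha>_i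
  also a_{i+1}.\<close>

lemma smooth_az_alpha_V:
  "smooth_az (i + 2) (i + 1) (alpha n \<gamma> \<delta> w i) \<and> smooth_az (i + 2) i (V_fun n \<gamma> \<delta> w i)"
proof (induction i)
  case 0
  then show ?case
    using smooth_az_alpha_0[OF w] smooth_az_V_0 by (simp only: add_0)
next
  case (Suc i)
  then have A: "smooth_az (i + 2) (i + 1) (alpha n \<gamma> \<delta> w i)"
    and V: "smooth_az (i + 2) i (V_fun n \<gamma> \<delta> w i)" by auto
  let ?m = "Suc i + 2" and ?k = "Suc i + 1"
  have V1: "smooth_az (i + 2) (i + 1) (V_fun n \<gamma> \<delta> w i)"
    by (rule smooth_az_mono[OF V]) auto
  have Bs: "smooth_az ?m ?k (\<lambda>a z. B_fun n \<gamma> w i a z (z (i + 3)) k)" for k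
    by (rule smooth_az_mono[OF smooth_az_B_fun]) auto
  have Ds: "smooth_az ?m ?k (\<lambda>a z. D_fun n \<gamma> w i a z (z (i + 3)) (alpha n \<gamma> \<delta> w i a z) k)" for k
    by (rule smooth_az_mono[OF smooth_az_D_fun[OF A]]) auto
  have As: "smooth_az ?m ?k (\<lambda>a z. partial k (alpha n \<gamma> \<delta> w i a) z)"
    "smooth_az ?m ?k (\<lambda>a z. partial k (\<lambda>a. alpha n \<gamma> \<delta> w i a z) a)"
    "smooth_az ?m ?k (\<lambda>a z. partial k (V_fun n \<gamma> \<delta> w i a) z)" for k
    by (rule smooth_az_mono[OF smooth_az_partial_z[OF A]] smooth_az_mono[OF smooth_az_partial_a[OF A]]
        smooth_az_mono[OF smooth_az_partial_z[OF V1]]; simp)+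
  have "smooth_az ?m ?k (alpha n \<gamma> \<delta> w (Suc i))"
    unfolding alpha.simps
    by (intro smooth_az_add smooth_az_diff smooth_az_mult smooth_az_sum smooth_az_inverse
        smooth_az_const Bs Ds As smooth_az_mono[OF smooth_az_beta] smooth_az_mono[OF smooth_az_b]
        beta_coef_nonzero smooth_az_mono[OF A] smooth_az_z smooth_az_a) auto
  moreover have "smooth_az ?m (Suc i) (V_fun n \<gamma> \<delta> w (Suc i))"
    unfolding V_fun.simps
    by (intro smooth_az_add smooth_az_diff smooth_az_mult smooth_az_power
        smooth_az_const smooth_az_mono[OF A] smooth_az_mono[OF V] smooth_az_z) auto
  ultimately show ?case by blast
qed

lemmas smooth_az_alpha = smooth_az_alpha_V[THEN conjunct1]
  and smooth_az_V = smooth_az_alpha_V[THEN conjunct2]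

section \<open>The Lyapunov function\<close>

lemma partial_V_0:
  assumes k: "k = 1 \<or> k = 2" and "sqnorm z \<noteq> 0"
  shows "partial k (V_fun n \<gamma> \<delta> w 0 a) z =
    2 * \<gamma> * sinh (\<gamma> * sqrt (sqnorm z)) * cosh (\<gamma> * sqrt (sqnorm z)) * z k / sqrt (sqnorm z)"
proof -
  have sq: "sqnorm z > 0"
    using assms sqnorm_nonneg[of z] by simp
  have "((\<lambda>t. sqnorm (z(k := t))) has_real_derivative 2 * z k) (at (z k))"
    using k by (auto simp: sqnorm_def intro!: derivative_eq_intros)
  moreover have "((\<lambda>r. (sinh (\<gamma> * sqrt r))\<^sup>2) has_real_derivative
      2 * sinh (\<gamma> * sqrt (sqnorm z)) * (cosh (\<gamma> * sqrt (sqnorm z)) * (\<gamma> * (inverse (sqrt (sqnorm z)) / 2))))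
      (at (sqnorm (z(k := z k))))"
    using sq by (auto intro!: derivative_eq_intros)
  ultimately have "((\<lambda>t. (sinh (\<gamma> * sqrt (sqnorm (z(k := t)))))\<^sup>2) has_real_derivative
      2 * sinh (\<gamma> * sqrt (sqnorm z)) * (cosh (\<gamma> * sqrt (sqnorm z)) * (\<gamma> * (inverse (sqrt (sqnorm z)) / 2)))
        * (2 * z k)) (at (z k))"
    by (rule DERIV_chain')
  then have "deriv (\<lambda>t. V_fun n \<gamma> \<delta> w 0 a (z(k := t))) (z k) =
      2 * sinh (\<gamma> * sqrt (sqnorm z)) * (cosh (\<gamma> * sqrt (sqnorm z)) * (\<gamma> * (inverse (sqrt (sqnorm z)) / 2)))
        * (2 * z k)"
    unfolding V_fun.simps norm_xi_of by (rule DERIV_imp_deriv)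
  then show ?thesis
    unfolding partial_def by (simp add: field_simps)
qed

lemma V_Suc_partial_z:
  assumes "k \<le> i + 2"
  shows "partial k (V_fun n \<gamma> \<delta> w (Suc i) a) z = partial k (V_fun n \<gamma> \<delta> w i a) z -
    \<delta> (Suc i) * (z (i + 3) - alpha n \<gamma> \<delta> w i a z) * partial k (alpha n \<gamma> \<delta> w i a) z"
proof -
  have "k \<noteq> i + 3" using assms by simp
  then have "((\<lambda>t. V_fun n \<gamma> \<delta> w (Suc i) a (z(k := t))) has_real_derivative
     partial k (V_fun n \<gamma> \<delta> w i a) z -
    \<delta> (Suc i) * (z (i + 3) - alpha n \<gamma> \<delta> w i a z) * partial k (alpha n \<gamma> \<delta> w i a) z) (at (z k))"
    unfolding V_fun.simps
    by (auto intro!: derivative_eq_intros smooth_az_line_z[OF smooth_az_alpha] smooth_az_line_z[OF smooth_az_V])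
  then show ?thesis
    unfolding partial_def[of k "V_fun n \<gamma> \<delta> w (Suc i) a"] by (rule DERIV_imp_deriv)
qed

lemma V_Suc_partial_last:
  "partial (i + 3) (V_fun n \<gamma> \<delta> w (Suc i) a) z =
    \<delta> (Suc i) * (z (i + 3) - alpha n \<gamma> \<delta> w i a z)"
proof -
  have c: "V_fun n \<gamma> \<delta> w i a (z(i + 3 := t)) = V_fun n \<gamma> \<delta> w i a z"
    "alpha n \<gamma> \<delta> w i a (z(i + 3 := t)) = alpha n \<gamma> \<delta> w i a z" for t
    by (rule smooth_az_local[OF smooth_az_V] smooth_az_local[OF smooth_az_alpha]; simp)+
  have "((\<lambda>t. V_fun n \<gamma> \<delta> w (Suc i) a (z(i + 3 := t))) has_real_derivative
    \<delta> (Suc i) * (z (i + 3) - alpha n \<gamma> \<delta> w i a z)) (at (z (i + 3)))"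
    unfolding V_fun.simps c by (auto intro!: derivative_eq_intros)
  then show ?thesis
    unfolding partial_def by (rule DERIV_imp_deriv)
qed

lemma V_Suc_partial_a:
  "partial j (\<lambda>a. V_fun n \<gamma> \<delta> w (Suc i) a z) a = partial j (\<lambda>a. V_fun n \<gamma> \<delta> w i a z) a -
    \<delta> (Suc i) * (z (i + 3) - alpha n \<gamma> \<delta> w i a z) * partial j (\<lambda>a. alpha n \<gamma> \<delta> w i a z) a"
proof -
  have "((\<lambda>t. V_fun n \<gamma> \<delta> w (Suc i) (a(j := t)) z) has_real_derivative
     partial j (\<lambda>a. V_fun n \<gamma> \<delta> w i a z) a -
    \<delta> (Suc i) * (z (i + 3) - alpha n \<gamma> \<delta> w i a z) * partial j (\<lambda>a. alpha n \<gamma> \<delta> w i a z) a) (at (a j))"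
    unfolding V_fun.simps
    by (auto intro!: derivative_eq_intros smooth_az_line_a[OF smooth_az_alpha] smooth_az_line_a[OF smooth_az_V])
  then show ?thesis
    unfolding partial_def[of j "\<lambda>a. V_fun n \<gamma> \<delta> w (Suc i) a z"] by (rule DERIV_imp_deriv)
qed

text \<open>The left side is the derivative of V_i along z^i' = B_i(z^i, \<alpha>_i), a_j' = w
  a_{j+1}, with time measured by the integral of |v_1^D|. In the step e = \<sigma>_{i+1} -
  \<alpha>_i need not vanish; by \<open>B_fun_diff\<close> this perturbs the derivative of V_i by e
  times (grad V_i) D_i. The \<delta>^{-1} term of \<alpha>_{i+1} cancels exactly this, its
  derivative terms cancel the motion of \<alpha>_i, and -\<gamma> e contributes -\<gamma> \<delta>
  e^2, which is -2\<gamma> times the new summand of V_{i+1}.\<close>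

lemma Lyapunov_derivative:
  assumes "i \<le> n"
  shows "(\<Sum>k=1..i+2. partial k (V_fun n \<gamma> \<delta> w i a) z * B_fun n \<gamma> w i a z (alpha n \<gamma> \<delta> w i a z) k) +
    w * (\<Sum>j=1..i. partial j (\<lambda>a. V_fun n \<gamma> \<delta> w i a z) a * a (j + 1)) = - 2 * \<gamma> * V_fun n \<gamma> \<delta> w i a z"
  using assms
proof (induction i)
  case 0
  have two: "{1..0+2::nat} = {1, 2}" by auto
  show ?case
  proof (cases "sqnorm z = 0")
    case True
    then have "z 1 = 0" "z 2 = 0"
      by (auto simp: sqnorm_def)
    then show ?thesis
      using True unfolding two
      by (simp add: B_fun_0_alpha_0[OF w] V_fun_0 del: V_fun.simps B_fun.simps alpha.simps)
  next
    case False
    define r where "r = sqrt (sqnorm z)"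
    have r: "r > 0" "r\<^sup>2 = sqnorm z"
      using False sqnorm_nonneg[of z] by (simp_all add: r_def)
    define C K where "C = 2 * \<gamma> * sinh (\<gamma> * r) * cosh (\<gamma> * r)" and "K = kappa \<gamma> (sqnorm z)"
    have k: "r * kappa \<gamma> (sqnorm z) = tanh (\<gamma> * r)"
      using kappa_eq[of r \<gamma>] r by simp
    have "(\<Sum>k=1..0+2. partial k (V_fun n \<gamma> \<delta> w 0 a) z * B_fun n \<gamma> w 0 a z (alpha n \<gamma> \<delta> w 0 a z) k) =
        (C * z 1 / r) * (- K * z 1) + (C * z 2 / r) * (- K * z 2)"
      unfolding two K_def
      by (simp add: partial_V_0[OF _ False] B_fun_0_alpha_0[OF w] C_def
          flip: r_def del: V_fun.simps B_fun.simps alpha.simps)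
    also have "\<dots> = - (C / r * K) * ((z 1)\<^sup>2 + (z 2)\<^sup>2)"
      using r(1) by (simp add: field_simps power2_eq_square)
    also have "\<dots> = - (2 * \<gamma> * sinh (\<gamma> * r) * cosh (\<gamma> * r) / r * kappa \<gamma> (sqnorm z)) * sqnorm z"
      by (simp add: C_def K_def sqnorm_def)
    also have "\<dots> = - (2 * \<gamma> * sinh (\<gamma> * r) * cosh (\<gamma> * r)) * (r * kappa \<gamma> (sqnorm z))"
      using r by (simp add: power2_eq_square flip: r(2))
    \<comment> \<open>Here tanh in the feedback meets sinh^2 in V_0: sinh cosh tanh =
      sinh^2.\<close>
    also have "\<dots> = - 2 * \<gamma> * (sinh (\<gamma> * r))\<^sup>2"
      unfolding k by (simp add: tanh_def power2_eq_square)
    finally show ?thesis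
      by (simp add: norm_xi_of r_def)
  qed
next
  case (Suc i)
  define \<alpha> where "\<alpha> = alpha n \<gamma> \<delta> w i a z"
  define \<zeta> where "\<zeta> = alpha n \<gamma> \<delta> w (Suc i) a z"
  define e where "e = z (i + 3) - \<alpha>"
  define d where "d = \<delta> (Suc i)"
  have d: "d > 0" using \<delta> Suc.prems by (simp add: d_def)
  define Vz where "Vz k = partial k (V_fun n \<gamma> \<delta> w i a) z" for k
  define Az where "Az k = partial k (alpha n \<gamma> \<delta> w i a) z" for k
  define Va where "Va j = partial j (\<lambda>a. V_fun n \<gamma> \<delta> w i a z) a" for j
  define Aa where "Aa j = partial j (\<lambda>a. alpha n \<gamma> \<delta> w i a z) a" for j
  define B where "B k = B_fun n \<gamma> w i a z (z (i + 3)) k" for k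
  define B0 where "B0 k = B_fun n \<gamma> w i a z \<alpha> k" for k
  define D where "D k = D_fun n \<gamma> w i a z (z (i + 3)) \<alpha> k" for k
  define b where "b = b_coef n \<gamma> w (Suc i) a z"
  define \<beta> where "\<beta> = beta_coef n \<gamma> w (Suc i) a z"
  have IH: "(\<Sum>k=1..i+2. Vz k * B0 k) + w * (\<Sum>j=1..i. Va j * a (j + 1)) =
      - 2 * \<gamma> * V_fun n \<gamma> \<delta> w i a z"
    using Suc by (simp only: Vz_def B0_def Va_def \<alpha>_def)
  have BD: "B k = B0 k + e * D k" for k
    unfolding B_def B0_def D_def e_def by (rule B_fun_diff)
  have VB: "(\<Sum>k=1..i+2. Vz k * B k) = (\<Sum>k=1..i+2. Vz k * B0 k) + e * (\<Sum>k=1..i+2. Vz k * D k)"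
    by (simp add: BD sum.distrib sum_distrib_left algebra_simps)
  have \<zeta>: "\<beta> * \<zeta> = (\<Sum>k=1..i+2. Az k * B k) + w * (\<Sum>j=1..Suc i. Aa j * a (j + 1)) -
      inverse d * (\<Sum>k=1..i+2. Vz k * D k) - b - \<gamma> * e"
    using beta_coef_nonzero[of "Suc i" a z]
    unfolding \<zeta>_def alpha.simps \<beta>_def Az_def B_def Aa_def d_def Vz_def D_def b_def e_def \<alpha>_def
    by (simp del: sum.cl_ivl_Suc)
  have "{1..Suc i + 2} = insert (i + 3) {1..i+2}" by auto
  then have "(\<Sum>k=1..Suc i+2. partial k (V_fun n \<gamma> \<delta> w (Suc i) a) z * B_fun n \<gamma> w (Suc i) a z \<zeta> k) =
      partial (i + 3) (V_fun n \<gamma> \<delta> w (Suc i) a) z * B_fun n \<gamma> w (Suc i) a z \<zeta> (i + 3) +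
      (\<Sum>k=1..i+2. partial k (V_fun n \<gamma> \<delta> w (Suc i) a) z * B_fun n \<gamma> w (Suc i) a z \<zeta> k)"
    by simp
  also have "partial (i + 3) (V_fun n \<gamma> \<delta> w (Suc i) a) z * B_fun n \<gamma> w (Suc i) a z \<zeta> (i + 3) =
      d * e * (b + \<beta> * \<zeta>)"
    unfolding V_Suc_partial_last by (simp add: d_def e_def b_def \<beta>_def \<alpha>_def)
  also have "(\<Sum>k=1..i+2. partial k (V_fun n \<gamma> \<delta> w (Suc i) a) z * B_fun n \<gamma> w (Suc i) a z \<zeta> k) =
      (\<Sum>k=1..i+2. (Vz k - d * e * Az k) * B k)"
    by (intro sum.cong refl) (simp add: V_Suc_partial_z Vz_def d_def e_def Az_def B_def \<alpha>_def del: V_fun.simps)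
  also have "\<dots> = (\<Sum>k=1..i+2. Vz k * B k) - d * e * (\<Sum>k=1..i+2. Az k * B k)"
    by (simp add: sum_subtractf sum_distrib_left algebra_simps del: sum.cl_ivl_Suc)
  finally have 1: "(\<Sum>k=1..Suc i+2. partial k (V_fun n \<gamma> \<delta> w (Suc i) a) z * B_fun n \<gamma> w (Suc i) a z \<zeta> k) =
      d * e * (b + \<beta> * \<zeta>) + ((\<Sum>k=1..i+2. Vz k * B k) - d * e * (\<Sum>k=1..i+2. Az k * B k))" .
  \<comment> \<open>The sum for V_{i+1} runs one index further than the one for V_i; the extra
    derivative of V_i vanishes because V_i does not involve a_{i+1}.\<close>
  have "Va (Suc i) = 0"
    unfolding Va_def by (rule smooth_az_partial_a_outside[OF smooth_az_V]) simp
  then have Va: "(\<Sum>j=1..Suc i. Va j * a (j + 1)) = (\<Sum>j=1..i. Va j * a (j + 1))"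
    by simp
  have 2: "(\<Sum>j=1..Suc i. partial j (\<lambda>a. V_fun n \<gamma> \<delta> w (Suc i) a z) a * a (j + 1)) =
      (\<Sum>j=1..i. Va j * a (j + 1)) - d * e * (\<Sum>j=1..Suc i. Aa j * a (j + 1))"
    unfolding V_Suc_partial_a Va[symmetric]
    by (simp add: Va_def d_def e_def Aa_def \<alpha>_def sum_subtractf sum.distrib sum_distrib_left algebra_simps del: sum.cl_ivl_Suc)
  have 3: "V_fun n \<gamma> \<delta> w (Suc i) a z = V_fun n \<gamma> \<delta> w i a z + 1/2 * d * e\<^sup>2"
    by (simp add: d_def e_def \<alpha>_def)
  define SVB SVD SAB SVa SAa where "SVB = (\<Sum>k=1..i+2. Vz k * B0 k)"
    and "SVD = (\<Sum>k=1..i+2. Vz k * D k)" and "SAB = (\<Sum>k=1..i+2. Az k * B k)"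
    and "SVa = (\<Sum>j=1..i. Va j * a (j + 1))" and "SAa = (\<Sum>j=1..Suc i. Aa j * a (j + 1))"
  have "d * e * (b + (SAB + w * SAa - inverse d * SVD - b - \<gamma> * e)) + (SVB + e * SVD - d * e * SAB) +
      w * (SVa - d * e * SAa) = SVB + w * SVa - \<gamma> * d * e\<^sup>2"
    using d by (simp add: field_simps power2_eq_square)
  also have "\<dots> = - 2 * \<gamma> * (V_fun n \<gamma> \<delta> w i a z + 1/2 * d * e\<^sup>2)"
    using IH unfolding SVB_def[symmetric] SVa_def[symmetric] by (simp add: algebra_simps)
  finally show ?case
    unfolding 1[unfolded \<zeta>_def[symmetric]] \<zeta>_def[symmetric] 2 3 \<zeta> VB
      SVB_def SVD_def SAB_def SVa_def SAa_def .
qed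

end

section \<open>Positivity of V and the equilibrium at zero error\<close>

context backstepping
begin

lemma V_nonneg: "i \<le> n \<Longrightarrow> V_fun n \<gamma> \<delta> w i a z \<ge> 0"
proof (induction i)
  case (Suc i)
  then show ?case
    using \<delta>[of "Suc i"] by auto
qed simp

lemma V_mono: "i \<le> j \<Longrightarrow> j \<le> n \<Longrightarrow> V_fun n \<gamma> \<delta> w i a z \<le> V_fun n \<gamma> \<delta> w j a z"
proof (induction j)
  case (Suc j)
  show ?case
  proof (cases "i = Suc j")
    case False
    then have "V_fun n \<gamma> \<delta> w i a z \<le> V_fun n \<gamma> \<delta> w j a z"
      using Suc by simp
    also have "\<dots> \<le> V_fun n \<gamma> \<delta> w (Suc j) a z"
      using \<delta>[of "Suc j"] Suc.prems by simp
    finally show ?thesis .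
  qed simp
qed simp

lemma V_ge_sqnorm: "\<gamma>\<^sup>2 * sqnorm z \<le> V_fun n \<gamma> \<delta> w n a z"
proof -
  define x where "x = \<gamma> * norm (xi_of z)"
  have x: "x \<ge> 0"
    using \<gamma> by (simp add: x_def)
  have "x \<le> sinh x"
    using real_le_x_sinh[OF x] by (simp add: sinh_def exp_minus)
  then have "x\<^sup>2 \<le> (sinh x)\<^sup>2"
    using x by (rule power_mono)
  moreover have "x\<^sup>2 = \<gamma>\<^sup>2 * sqnorm z"
    by (simp add: x_def norm_xi_of power_mult_distrib sqnorm_nonneg)
  ultimately show ?thesis
    using V_mono[of 0 n a z] by (simp add: x_def)
qed

lemma V_ge_error:
  assumes "i < n"
  shows "1/2 * \<delta> (Suc i) * (z (i + 3) - alpha n \<gamma> \<delta> w i a z)\<^sup>2 \<le> V_fun n \<gamma> \<delta> w n a z"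
  using V_mono[of "Suc i" n a z] V_nonneg[of i a z] assms by simp

lemma lam_zero: "z 1 = 0 \<Longrightarrow> z 2 = 0 \<Longrightarrow> lam \<gamma> w a z = w"
  unfolding lam_eq[OF w] c_vec_components by simp

lemma B_fun_zero: "(\<And>k. 1 \<le> k \<Longrightarrow> k \<le> i + 2 \<Longrightarrow> z k = 0) \<Longrightarrow> B_fun n \<gamma> w i a z 0 k = 0"
proof (induction i)
  case 0
  then show ?case
    unfolding B_fun_0 by (simp add: lam_zero)
next
  case (Suc i)
  then have "z 1 = 0" "z 2 = 0" "z (i + 3) = 0"
    by auto
  then show ?case
    using Suc by (auto simp: b_coef_def lam_zero)
qed

text \<open>At z^i = 0 the nonnegative function V_i attains its minimum, so its gradient vanishes
  there; \<alpha>_i is 0 for every a, so its derivatives in a vanish; and B_i(0, 0) = 0. Every term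
  of the recursion is then 0.\<close>

lemma alpha_V_zero:
  assumes "i \<le> n" "\<And>k. 1 \<le> k \<Longrightarrow> k \<le> i + 2 \<Longrightarrow> z k = 0"
  shows "alpha n \<gamma> \<delta> w i a z = 0 \<and> V_fun n \<gamma> \<delta> w i a z = 0"
  using assms
proof (induction i arbitrary: a)
  case 0
  then show ?case
    unfolding V_fun_0 alpha.simps c_vec_components by (simp add: sqnorm_def)
next
  case (Suc i)
  have A: "alpha n \<gamma> \<delta> w i a z = 0" and V: "V_fun n \<gamma> \<delta> w i a z = 0" for a
    using Suc.IH[of a] Suc.prems by auto
  have z: "z 1 = 0" "z 2 = 0" "z (i + 3) = 0"
    using Suc.prems(2) by auto
  have B: "B_fun n \<gamma> w i a z 0 k = 0" for k
    using Suc.prems(2) by (intro B_fun_zero) auto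
  have pA: "partial j (\<lambda>a. alpha n \<gamma> \<delta> w i a z) a = 0" for j
    using A by (simp add: partial_def)
  have pV: "partial k (V_fun n \<gamma> \<delta> w i a) z = 0" for k
  proof (rule DERIV_local_min[OF smooth_az_line_z[OF smooth_az_V] zero_less_one])
    show "\<forall>y. \<bar>z k - y\<bar> < 1 \<longrightarrow> V_fun n \<gamma> \<delta> w i a (z(k := z k)) \<le> V_fun n \<gamma> \<delta> w i a (z(k := y))"
      using V V_nonneg Suc.prems(1) by simp
  qed
  have "alpha n \<gamma> \<delta> w (Suc i) a z = 0"
    unfolding alpha.simps unfolding pA pV unfolding A z B
    by (simp add: b_coef_def lam_zero[OF z(1,2)])
  moreover have "V_fun n \<gamma> \<delta> w (Suc i) a z = 0"
    using z A V by simp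
  ultimately show ?case ..
qed

subsection \<open>Periodicity in the heading angle\<close>

text \<open>The reference heading, which is substituted for \<open>a 1\<close>, may be unbounded.\<close>

lemma periodic:
  fixes e :: int
  defines "sh \<equiv> (\<lambda>a :: nat \<Rightarrow> real. a(1 := a 1 + 2 * pi * of_int e))"
  shows c_vec_periodic: "c_vec \<gamma> w (sh a) z = c_vec \<gamma> w a z"
    and lam_periodic: "lam \<gamma> w (sh a) z = lam \<gamma> w a z"
    and beta_coef_periodic: "beta_coef n \<gamma> w i (sh a) z = beta_coef n \<gamma> w i a z"
    and b_coef_periodic: "b_coef n \<gamma> w (Suc i) (sh a) z = b_coef n \<gamma> w (Suc i) a z"
    and B_fun_periodic: "B_fun n \<gamma> w i (sh a) z \<zeta> k = B_fun n \<gamma> w i a z \<zeta> k"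
    and D_fun_periodic: "D_fun n \<gamma> w i (sh a) z \<zeta> \<eta> k = D_fun n \<gamma> w i a z \<zeta> \<eta> k"
proof -
  have cs: "cos (x + 2 * pi * of_int e) = cos x" "sin (x + 2 * pi * of_int e) = sin x" for x
    by (simp_all add: cos_add sin_add)
  have cs2: "cos (x + 2 * pi * of_int e + y) = cos (x + y)" "sin (x + 2 * pi * of_int e + y) = sin (x + y)" for x y
    using cs[of "x + y"] by (simp_all add: ac_simps)
  show 1: "c_vec \<gamma> w (sh a) z = c_vec \<gamma> w a z" for a z
    unfolding vec_eq_iff forall_2 c_vec_components by (simp add: sh_def cs)
  show 2: "lam \<gamma> w (sh a) z = lam \<gamma> w a z" for a z
    unfolding lam_def 1 ..
  show 3: "beta_coef n \<gamma> w i (sh a) z = beta_coef n \<gamma> w i a z" for i a z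
    unfolding beta_coef_def 2 ..
  show 4: "b_coef n \<gamma> w (Suc i) (sh a) z = b_coef n \<gamma> w (Suc i) a z" for i a z
    unfolding b_coef_def 2 by (simp add: sh_def)
  show 5: "B_fun n \<gamma> w i (sh a) z \<zeta> k = B_fun n \<gamma> w i a z \<zeta> k" for i a z \<zeta> k
  proof (induction i arbitrary: \<zeta>)
    case 0
    show ?case
      unfolding B_fun_0 2 by (simp add: sh_def cs cs2)
  qed (simp add: 3 4)
  show "D_fun n \<gamma> w i (sh a) z \<zeta> \<eta> k = D_fun n \<gamma> w i a z \<zeta> \<eta> k"
    unfolding D_fun_def 5 ..
qed

text \<open>Differentiation commutes with the shift: for j = 1 by the chain rule with t - T,
  otherwise because the shift leaves coordinate j alone.\<close>

lemma partial_a_periodic: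
  fixes e :: int
  defines "sh \<equiv> (\<lambda>a :: nat \<Rightarrow> real. a(1 := a 1 + 2 * pi * of_int e))"
  assumes f: "smooth_az m k f" and per: "\<And>a. f (sh a) z = f a z"
  shows "partial j (\<lambda>a. f a z) (sh a) = partial j (\<lambda>a. f a z) a"
proof (cases "j = 1")
  case True
  define T where "T = 2 * pi * of_int e"
  have "((\<lambda>t. t - T) has_real_derivative 1) (at (a 1 + T))"
    by (auto intro!: derivative_eq_intros)
  moreover have "((\<lambda>t. f (a(1 := t)) z) has_real_derivative partial 1 (\<lambda>a. f a z) a) (at (a 1 + T - T))"
    using smooth_az_line_a[OF f] by simp
  ultimately have "((\<lambda>t. f (a(1 := t - T)) z) has_real_derivative partial 1 (\<lambda>a. f a z) a * 1) (at (a 1 + T))"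
    by (rule DERIV_chain')
  moreover have "f (a(1 := t - T)) z = f ((sh a)(1 := t)) z" for t
    using per[of "a(1 := t - T)"] by (simp add: sh_def T_def)
  ultimately have "((\<lambda>t. f ((sh a)(1 := t)) z) has_real_derivative partial 1 (\<lambda>a. f a z) a) (at (sh a 1))"
    by (simp add: sh_def T_def)
  then show ?thesis
    unfolding True partial_def[of 1 _ "sh a"] by (rule DERIV_imp_deriv)
next
  case False
  then have "(sh a)(j := t) = sh (a(j := t))" "sh a j = a j" for t
    by (auto simp: sh_def)
  then show ?thesis
    by (simp add: partial_def per)
qed

lemma alpha_V_periodic:
  fixes e :: int
  defines "sh \<equiv> (\<lambda>a :: nat \<Rightarrow> real. a(1 := a 1 + 2 * pi * of_int e))"
  shows "alpha n \<gamma> \<delta> w i (sh a) = alpha n \<gamma> \<delta> w i a \<and> V_fun n \<gamma> \<delta> w i (sh a) = V_fun n \<gamma> \<delta> w i a"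
proof (induction i arbitrary: a)
  case 0
  show ?case
    unfolding alpha.simps V_fun.simps sh_def c_vec_periodic by simp
next
  case (Suc i)
  then have IH: "alpha n \<gamma> \<delta> w i (sh a) = alpha n \<gamma> \<delta> w i a"
    "V_fun n \<gamma> \<delta> w i (sh a) = V_fun n \<gamma> \<delta> w i a" for a by auto
  have pa: "partial j (\<lambda>a. alpha n \<gamma> \<delta> w i a z) (sh a) = partial j (\<lambda>a. alpha n \<gamma> \<delta> w i a z) a" for j a z
    unfolding sh_def by (rule partial_a_periodic[OF smooth_az_alpha]) (use IH in \<open>simp add: sh_def\<close>)
  \<comment> \<open>The recursion uses the values of a only at indices j + 1 \<ge> 2, which the
    shift does not touch.\<close>
  have sh_j: "(\<Sum>j=1..Suc i. X j * sh a (j + 1)) = (\<Sum>j=1..Suc i. X j * a (j + 1))" for X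
    by (intro sum.cong) (auto simp: sh_def)
  show ?case
    unfolding alpha.simps V_fun.simps IH pa sh_j
    unfolding sh_def B_fun_periodic D_fun_periodic beta_coef_periodic b_coef_periodic
    by (rule conjI; rule refl)
qed

lemmas alpha_periodic = alpha_V_periodic[THEN conjunct1]

subsection \<open>The error dynamics\<close>

text \<open>The vector field of the error equation without the factor |v_1^D|.\<close>

definition rhs :: "(nat \<Rightarrow> real) \<Rightarrow> (nat \<Rightarrow> real) \<Rightarrow> nat \<Rightarrow> real" where
  "rhs a z k = B_fun n \<gamma> w n a z (alpha n \<gamma> \<delta> w n a z) k"

lemma B_fun_low: "k \<le> i + 2 \<Longrightarrow> B_fun n \<gamma> w (Suc (i + d)) a z \<zeta> k = B_fun n \<gamma> w i a z (z (i + 3)) k"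
  by (induction d arbitrary: \<zeta>) auto

lemma rhs_low: "i < n \<Longrightarrow> k \<le> i + 2 \<Longrightarrow> rhs a z k = B_fun n \<gamma> w i a z (z (i + 3)) k"
  unfolding rhs_def using B_fun_low[of k i "n - Suc i" a z] by simp

lemma rhs_xi:
  "rhs a z 1 = - w * cos (a 1) + lam \<gamma> w a z * cos (a 1 + z 3)"
  "rhs a z 2 = - w * sin (a 1) + lam \<gamma> w a z * sin (a 1 + z 3)"
  using n rhs_low[of 0 1 a z] rhs_low[of 0 2 a z] unfolding B_fun_0 by auto

lemma rhs_sigma:
  assumes "1 \<le> j" "j < n"
  shows "rhs a z (j + 2) = lam \<gamma> w a z * (z (j + 3) + a (j + 1)) - w * a (j + 1)"
proof -
  obtain i where i: "j = Suc i" using assms by (cases j) auto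
  show ?thesis
    using assms rhs_low[of j "j + 2" a z] unfolding i
    by (simp add: b_coef_def beta_coef_def algebra_simps)
qed

lemma rhs_last: "rhs a z (n + 2) = alpha n \<gamma> \<delta> w n a z"
proof -
  obtain m where m: "n = Suc m" using n by (cases n) auto
  show ?thesis
    unfolding rhs_def by (subst (2) m) (simp add: m b_coef_def beta_coef_def del: alpha.simps)
qed

lemma smooth_az_rhs:
  assumes "1 \<le> k" "k \<le> n + 2"
  shows "smooth_az (n + 2) (n + 1) (\<lambda>a z. rhs a z k)"
proof (cases "k = n + 2")
  case True
  then show ?thesis
    using smooth_az_alpha[of n] unfolding True rhs_last by simp
next
  case False
  then have "rhs a z k = B_fun n \<gamma> w (n - 1) a z (z (n - 1 + 3)) k" for a z
    using assms n by (intro rhs_low) auto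
  then show ?thesis
    using smooth_az_mono[OF smooth_az_B_fun[of "n - 1" k], of "n + 2" "n + 1"] n by simp
qed

lemma rhs_periodic: "rhs (a(1 := a 1 + 2 * pi * of_int e)) z k = rhs a z k"
  unfolding rhs_def B_fun_periodic alpha_periodic ..

lemma rhs_zero: "(\<And>k. 1 \<le> k \<Longrightarrow> k \<le> n + 2 \<Longrightarrow> z k = 0) \<Longrightarrow> rhs a z k = 0"
  unfolding rhs_def using alpha_V_zero[of n z a] B_fun_zero[of n z a k] by simp

lemma rhs_Lipschitz:
  obtains L where "L \<ge> 0" "\<And>a z z' k. 1 \<le> k \<Longrightarrow> k \<le> n + 2 \<Longrightarrow>
    (\<And>j. 2 \<le> j \<Longrightarrow> j \<le> n + 1 \<Longrightarrow> \<bar>a j\<bar> \<le> R) \<Longrightarrow>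
    (\<And>j. 1 \<le> j \<Longrightarrow> j \<le> n + 2 \<Longrightarrow> \<bar>z j\<bar> \<le> R) \<Longrightarrow> (\<And>j. 1 \<le> j \<Longrightarrow> j \<le> n + 2 \<Longrightarrow> \<bar>z' j\<bar> \<le> R) \<Longrightarrow>
    \<bar>rhs a z k - rhs a z' k\<bar> \<le> L * (\<Sum>j=1..n+2. \<bar>z j - z' j\<bar>)"
proof -
  define Q where "Q k L \<longleftrightarrow> L \<ge> 0 \<and> (\<forall>a z z'. (\<forall>j. 2 \<le> j \<longrightarrow> j \<le> n + 1 \<longrightarrow> \<bar>a j\<bar> \<le> R) \<longrightarrow>
    (\<forall>j. 1 \<le> j \<longrightarrow> j \<le> n + 2 \<longrightarrow> \<bar>z j\<bar> \<le> R) \<longrightarrow> (\<forall>j. 1 \<le> j \<longrightarrow> j \<le> n + 2 \<longrightarrow> \<bar>z' j\<bar> \<le> R) \<longrightarrow>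
    \<bar>rhs a z k - rhs a z' k\<bar> \<le> L * (\<Sum>j=1..n+2. \<bar>z j - z' j\<bar>))" for k L
  have "\<exists>L. 1 \<le> k \<longrightarrow> k \<le> n + 2 \<longrightarrow> Q k L" for k
  proof (cases "1 \<le> k \<and> k \<le> n + 2")
    case True
    show ?thesis
      by (rule smooth_az_Lipschitz[where R = R, OF smooth_az_rhs[OF True[THEN conjunct1] True[THEN conjunct2]] rhs_periodic])
        (unfold Q_def, intro exI conjI impI allI; blast)
  qed auto
  then obtain L where "\<And>k. 1 \<le> k \<Longrightarrow> k \<le> n + 2 \<Longrightarrow> Q k (L k)"
    by metis
  then have L: "\<And>k. 1 \<le> k \<Longrightarrow> k \<le> n + 2 \<Longrightarrow> L k \<ge> 0" "\<And>k a z z'. 1 \<le> k \<Longrightarrow> k \<le> n + 2 \<Longrightarrow>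
    (\<forall>j. 2 \<le> j \<longrightarrow> j \<le> n + 1 \<longrightarrow> \<bar>a j\<bar> \<le> R) \<Longrightarrow>
    (\<forall>j. 1 \<le> j \<longrightarrow> j \<le> n + 2 \<longrightarrow> \<bar>z j\<bar> \<le> R) \<Longrightarrow> (\<forall>j. 1 \<le> j \<longrightarrow> j \<le> n + 2 \<longrightarrow> \<bar>z' j\<bar> \<le> R) \<Longrightarrow>
    \<bar>rhs a z k - rhs a z' k\<bar> \<le> L k * (\<Sum>j=1..n+2. \<bar>z j - z' j\<bar>)"
    unfolding Q_def by blast+
  show ?thesis
  proof (rule that[of "\<Sum>k=1..n+2. L k"])
    show "(\<Sum>k=1..n+2. L k) \<ge> 0"
      using L(1) by (intro sum_nonneg) auto
    fix a z z' :: "nat \<Rightarrow> real" and k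
    assume k: "1 \<le> k" "k \<le> n + 2" and b: "\<And>j. 2 \<le> j \<Longrightarrow> j \<le> n + 1 \<Longrightarrow> \<bar>a j\<bar> \<le> R"
      "\<And>j. 1 \<le> j \<Longrightarrow> j \<le> n + 2 \<Longrightarrow> \<bar>z j\<bar> \<le> R" "\<And>j. 1 \<le> j \<Longrightarrow> j \<le> n + 2 \<Longrightarrow> \<bar>z' j\<bar> \<le> R"
    have "L k \<le> (\<Sum>k=1..n+2. L k)"
      using k L(1) by (intro member_le_sum) auto
    then show "\<bar>rhs a z k - rhs a z' k\<bar> \<le> (\<Sum>k=1..n+2. L k) * (\<Sum>j=1..n+2. \<bar>z j - z' j\<bar>)"
      by (intro order_trans[OF L(2)[OF k, of a z z'] mult_right_mono] sum_nonneg) (use b in auto)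
  qed
qed

lemma alpha_bound:
  assumes "i \<le> n"
  obtains L where "L \<ge> 0" "\<And>a z. (\<And>j. 2 \<le> j \<Longrightarrow> j \<le> n + 1 \<Longrightarrow> \<bar>a j\<bar> \<le> R) \<Longrightarrow>
    (\<And>j. 1 \<le> j \<Longrightarrow> j \<le> i + 2 \<Longrightarrow> \<bar>z j\<bar> \<le> R) \<Longrightarrow>
    \<bar>alpha n \<gamma> \<delta> w i a z\<bar> \<le> L * (\<Sum>j=1..i+2. \<bar>z j\<bar>)"
proof -
  \<comment> \<open>The radius \<open>max R 0\<close> puts the zero vector, the comparison point,
    into the box for negative R as well.\<close>
  obtain L where L: "L \<ge> 0" "\<And>a z z'. (\<And>j. 2 \<le> j \<Longrightarrow> j \<le> i + 1 \<Longrightarrow> \<bar>a j\<bar> \<le> max R 0) \<Longrightarrow>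
    (\<And>j. 1 \<le> j \<Longrightarrow> j \<le> i + 2 \<Longrightarrow> \<bar>z j\<bar> \<le> max R 0) \<Longrightarrow> (\<And>j. 1 \<le> j \<Longrightarrow> j \<le> i + 2 \<Longrightarrow> \<bar>z' j\<bar> \<le> max R 0) \<Longrightarrow>
    \<bar>alpha n \<gamma> \<delta> w i a z - alpha n \<gamma> \<delta> w i a z'\<bar> \<le> L * (\<Sum>j=1..i+2. \<bar>z j - z' j\<bar>)"
    by (rule smooth_az_Lipschitz[where R = "max R 0", OF smooth_az_alpha[of i]])
      (use alpha_periodic in auto)
  show ?thesis
  proof (rule that[OF L(1)])
    fix a z :: "nat \<Rightarrow> real"
    assume "\<And>j. 2 \<le> j \<Longrightarrow> j \<le> n + 1 \<Longrightarrow> \<bar>a j\<bar> \<le> R" "\<And>j. 1 \<le> j \<Longrightarrow> j \<le> i + 2 \<Longrightarrow> \<bar>z j\<bar> \<le> R"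
    then have "\<bar>alpha n \<gamma> \<delta> w i a z - alpha n \<gamma> \<delta> w i a (\<lambda>_. 0)\<bar> \<le> L * (\<Sum>j=1..i+2. \<bar>z j - 0\<bar>)"
      using assms by (intro L(2)) (auto simp: max.coboundedI1)
    then show "\<bar>alpha n \<gamma> \<delta> w i a z\<bar> \<le> L * (\<Sum>j=1..i+2. \<bar>z j\<bar>)"
      using alpha_V_zero[OF assms, of "\<lambda>_. 0" a] by simp
  qed
qed

text \<open>Induction over the coordinates: V bounds \<xi>, and then each difference \<sigma>_{i+1}
  - \<alpha>_i, while \<alpha>_i is bounded on the box already found. Since
  \<open>alpha_bound\<close> is insensitive to a_1, so is the resulting radius.\<close>

lemma V_sublevel_bounded:
  obtains R' where "R' \<ge> 0" "\<And>a z k. (\<And>j. 2 \<le> j \<Longrightarrow> j \<le> n + 1 \<Longrightarrow> \<bar>a j\<bar> \<le> R) \<Longrightarrow>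
    V_fun n \<gamma> \<delta> w n a z \<le> C \<Longrightarrow> 1 \<le> k \<Longrightarrow> k \<le> n + 2 \<Longrightarrow> \<bar>z k\<bar> \<le> R'"
proof -
  have "\<exists>R'\<ge>0. \<forall>a z k. (\<forall>j. 2 \<le> j \<longrightarrow> j \<le> n + 1 \<longrightarrow> \<bar>a j\<bar> \<le> R) \<longrightarrow>
    V_fun n \<gamma> \<delta> w n a z \<le> C \<longrightarrow> 1 \<le> k \<longrightarrow> k \<le> i + 2 \<longrightarrow> \<bar>z k\<bar> \<le> R'" if "i \<le> n" for i
    using that
  proof (induction i)
    case 0
    have "\<bar>z k\<bar> \<le> sqrt \<bar>C\<bar> / \<gamma>" if "V_fun n \<gamma> \<delta> w n a z \<le> C" "1 \<le> k" "k \<le> 0 + 2" for a z k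
    proof -
      have "k = 1 \<or> k = 2" using that by auto
      then have "(z k)\<^sup>2 \<le> sqnorm z"
        by (auto simp: sqnorm_def)
      then have "\<gamma>\<^sup>2 * (z k)\<^sup>2 \<le> \<gamma>\<^sup>2 * sqnorm z"
        by (simp add: mult_left_mono)
      then have "(\<gamma> * z k)\<^sup>2 \<le> \<bar>C\<bar>"
        using V_ge_sqnorm[of z a] that(1) by (simp add: power_mult_distrib)
      then have "\<bar>\<gamma> * z k\<bar> \<le> sqrt \<bar>C\<bar>"
        by (rule real_le_rsqrt[of "\<bar>\<gamma> * z k\<bar>", simplified])
      then show ?thesis
        using \<gamma> by (simp add: abs_mult field_simps)
    qed
    then show ?case
      using \<gamma> by (intro exI[of _ "sqrt \<bar>C\<bar> / \<gamma>"]) auto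
  next
    case (Suc i)
    then obtain R1 where R1: "R1 \<ge> 0" "\<And>a z k. (\<forall>j. 2 \<le> j \<longrightarrow> j \<le> n + 1 \<longrightarrow> \<bar>a j\<bar> \<le> R) \<Longrightarrow>
        V_fun n \<gamma> \<delta> w n a z \<le> C \<Longrightarrow> 1 \<le> k \<Longrightarrow> k \<le> i + 2 \<Longrightarrow> \<bar>z k\<bar> \<le> R1"
      by auto
    obtain L where L: "L \<ge> 0" "\<And>a z. (\<And>j. 2 \<le> j \<Longrightarrow> j \<le> n + 1 \<Longrightarrow> \<bar>a j\<bar> \<le> max R R1) \<Longrightarrow>
      (\<And>j. 1 \<le> j \<Longrightarrow> j \<le> i + 2 \<Longrightarrow> \<bar>z j\<bar> \<le> max R R1) \<Longrightarrow>
      \<bar>alpha n \<gamma> \<delta> w i a z\<bar> \<le> L * (\<Sum>j=1..i+2. \<bar>z j\<bar>)"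
      using Suc.prems by (rule_tac alpha_bound[of i "max R R1"]) auto
    define d where "d = \<delta> (Suc i)"
    have d: "d > 0" using \<delta> Suc.prems by (simp add: d_def)
    \<comment> \<open>The root comes from (1/2) d e^2 \<le> |C|, the second summand bounds
      |\<alpha>_i| on the box of radius R1.\<close>
    define R2 where "R2 = sqrt (2 * \<bar>C\<bar> / d) + L * (\<Sum>j=1..i+2. R1)"
    have R2: "R2 \<ge> 0"
      using d L(1) R1(1) by (simp add: R2_def sum_nonneg)
    have "\<bar>z (i + 3)\<bar> \<le> R2" if a: "\<forall>j. 2 \<le> j \<longrightarrow> j \<le> n + 1 \<longrightarrow> \<bar>a j\<bar> \<le> R"
      and V: "V_fun n \<gamma> \<delta> w n a z \<le> C" for a z
    proof -
      have "1/2 * d * (z (i + 3) - alpha n \<gamma> \<delta> w i a z)\<^sup>2 \<le> \<bar>C\<bar>"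
        using V_ge_error[of i z a] V Suc.prems by (simp add: d_def)
      then have "(z (i + 3) - alpha n \<gamma> \<delta> w i a z)\<^sup>2 \<le> 2 * \<bar>C\<bar> / d"
        using d by (simp add: field_simps)
      then have "\<bar>z (i + 3) - alpha n \<gamma> \<delta> w i a z\<bar> \<le> sqrt (2 * \<bar>C\<bar> / d)"
        using real_le_rsqrt[of "\<bar>z (i + 3) - alpha n \<gamma> \<delta> w i a z\<bar>"] by simp
      moreover have "\<bar>alpha n \<gamma> \<delta> w i a z\<bar> \<le> L * (\<Sum>j=1..i+2. \<bar>z j\<bar>)"
        using a R1(2)[OF a V] by (intro L(2)) (auto simp: le_max_iff_disj)
      moreover have "L * (\<Sum>j=1..i+2. \<bar>z j\<bar>) \<le> L * (\<Sum>j=1..i+2. R1)"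
        using R1(2)[OF a V] L(1) by (intro mult_left_mono sum_mono) auto
      ultimately show ?thesis
        unfolding R2_def by linarith
    qed
    moreover have "\<bar>z k\<bar> \<le> R1" if "\<forall>j. 2 \<le> j \<longrightarrow> j \<le> n + 1 \<longrightarrow> \<bar>a j\<bar> \<le> R"
      "V_fun n \<gamma> \<delta> w n a z \<le> C" "1 \<le> k" "k \<le> i + 2" for a z k
      using R1(2) that by blast
    moreover have "k = i + 3 \<or> k \<le> i + 2" if "k \<le> Suc i + 2" for k
      using that by auto
    ultimately show ?case
      using R2 by (intro exI[of _ "max R1 R2"]) (force simp: le_max_iff_disj)
  qed
  then obtain R' where "R' \<ge> 0" "\<forall>a z k. (\<forall>j. 2 \<le> j \<longrightarrow> j \<le> n + 1 \<longrightarrow> \<bar>a j\<bar> \<le> R) \<longrightarrow>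
    V_fun n \<gamma> \<delta> w n a z \<le> C \<longrightarrow> 1 \<le> k \<longrightarrow> k \<le> n + 2 \<longrightarrow> \<bar>z k\<bar> \<le> R'"
    by blast
  then show ?thesis
    by (intro that[of R']) blast+
qed

end

section \<open>A priori bounds, uniqueness and global existence for the error equation\<close>

text \<open>Abstract data of a reference: \<nu> stands for |v_1^D| and a_j for s_j^D. The bound R
  concerns only a_2, ..., a_{n+1}, since the heading a_1 may be unbounded.\<close>

locale error_system = backstepping +
  fixes \<nu> :: "real \<Rightarrow> real" and a :: "real \<Rightarrow> nat \<Rightarrow> real" and \<nu>0 \<nu>1 R :: real
  assumes \<nu>0: "\<nu>0 > 0" and \<nu>: "\<And>t. t \<ge> 0 \<Longrightarrow> \<nu>0 \<le> \<nu> t" "\<And>t. t \<ge> 0 \<Longrightarrow> \<nu> t \<le> \<nu>1"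
    and \<nu>_cont: "continuous_on {0..} \<nu>"
    and a_cont: "\<And>j. continuous_on {0..} (\<lambda>t. a t j)"
    and a_bound: "\<And>j t. 2 \<le> j \<Longrightarrow> j \<le> n + 1 \<Longrightarrow> t \<ge> 0 \<Longrightarrow> \<bar>a t j\<bar> \<le> R"
    and a_deriv: "\<And>j t. 1 \<le> j \<Longrightarrow> j \<le> n \<Longrightarrow> t \<ge> 0 \<Longrightarrow>
      ((\<lambda>t. a t j) has_real_derivative \<nu> t * (w * a t (j + 1))) (at t within {0..})"
begin

definition error_solution :: "real set \<Rightarrow> (real \<Rightarrow> nat \<Rightarrow> real) \<Rightarrow> bool" where
  "error_solution S z \<longleftrightarrow> (\<forall>t\<in>S. \<forall>k. 1 \<le> k \<longrightarrow> k \<le> n + 2 \<longrightarrow>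
     ((\<lambda>s. z s k) has_real_derivative \<nu> t * rhs (a t) (z t) k) (at t within S))"

lemma error_solution_subset:
  "error_solution S z \<Longrightarrow> T \<subseteq> S \<Longrightarrow> error_solution T z"
  unfolding error_solution_def by (meson DERIV_subset subsetD)

text \<open>The Lyapunov identity multiplied by \<nu> \<ge> \<nu>0. It is stated on compact
  intervals so that it applies to solutions not yet known to be global.\<close>

lemma V_decay:
  assumes z: "error_solution {0..T} z" and T: "T \<ge> 0"
  shows "V_fun n \<gamma> \<delta> w n (a T) (z T) \<le> V_fun n \<gamma> \<delta> w n (a 0) (z 0) * exp (- (2 * \<gamma> * \<nu>0 * T))"
proof -
  define V where "V t = V_fun n \<gamma> \<delta> w n (a t) (z t)" for t
  define c where "c = 2 * \<gamma> * \<nu>0"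
  have V: "(V has_real_derivative \<nu> t * (- 2 * \<gamma> * V t)) (at t within {0..T})"
    if t: "0 \<le> t" "t \<le> T" for t
  proof -
    have "(V has_real_derivative
      (\<Sum>k=1..n+2. partial k (V_fun n \<gamma> \<delta> w n (a t)) (z t) * (\<nu> t * rhs (a t) (z t) k)) +
      (\<Sum>j=1..n. partial j (\<lambda>a. V_fun n \<gamma> \<delta> w n a (z t)) (a t) * (\<nu> t * (w * a t (j + 1)))))
      (at t within {0..T})"
      unfolding V_def
    proof (rule smooth_az_chain[OF smooth_az_V])
      show "((\<lambda>s. z s k) has_real_derivative \<nu> t * rhs (a t) (z t) k) (at t within {0..T})"
        if "1 \<le> k" "k \<le> n + 2" for k
        using z that t unfolding error_solution_def by auto
      show "((\<lambda>s. a s j) has_real_derivative \<nu> t * (w * a t (j + 1))) (at t within {0..T})"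
        if "1 \<le> j" "j \<le> n" for j
        by (rule DERIV_subset[OF a_deriv[OF that t(1)]]) auto
    qed
    also have "(\<Sum>k=1..n+2. partial k (V_fun n \<gamma> \<delta> w n (a t)) (z t) * (\<nu> t * rhs (a t) (z t) k)) +
      (\<Sum>j=1..n. partial j (\<lambda>a. V_fun n \<gamma> \<delta> w n a (z t)) (a t) * (\<nu> t * (w * a t (j + 1)))) =
      \<nu> t * ((\<Sum>k=1..n+2. partial k (V_fun n \<gamma> \<delta> w n (a t)) (z t) * rhs (a t) (z t) k) +
      w * (\<Sum>j=1..n. partial j (\<lambda>a. V_fun n \<gamma> \<delta> w n a (z t)) (a t) * a t (j + 1)))"
      by (simp only: distrib_left sum_distrib_left mult_ac)
    also have "\<dots> = \<nu> t * (- 2 * \<gamma> * V t)"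
      using Lyapunov_derivative[of n "a t" "z t"] by (simp only: rhs_def V_def order_refl)
    finally show ?thesis .
  qed
  have "V T * exp (c * T) \<le> V 0 * exp (c * 0)"
  proof (rule DERIV_nonpos_imp_le_atLeastAtMost[OF T, of "\<lambda>t. V t * exp (c * t)"])
    fix t assume t: "0 \<le> t" "t \<le> T"
    show "((\<lambda>t. V t * exp (c * t)) has_real_derivative (c - \<nu> t * (2 * \<gamma>)) * V t * exp (c * t))
        (at t within {0..T})"
      by (auto intro!: derivative_eq_intros V[OF t] simp: algebra_simps)
    have "c \<le> \<nu> t * (2 * \<gamma>)"
      using \<nu>(1)[OF t(1)] \<gamma> by (simp add: c_def mult.commute mult_left_mono)
    moreover have "V t \<ge> 0"
      unfolding V_def by (rule V_nonneg) simp
    ultimately show "(c - \<nu> t * (2 * \<gamma>)) * V t * exp (c * t) \<le> 0"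
      by (simp add: mult_nonpos_nonneg)
  qed
  then have "V T * exp (c * T) * exp (- (c * T)) \<le> V 0 * exp (- (c * T))"
    by (intro mult_right_mono) auto
  then show ?thesis
    by (simp add: V_def c_def mult.assoc flip: exp_add)
qed

lemma error_bounded:
  obtains R' where "R' \<ge> 0" "\<And>z T k. error_solution {0..T} z \<Longrightarrow> T \<ge> 0 \<Longrightarrow>
    V_fun n \<gamma> \<delta> w n (a 0) (z 0) \<le> C \<Longrightarrow> 1 \<le> k \<Longrightarrow> k \<le> n + 2 \<Longrightarrow> \<bar>z T k\<bar> \<le> R'"
proof -
  obtain R' where R': "R' \<ge> 0" "\<And>a z k. (\<And>j. 2 \<le> j \<Longrightarrow> j \<le> n + 1 \<Longrightarrow> \<bar>a j\<bar> \<le> R) \<Longrightarrow>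
    V_fun n \<gamma> \<delta> w n a z \<le> C \<Longrightarrow> 1 \<le> k \<Longrightarrow> k \<le> n + 2 \<Longrightarrow> \<bar>z k\<bar> \<le> R'"
    by (rule V_sublevel_bounded[of R C]) blast
  show ?thesis
  proof (rule that[OF R'(1)])
    fix z T k
    assume z: "error_solution {0..T} z" "T \<ge> 0" "V_fun n \<gamma> \<delta> w n (a 0) (z 0) \<le> C" "1 \<le> k" "k \<le> n + 2"
    have "V_fun n \<gamma> \<delta> w n (a 0) (z 0) * exp (- (2 * \<gamma> * \<nu>0 * T)) \<le> V_fun n \<gamma> \<delta> w n (a 0) (z 0) * 1"
      using V_nonneg[of n] \<gamma> \<nu>0 z(2) by (intro mult_left_mono) auto
    then have "V_fun n \<gamma> \<delta> w n (a T) (z T) \<le> C"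
      using V_decay[OF z(1,2)] z(3) by linarith
    then show "\<bar>z T k\<bar> \<le> R'"
      using a_bound z by (intro R'(2)[of "a T"]) auto
  qed
qed

text \<open>The vector field is only locally Lipschitz, but decay of V confines both solutions to
  one common box, and there Gronwall's inequality applies.\<close>

lemma error_solution_unique:
  assumes z: "error_solution {0..<T} z" and z': "error_solution {0..<T} z'"
    and init: "\<And>k. 1 \<le> k \<Longrightarrow> k \<le> n + 2 \<Longrightarrow> z 0 k = z' 0 k"
    and t: "0 \<le> t" "t < T" and k: "1 \<le> k" "k \<le> n + 2"
  shows "z t k = z' t k"
proof -
  have V0: "V_fun n \<gamma> \<delta> w n (a 0) (z 0) = V_fun n \<gamma> \<delta> w n (a 0) (z' 0)"
    by (rule smooth_az_local[OF smooth_az_V]) (use init in auto)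
  obtain R' where R': "R' \<ge> 0" "\<And>z T k. error_solution {0..T} z \<Longrightarrow> T \<ge> 0 \<Longrightarrow>
    V_fun n \<gamma> \<delta> w n (a 0) (z 0) \<le> V_fun n \<gamma> \<delta> w n (a 0) (z' 0) \<Longrightarrow> 1 \<le> k \<Longrightarrow> k \<le> n + 2 \<Longrightarrow> \<bar>z T k\<bar> \<le> R'"
    by (rule error_bounded[of "V_fun n \<gamma> \<delta> w n (a 0) (z' 0)"]) blast
  have b: "\<bar>z s j\<bar> \<le> max R R'" "\<bar>z' s j\<bar> \<le> max R R'" if "0 \<le> s" "s \<le> t" "1 \<le> j" "j \<le> n + 2" for s j
  proof -
    have "\<bar>z s j\<bar> \<le> R'" "\<bar>z' s j\<bar> \<le> R'"
      using t that V0
      by (auto intro!: R'(2)[where z = z and T = s and k = j] R'(2)[where z = z' and T = s and k = j] error_solution_subset[OF z] error_solution_subset[OF z'])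
    then show "\<bar>z s j\<bar> \<le> max R R'" "\<bar>z' s j\<bar> \<le> max R R'" by auto
  qed
  obtain L where L: "L \<ge> 0" "\<And>a z z' k. 1 \<le> k \<Longrightarrow> k \<le> n + 2 \<Longrightarrow>
    (\<And>j. 2 \<le> j \<Longrightarrow> j \<le> n + 1 \<Longrightarrow> \<bar>a j\<bar> \<le> max R R') \<Longrightarrow>
    (\<And>j. 1 \<le> j \<Longrightarrow> j \<le> n + 2 \<Longrightarrow> \<bar>z j\<bar> \<le> max R R') \<Longrightarrow> (\<And>j. 1 \<le> j \<Longrightarrow> j \<le> n + 2 \<Longrightarrow> \<bar>z' j\<bar> \<le> max R R') \<Longrightarrow>
    \<bar>rhs a z k - rhs a z' k\<bar> \<le> L * (\<Sum>j=1..n+2. \<bar>z j - z' j\<bar>)"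
    by (rule rhs_Lipschitz[of "max R R'"]) blast
  have "\<nu>1 \<ge> 0"
    using \<nu>[of 0] \<nu>0 by simp
  have sub: "{0..t} \<subseteq> {0..<T}"
    using t by auto
  have "z t k - z' t k = 0"
  proof (rule differential_inequality_unique[where I = "{1..n+2}" and d = "\<lambda>k t. z t k - z' t k" and L = "\<nu>1 * L"])
    fix j s assume j: "j \<in> {1..n+2}" and s: "0 \<le> s" "s \<le> t"
    show "((\<lambda>s. z s j - z' s j) has_real_derivative
      \<nu> s * (rhs (a s) (z s) j - rhs (a s) (z' s) j)) (at s within {0..t})"
      unfolding right_diff_distrib
      using error_solution_subset[OF z sub] error_solution_subset[OF z' sub] j s
      by (intro DERIV_diff) (auto simp: error_solution_def)
    have "\<bar>\<nu> s * (rhs (a s) (z s) j - rhs (a s) (z' s) j)\<bar> \<le> \<nu>1 * (L * (\<Sum>k\<in>{1..n+2}. \<bar>z s k - z' s k\<bar>))"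
      unfolding abs_mult
    proof (intro mult_mono)
      show "\<bar>\<nu> s\<bar> \<le> \<nu>1"
        using \<nu>[OF s(1)] \<nu>0 by simp
      show "\<bar>rhs (a s) (z s) j - rhs (a s) (z' s) j\<bar> \<le> L * (\<Sum>k\<in>{1..n+2}. \<bar>z s k - z' s k\<bar>)"
        using j b[OF s] a_bound[OF _ _ s(1)] by (intro L(2)) (auto simp: le_max_iff_disj)
    qed (use \<open>\<nu>1 \<ge> 0\<close> in auto)
    then show "\<bar>\<nu> s * (rhs (a s) (z s) j - rhs (a s) (z' s) j)\<bar> \<le> \<nu>1 * L * (\<Sum>k\<in>{1..n+2}. \<bar>z s k - z' s k\<bar>)"
      by (simp only: mult.assoc)
  qed (use k t init L(1) \<open>\<nu>1 \<ge> 0\<close> in auto)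
  then show ?thesis by simp
qed

text \<open>Global existence: clamp the state outside a box that the Lyapunov function keeps the solution
  from leaving, and solve the resulting globally Lipschitz equation.\<close>

lemma error_solution_exists:
  obtains z where "error_solution {0..} z" "\<And>k. 1 \<le> k \<Longrightarrow> k \<le> n + 2 \<Longrightarrow> z 0 k = z0 k"
proof -
  obtain R' where R': "R' \<ge> 0" "\<And>z T k. error_solution {0..T} z \<Longrightarrow> T \<ge> 0 \<Longrightarrow>
    V_fun n \<gamma> \<delta> w n (a 0) (z 0) \<le> V_fun n \<gamma> \<delta> w n (a 0) z0 \<Longrightarrow> 1 \<le> k \<Longrightarrow> k \<le> n + 2 \<Longrightarrow> \<bar>z T k\<bar> \<le> R'"
    by (rule error_bounded[of "V_fun n \<gamma> \<delta> w n (a 0) z0"]) blast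
  \<comment> \<open>Strictly larger than the a priori bound R', so that a true solution cannot reach
    the boundary of the box.\<close>
  define c where "c = R' + 1"
  have c: "c > 0" using R'(1) by (simp add: c_def)
  define clamp where "clamp z = (\<lambda>k::nat. max (- c) (min c (z k)))" for z :: "nat \<Rightarrow> real"
  have clamp_bound: "\<bar>clamp z k\<bar> \<le> c" for z k
    using c by (auto simp: clamp_def)
  have clamp_id: "clamp z k = z k" if "\<bar>z k\<bar> \<le> c" for z k
    using that by (auto simp: clamp_def)
  have clamp_Lip: "\<bar>clamp z k - clamp z' k\<bar> \<le> \<bar>z k - z' k\<bar>" for z z' k
    by (auto simp: clamp_def max_def min_def)
  obtain L where L: "L \<ge> 0" "\<And>a z z' k. 1 \<le> k \<Longrightarrow> k \<le> n + 2 \<Longrightarrow>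
    (\<And>j. 2 \<le> j \<Longrightarrow> j \<le> n + 1 \<Longrightarrow> \<bar>a j\<bar> \<le> max R c) \<Longrightarrow>
    (\<And>j. 1 \<le> j \<Longrightarrow> j \<le> n + 2 \<Longrightarrow> \<bar>z j\<bar> \<le> max R c) \<Longrightarrow> (\<And>j. 1 \<le> j \<Longrightarrow> j \<le> n + 2 \<Longrightarrow> \<bar>z' j\<bar> \<le> max R c) \<Longrightarrow>
    \<bar>rhs a z k - rhs a z' k\<bar> \<le> L * (\<Sum>j=1..n+2. \<bar>z j - z' j\<bar>)"
    by (rule rhs_Lipschitz[of "max R c"]) blast
  have \<nu>1: "\<nu>1 \<ge> 0" and \<nu>_abs: "t \<ge> 0 \<Longrightarrow> \<bar>\<nu> t\<bar> \<le> \<nu>1" for t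
    using \<nu>[of 0] \<nu>[of t] \<nu>0 by auto
  have rhs_clamp: "\<bar>rhs (a t) (clamp x) k - rhs (a t) y k\<bar> \<le> L * (\<Sum>j=1..n+2. \<bar>clamp x j - y j\<bar>)"
    if "1 \<le> k" "k \<le> n + 2" "t \<ge> 0" "\<And>j. \<bar>y j\<bar> \<le> c" for t x y k
    using that clamp_bound a_bound by (intro L(2)) (auto simp: le_max_iff_disj)
  define g where "g k t z = \<nu> t * rhs (a t) (clamp z) k" for k t z
  obtain x where x: "\<And>k. k \<in> {1..n+2} \<Longrightarrow> x k 0 = z0 k"
    "\<And>k t. k \<in> {1..n+2} \<Longrightarrow> t \<ge> 0 \<Longrightarrow> (x k has_real_derivative g k t (\<lambda>j. x j t)) (at t within {0..})"
  proof (rule ode_global_solution[where g = g and N = "n + 2" and ini = z0 and M = "\<nu>1 * (L * (\<Sum>j=1..n+2. c))" and L = "\<nu>1 * L"])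
    fix k assume k: "k \<in> {1..n+2}"
    {
      fix x :: "nat \<Rightarrow> real \<Rightarrow> real" assume "\<And>j. continuous_on {0..} (x j)"
      then have "continuous_on {0..} (\<lambda>t. rhs (a t) (clamp (\<lambda>j. x j t)) k)"
        unfolding clamp_def using k
        by (intro smooth_az_continuous_on[OF smooth_az_rhs] a_cont continuous_intros) auto
      then show "continuous_on {0..} (\<lambda>t. g k t (\<lambda>j. x j t))"
        unfolding g_def by (intro continuous_on_mult \<nu>_cont)
    next
      fix t x assume t: "(t::real) \<ge> 0"
      have "\<bar>rhs (a t) (clamp x) k - rhs (a t) (\<lambda>_. 0) k\<bar> \<le> L * (\<Sum>j=1..n+2. \<bar>clamp x j - 0\<bar>)"
        using k t c by (intro rhs_clamp) auto
      also have "\<dots> \<le> L * (\<Sum>j=1..n+2. c)"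
        using clamp_bound L(1) by (intro mult_left_mono sum_mono) auto
      finally have "\<bar>rhs (a t) (clamp x) k\<bar> \<le> L * (\<Sum>j=1..n+2. c)"
        by (simp add: rhs_zero)
      then show "\<bar>g k t x\<bar> \<le> \<nu>1 * (L * (\<Sum>j=1..n+2. c))"
        unfolding g_def abs_mult by (intro mult_mono \<nu>_abs[OF t] \<nu>1) auto
    next
      fix t x y assume t: "(t::real) \<ge> 0"
      have "\<bar>rhs (a t) (clamp x) k - rhs (a t) (clamp y) k\<bar> \<le> L * (\<Sum>j=1..n+2. \<bar>clamp x j - clamp y j\<bar>)"
        using k t clamp_bound by (intro rhs_clamp) auto
      also have "\<dots> \<le> L * (\<Sum>j=1..n+2. \<bar>x j - y j\<bar>)"
        using clamp_Lip L(1) by (intro mult_left_mono sum_mono) auto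
      finally have "\<bar>\<nu> t\<bar> * \<bar>rhs (a t) (clamp x) k - rhs (a t) (clamp y) k\<bar> \<le> \<nu>1 * (L * (\<Sum>j=1..n+2. \<bar>x j - y j\<bar>))"
        by (intro mult_mono \<nu>_abs[OF t] \<nu>1) auto
      then show "\<bar>g k t x - g k t y\<bar> \<le> \<nu>1 * L * (\<Sum>j=1..n+2. \<bar>x j - y j\<bar>)"
        unfolding g_def by (simp only: abs_mult mult.assoc flip: right_diff_distrib)
    }
  qed (use \<nu>1 L(1) c in \<open>auto intro!: mult_nonneg_nonneg sum_nonneg\<close>)
  define z where "z t = (\<lambda>k. x k t)" for t
  have x_cont: "continuous_on {0..} (x k)" if "k \<in> {1..n+2}" for k
    using x(2)[OF that] by (intro DERIV_continuous_on) auto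
  have true_solution: "error_solution {0..T} z"
    if "\<And>t k. 0 \<le> t \<Longrightarrow> t \<le> T \<Longrightarrow> k \<in> {1..n+2} \<Longrightarrow> \<bar>x k t\<bar> \<le> c" for T
    unfolding error_solution_def
  proof (intro ballI allI impI)
    fix t k assume t: "t \<in> {0..T}" and k: "1 \<le> k" "k \<le> n + 2"
    have "rhs (a t) (clamp (z t)) k = rhs (a t) (z t) k"
      by (rule smooth_az_local[OF smooth_az_rhs[OF k]]) (use that t in \<open>auto simp: z_def intro!: clamp_id\<close>)
    then show "((\<lambda>s. z s k) has_real_derivative \<nu> t * rhs (a t) (z t) k) (at t within {0..T})"
      using DERIV_subset[OF x(2)[of k t], of "{0..T}"] t k by (auto simp: z_def g_def)
  qed
  have V0: "V_fun n \<gamma> \<delta> w n (a 0) (z 0) = V_fun n \<gamma> \<delta> w n (a 0) z0"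
    by (rule smooth_az_local[OF smooth_az_V]) (use x(1) in \<open>auto simp: z_def\<close>)
  have inside: "\<bar>x k t\<bar> < c" if "t \<ge> 0" "k \<in> {1..n+2}" for t k
  proof (rule ccontr)
    assume "\<not> \<bar>x k t\<bar> < c"
    \<comment> \<open>The times at which some coordinate reaches the boundary of the box. The set is
      closed, so its infimum is a first such time.\<close>
    define P where "P = (\<Union>k\<in>{1..n+2}. {t\<in>{0..}. c \<le> \<bar>x k t\<bar>})"
    have ne: "P \<noteq> {}"
      using \<open>\<not> \<bar>x k t\<bar> < c\<close> that by (auto simp: P_def not_less)
    have "closed P"
      unfolding P_def
      by (intro closed_UN closed_Collect_le[THEN closed_Int[OF closed_atLeast], unfolded Int_def] ballI
         continuous_on_closed_Collect_le continuous_on_rabs x_cont continuous_on_const closed_atLeast) auto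
    moreover have bdd: "bdd_below P"
      by (rule bdd_belowI[of _ 0]) (auto simp: P_def)
    ultimately have InfP: "Inf P \<in> P"
      using ne by (intro closed_contains_Inf)
    define T where "T = Inf P"
    obtain k where k: "k \<in> {1..n+2}" "c \<le> \<bar>x k T\<bar>" and T: "T \<ge> 0"
      using InfP by (auto simp: P_def T_def)
    have before: "\<bar>x j s\<bar> < c" if "0 \<le> s" "s < T" "j \<in> {1..n+2}" for j s
    proof -
      have "s \<notin> P"
        using cInf_lower[OF _ bdd, of s] that by (auto simp: T_def)
      then show ?thesis
        using that by (auto simp: P_def not_le)
    qed
    have upto: "\<bar>x j s\<bar> \<le> c" if "0 \<le> s" "s \<le> T" "j \<in> {1..n+2}" for j s
    proof (cases "T = 0")
      case True
      \<comment> \<open>Within a single point every number is a derivative, so z is trivially a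
        solution there, and the a priori bound applies to the initial value.\<close>
      have "error_solution {0..0} z"
        unfolding error_solution_def by (auto simp: has_field_derivative_def has_derivative_within_singleton_iff bounded_linear_mult_right)
      from R'(2)[OF this, of j] have "\<bar>x j 0\<bar> \<le> R'"
        using that V0 by (simp add: z_def)
      then show ?thesis
        using that True by (simp add: c_def)
    next
      case False
      then have cl: "closure {0..<T} = {0..T}"
        using T by simp
      show ?thesis
      proof (rule continuous_le_on_closure[of "{0..<T}" "\<lambda>s. \<bar>x j s\<bar>"])
        show "continuous_on (closure {0..<T}) (\<lambda>s. \<bar>x j s\<bar>)"
          unfolding cl using continuous_on_subset[OF x_cont[OF that(3)], of "{0..T}"]
          by (intro continuous_on_rabs) auto
      qed (use before that cl in \<open>auto intro: less_imp_le\<close>)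
    qed
    \<comment> \<open>Up to time T clamping changes nothing, so z is a true solution there and obeys
      the Lyapunov bound R' < c.\<close>
    have "\<bar>x k T\<bar> \<le> R'"
      using R'(2)[OF true_solution[OF upto] T, of k] k V0 by (simp add: z_def)
    then show False
      using k(2) by (simp add: c_def)
  qed
  show ?thesis
  proof (rule that[of z])
    show "error_solution {0..} z"
      unfolding error_solution_def
    proof (intro ballI allI impI)
      fix t k assume t: "t \<in> {0::real..}" and k: "1 \<le> k" "k \<le> n + 2"
      have "error_solution {0..t+1} z"
        using inside by (intro true_solution less_imp_le) auto
      then show "((\<lambda>s. z s k) has_real_derivative \<nu> t * rhs (a t) (z t) k) (at t within {0..})"
        using t k by (intro DERIV_within_atLeast) (auto simp: error_solution_def)
    qed
  qed (use x(1) in \<open>auto simp: z_def\<close>)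
qed

section \<open>Convergence of the error\<close>

context
  fixes z
  assumes z: "error_solution {0..} z"
begin

lemma V_tendsto_0: "((\<lambda>t. V_fun n \<gamma> \<delta> w n (a t) (z t)) \<longlongrightarrow> 0) at_top"
proof (rule tendsto_sandwich[of "\<lambda>_. 0"])
  have "V_fun n \<gamma> \<delta> w n (a t) (z t) \<le> V_fun n \<gamma> \<delta> w n (a 0) (z 0) * exp (- (2 * \<gamma> * \<nu>0 * t))" if "t \<ge> 0" for t
    by (rule V_decay[OF error_solution_subset[OF z] that]) auto
  then show "\<forall>\<^sub>F t in at_top. V_fun n \<gamma> \<delta> w n (a t) (z t) \<le>
      V_fun n \<gamma> \<delta> w n (a 0) (z 0) * exp (- (2 * \<gamma> * \<nu>0 * t))"
    using eventually_ge_at_top[of 0] by (rule eventually_mono[rotated])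
  have "filterlim (\<lambda>t. - (2 * \<gamma> * \<nu>0 * t)) at_bot at_top"
    unfolding filterlim_uminus_at_bot minus_minus
    using \<gamma> \<nu>0 by (intro filterlim_tendsto_pos_mult_at_top[OF tendsto_const _ filterlim_ident]) auto
  then have "((\<lambda>t. exp (- (2 * \<gamma> * \<nu>0 * t))) \<longlongrightarrow> 0) at_top"
    using exp_at_bot filterlim_compose by blast
  then show "((\<lambda>t. V_fun n \<gamma> \<delta> w n (a 0) (z 0) * exp (- (2 * \<gamma> * \<nu>0 * t))) \<longlongrightarrow> 0) at_top"
    by (rule tendsto_mult_right_zero)
qed (use V_nonneg in \<open>auto\<close>)

lemma alpha_tendsto_0:
  assumes i: "i \<le> n" and zk: "\<And>k. 1 \<le> k \<Longrightarrow> k \<le> i + 2 \<Longrightarrow> ((\<lambda>t. z t k) \<longlongrightarrow> 0) at_top"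
  shows "((\<lambda>t. alpha n \<gamma> \<delta> w i (a t) (z t)) \<longlongrightarrow> 0) at_top"
proof -
  obtain R' where R': "R' \<ge> 0" "\<And>z' T k. error_solution {0..T} z' \<Longrightarrow> T \<ge> 0 \<Longrightarrow>
    V_fun n \<gamma> \<delta> w n (a 0) (z' 0) \<le> V_fun n \<gamma> \<delta> w n (a 0) (z 0) \<Longrightarrow> 1 \<le> k \<Longrightarrow> k \<le> n + 2 \<Longrightarrow> \<bar>z' T k\<bar> \<le> R'"
    by (rule error_bounded[of "V_fun n \<gamma> \<delta> w n (a 0) (z 0)"]) blast
  obtain L where L: "L \<ge> 0" "\<And>a z. (\<And>j. 2 \<le> j \<Longrightarrow> j \<le> n + 1 \<Longrightarrow> \<bar>a j\<bar> \<le> max R R') \<Longrightarrow>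
    (\<And>j. 1 \<le> j \<Longrightarrow> j \<le> i + 2 \<Longrightarrow> \<bar>z j\<bar> \<le> max R R') \<Longrightarrow>
    \<bar>alpha n \<gamma> \<delta> w i a z\<bar> \<le> L * (\<Sum>j=1..i+2. \<bar>z j\<bar>)"
    by (rule alpha_bound[OF i, of "max R R'"]) blast
  have "\<bar>alpha n \<gamma> \<delta> w i (a t) (z t)\<bar> \<le> L * (\<Sum>j=1..i+2. \<bar>z t j\<bar>)" if "t \<ge> 0" for t
  proof -
    have "\<bar>z t j\<bar> \<le> R'" if "1 \<le> j" "j \<le> i + 2" for j
      using that i \<open>t \<ge> 0\<close> by (intro R'(2) error_solution_subset[OF z]) auto
    then show ?thesis
      using a_bound that by (intro L(2)) (auto simp: le_max_iff_disj)
  qed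
  then have "\<forall>\<^sub>F t in at_top. norm (alpha n \<gamma> \<delta> w i (a t) (z t)) \<le> L * (\<Sum>j=1..i+2. \<bar>z t j\<bar>)"
    unfolding real_norm_def by (rule eventually_mono[OF eventually_ge_at_top[of 0]])
  moreover have "((\<lambda>t. L * (\<Sum>j=1..i+2. \<bar>z t j\<bar>)) \<longlongrightarrow> 0) at_top"
    using zk by (intro tendsto_mult_right_zero tendsto_null_sum tendsto_rabs_zero) auto
  ultimately show ?thesis
    by (rule Lim_null_comparison)
qed

lemma error_tendsto_0:
  assumes "1 \<le> k" "k \<le> n + 2"
  shows "((\<lambda>t. z t k) \<longlongrightarrow> 0) at_top"
proof -
  have "\<forall>k. 1 \<le> k \<longrightarrow> k \<le> i + 2 \<longrightarrow> ((\<lambda>t. z t k) \<longlongrightarrow> 0) at_top" if "i \<le> n" for i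
    using that
  proof (induction i)
    case 0
    show ?case
    proof (intro allI impI)
      fix k :: nat assume k: "1 \<le> k" "k \<le> 0 + 2"
      have "norm (z t k) \<le> sqrt (V_fun n \<gamma> \<delta> w n (a t) (z t)) / \<gamma>" for t
      proof -
        have "k = 1 \<or> k = 2" using k by auto
        then have "(z t k)\<^sup>2 \<le> sqnorm (z t)"
          by (auto simp: sqnorm_def)
        then have "\<gamma>\<^sup>2 * (z t k)\<^sup>2 \<le> \<gamma>\<^sup>2 * sqnorm (z t)"
          by (simp add: mult_left_mono)
        then have "\<bar>\<gamma> * z t k\<bar>\<^sup>2 \<le> V_fun n \<gamma> \<delta> w n (a t) (z t)"
          using V_ge_sqnorm[of "z t" "a t"] by (simp add: power_mult_distrib)
        then have "\<bar>\<gamma> * z t k\<bar> \<le> sqrt (V_fun n \<gamma> \<delta> w n (a t) (z t))"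
          by (rule real_le_rsqrt)
        then show ?thesis
          using \<gamma> by (simp add: abs_mult field_simps)
      qed
      moreover have "((\<lambda>t. sqrt (V_fun n \<gamma> \<delta> w n (a t) (z t)) / \<gamma>) \<longlongrightarrow> 0) at_top"
        using tendsto_divide[OF tendsto_real_sqrt[OF V_tendsto_0] tendsto_const[of \<gamma>]] \<gamma> by simp
      ultimately show "((\<lambda>t. z t k) \<longlongrightarrow> 0) at_top"
        by (intro Lim_null_comparison[of "\<lambda>t. z t k"] always_eventually allI)
    qed
  next
    case (Suc i)
    define d where "d = \<delta> (Suc i)"
    have d: "d > 0" using \<delta> Suc.prems by (simp add: d_def)
    have "norm (z t (i + 3) - alpha n \<gamma> \<delta> w i (a t) (z t)) \<le> sqrt (2 / d * V_fun n \<gamma> \<delta> w n (a t) (z t))" for t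
    proof -
      have "1/2 * d * (z t (i + 3) - alpha n \<gamma> \<delta> w i (a t) (z t))\<^sup>2 \<le> V_fun n \<gamma> \<delta> w n (a t) (z t)"
        using V_ge_error[of i "z t" "a t"] Suc.prems by (simp add: d_def)
      then have "\<bar>z t (i + 3) - alpha n \<gamma> \<delta> w i (a t) (z t)\<bar>\<^sup>2 \<le> 2 / d * V_fun n \<gamma> \<delta> w n (a t) (z t)"
        using d by (simp add: field_simps)
      then show ?thesis
        unfolding real_norm_def by (rule real_le_rsqrt)
    qed
    moreover have "((\<lambda>t. sqrt (2 / d * V_fun n \<gamma> \<delta> w n (a t) (z t))) \<longlongrightarrow> 0) at_top"
      using tendsto_real_sqrt[OF tendsto_mult_right_zero[OF V_tendsto_0, of "2 / d"]]
      by (simp only: real_sqrt_zero)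
    ultimately have "((\<lambda>t. z t (i + 3) - alpha n \<gamma> \<delta> w i (a t) (z t)) \<longlongrightarrow> 0) at_top"
      by (intro Lim_null_comparison[of "\<lambda>t. z t (i + 3) - alpha n \<gamma> \<delta> w i (a t) (z t)"] always_eventually allI)
    moreover have "((\<lambda>t. alpha n \<gamma> \<delta> w i (a t) (z t)) \<longlongrightarrow> 0) at_top"
      using Suc by (intro alpha_tendsto_0) auto
    ultimately have "((\<lambda>t. z t (i + 3) - alpha n \<gamma> \<delta> w i (a t) (z t) + alpha n \<gamma> \<delta> w i (a t) (z t)) \<longlongrightarrow> 0 + 0) at_top"
      by (rule tendsto_add)
    then have last: "((\<lambda>t. z t (i + 3)) \<longlongrightarrow> 0) at_top"
      by simp
    show ?case
    proof (intro allI impI)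
      fix k assume k: "1 \<le> k" "k \<le> Suc i + 2"
      then show "((\<lambda>t. z t k) \<longlongrightarrow> 0) at_top"
        using last Suc by (cases "k = i + 3") auto
    qed
  qed
  from this[of n] show ?thesis
    using assms by auto
qed

text \<open>The distance of c from w times the unit vector is |tanh(\<gamma>|\<xi>|)|, whatever the
  heading is. The reverse triangle inequality passes this bound to \<open>lam\<close> minus
  w.\<close>

lemma lam_tendsto: "((\<lambda>t. lam \<gamma> w (a t) (z t)) \<longlongrightarrow> w) at_top"
proof -
  have "norm (lam \<gamma> w (a t) (z t) - w) \<le> \<bar>tanh (\<gamma> * norm (xi_of (z t)))\<bar>" for t
  proof -
    define r where "r = sqrt (sqnorm (z t))"
    have r: "r \<ge> 0" "r\<^sup>2 = sqnorm (z t)"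
      by (simp_all add: r_def sqnorm_nonneg)
    define v where "v = c_vec \<gamma> w (a t) (z t) - w *\<^sub>R vector [1, 0]"
    have e: "norm (w *\<^sub>R vector [1, 0] :: real^2) = 1"
      using w by (auto simp: norm_vec2)
    have v: "v $ 1 = - kappa \<gamma> (sqnorm (z t)) * (cos (a t 1) * z t 1 + sin (a t 1) * z t 2)"
      "v $ 2 = - kappa \<gamma> (sqnorm (z t)) * (- sin (a t 1) * z t 1 + cos (a t 1) * z t 2)"
      by (simp_all add: v_def c_vec_components)
    have "(v $ 1)\<^sup>2 + (v $ 2)\<^sup>2 = (kappa \<gamma> (sqnorm (z t)))\<^sup>2 *
        (((cos (a t 1))\<^sup>2 + (sin (a t 1))\<^sup>2) * sqnorm (z t))"
      unfolding v sqnorm_def by algebra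
    also have "\<dots> = (r * kappa \<gamma> (r\<^sup>2))\<^sup>2"
      using sin_cos_squared_add2[of "a t 1"] by (simp add: r(2) power_mult_distrib)
    finally have "norm v = \<bar>tanh (\<gamma> * r)\<bar>"
      by (simp add: norm_vec2 kappa_eq)
    then have "norm v = \<bar>tanh (\<gamma> * norm (xi_of (z t)))\<bar>"
      by (simp add: norm_xi_of r_def)
    moreover have "\<bar>norm (c_vec \<gamma> w (a t) (z t)) - 1\<bar> \<le> norm v"
      using norm_triangle_ineq3[of "c_vec \<gamma> w (a t) (z t)" "w *\<^sub>R vector [1, 0]"] e by (simp add: v_def)
    moreover have "\<bar>lam \<gamma> w (a t) (z t) - w\<bar> = \<bar>norm (c_vec \<gamma> w (a t) (z t)) - 1\<bar>"
      using w by (auto simp: lam_def)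
    ultimately show ?thesis by simp
  qed
  moreover have "((\<lambda>t. \<bar>tanh (\<gamma> * norm (xi_of (z t)))\<bar>) \<longlongrightarrow> 0) at_top"
  proof -
    have "((\<lambda>t. sqnorm (z t)) \<longlongrightarrow> 0) at_top"
      unfolding sqnorm_def using tendsto_add[OF tendsto_power[OF error_tendsto_0[of 1], of 2] tendsto_power[OF error_tendsto_0[of 2], of 2]]
      by simp
    from tendsto_real_sqrt[OF this] have "((\<lambda>t. \<gamma> * norm (xi_of (z t))) \<longlongrightarrow> 0) at_top"
      unfolding norm_xi_of by (intro tendsto_mult_right_zero) simp
    from tendsto_tanh[OF this] show ?thesis
      using tendsto_rabs_zero by fastforce
  qed
  ultimately have "((\<lambda>t. lam \<gamma> w (a t) (z t) - w) \<longlongrightarrow> 0) at_top"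
    by (intro Lim_null_comparison[of "\<lambda>t. lam \<gamma> w (a t) (z t) - w"] always_eventually allI)
  then show ?thesis
    by (simp add: LIM_zero_iff)
qed

end

end

section \<open>Reference trajectories\<close>

text \<open>This makes one-sided derivatives on the half-line unique, at 0 too.\<close>

lemma at_within_atLeast_neq_bot:
  assumes "t \<ge> 0"
  shows "at t within {0::real..} \<noteq> bot"
proof -
  have "t islimpt {t<..<t+1}"
    by (rule islimpt_greaterThanLessThan1) simp
  then have "t islimpt {0..}"
    using assms by (elim islimpt_subset) auto
  then show ?thesis
    by (simp add: trivial_limit_within)
qed

lemma tderiv_eqI:
  assumes "(f has_vector_derivative D) (at t within {0..})" "t \<ge> 0"
  shows "tderiv f t = D"
  unfolding tderiv_def
  using at_within_atLeast_neq_bot[OF assms(2)] assms(1) by (rule vector_derivative_within)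

lemma abs_sin_diff_le: "\<bar>sin x - sin y\<bar> \<le> \<bar>x - y\<bar>"
  and abs_cos_diff_le: "\<bar>cos x - cos y\<bar> \<le> \<bar>x - y\<bar>" for x y :: real
proof -
  have "\<bar>2 * sin ((x - y) / 2) * c\<bar> \<le> \<bar>x - y\<bar>" if "\<bar>c\<bar> \<le> 1" for c :: real
  proof -
    have "\<bar>sin ((x - y) / 2)\<bar> * \<bar>c\<bar> \<le> \<bar>(x - y) / 2\<bar> * 1"
      using that by (intro mult_mono abs_sin_x_le_abs_x) auto
    then show ?thesis by (simp add: abs_mult)
  qed
  from this[of "cos ((x + y) / 2)"] this[of "sin ((x + y) / 2)"]
  have "\<bar>2 * sin ((x - y) / 2) * cos ((x + y) / 2)\<bar> \<le> \<bar>x - y\<bar>"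
    "\<bar>2 * sin ((x - y) / 2) * sin ((x + y) / 2)\<bar> \<le> \<bar>x - y\<bar>" by auto
  moreover have "sin ((y - x) / 2) = - sin ((x - y) / 2)"
    by (metis minus_diff_eq minus_divide_left sin_minus)
  ultimately show "\<bar>sin x - sin y\<bar> \<le> \<bar>x - y\<bar>" "\<bar>cos x - cos y\<bar> \<le> \<bar>x - y\<bar>"
    by (auto simp: sin_diff_sin cos_diff_cos abs_mult mult_ac)
qed

locale reference =
  fixes n :: nat and \<epsilon> :: real and xD :: "real \<Rightarrow> real^2"
  assumes n: "n \<ge> 1" and \<epsilon>: "\<epsilon> = 1 \<or> \<epsilon> = -1" and adm: "strongly_admissible n xD"
begin

definition X :: "nat \<Rightarrow> real \<Rightarrow> real^2" where "X k = (tderiv ^^ k) xD"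

definition v :: "real \<Rightarrow> real" where "v = v1_ref \<epsilon> xD"

lemma X_vector_derivative:
  assumes "k \<le> n" "t \<ge> 0"
  shows "(X k has_vector_derivative X (Suc k) t) (at t within {0..})"
proof -
  have "X k differentiable (at t within {0..})"
    using adm assms unfolding strongly_admissible_def X_def by blast
  then obtain D where "(X k has_vector_derivative D) (at t within {0..})"
    using vector_derivative_works by blast
  moreover from tderiv_eqI[OF this assms(2)] have "D = X (Suc k) t"
    by (simp add: X_def)
  ultimately show ?thesis by simp
qed

lemma X_deriv:
  assumes "k \<le> n" "t \<ge> 0"
  shows "((\<lambda>t. X k t $ c) has_real_derivative X (Suc k) t $ c) (at t within {0..})"
proof -
  have "((\<lambda>t. X k t $ c) has_vector_derivative X (Suc k) t $ c) (at t within {0..})"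
    by (rule bounded_linear.has_vector_derivative[OF bounded_linear_vec_nth X_vector_derivative[OF assms]])
  then show ?thesis
    by (simp add: has_real_derivative_iff_has_vector_derivative)
qed

lemma X_cont: "k \<le> n + 1 \<Longrightarrow> continuous_on {0..} (\<lambda>t. X k t $ c)"
proof (cases "k = n + 1")
  case True
  then have "continuous_on {0..} (X k)"
    using adm unfolding strongly_admissible_def X_def by auto
  then show ?thesis by (intro continuous_intros)
next
  case False
  assume "k \<le> n + 1"
  with False show ?thesis
    using X_deriv[of k _ c] by (intro DERIV_continuous_on) auto
qed

lemma X_bounded:
  assumes "1 \<le> k" "k \<le> n + 1"
  obtains B where "\<And>t. t \<ge> 0 \<Longrightarrow> norm (X k t) \<le> B"
proof -
  have "bounded (X k ` {0..})"
    using adm assms unfolding strongly_admissible_def X_def by auto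
  then show ?thesis
    using that unfolding bounded_iff by auto
qed

lemma speed_bound: obtains c where "c > 0" "\<And>t. t \<ge> 0 \<Longrightarrow> c \<le> norm (X 1 t)"
proof (rule that[of "INF t\<in>{0..}. norm (X 1 t)"])
  show "0 < (INF t\<in>{0..}. norm (X 1 t))"
    using adm unfolding strongly_admissible_def X_def by simp
  show "(INF t\<in>{0..}. norm (X 1 t)) \<le> norm (X 1 t)" if "t \<ge> 0" for t
    using that by (intro cINF_lower bdd_belowI[of _ 0]) auto
qed

lemma X_1_nonzero: "t \<ge> 0 \<Longrightarrow> norm (X 1 t) > 0"
  using speed_bound by (metis less_le_trans)

lemma v_eq: "v t = \<epsilon> * norm (X 1 t)"
  by (simp add: v_def v1_ref_def X_def)

lemma v_abs: "\<bar>v t\<bar> = norm (X 1 t)"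
  using \<epsilon> by (auto simp: v_eq)

lemma v_eq_abs: "v t = \<epsilon> * \<bar>v t\<bar>" "\<bar>v t\<bar> = \<epsilon> * v t"
  using \<epsilon> by (auto simp: v_eq)

lemma v_nonzero: "t \<ge> 0 \<Longrightarrow> v t \<noteq> 0"
  using X_1_nonzero[of t] v_abs[of t] by auto

lemma v_square: "(v t)\<^sup>2 = (X 1 t $ 1)\<^sup>2 + (X 1 t $ 2)\<^sup>2"
  using \<epsilon> by (auto simp: v_eq norm_vec2)

lemma v_deriv:
  assumes t: "t \<ge> 0"
  shows "(v has_real_derivative (X 1 t $ 1 * X 2 t $ 1 + X 1 t $ 2 * X 2 t $ 2) / v t) (at t within {0..})"
proof -
  define x y x' y' where "x = (\<lambda>t. X 1 t $ 1)" and "y = (\<lambda>t. X 1 t $ 2)"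
    and "x' = X 2 t $ 1" and "y' = X 2 t $ 2"
  have sq: "(x t)\<^sup>2 + (y t)\<^sup>2 > 0"
    using X_1_nonzero[OF t] by (simp add: norm_vec2 x_def y_def)
  have v: "v = (\<lambda>t. \<epsilon> * sqrt ((x t)\<^sup>2 + (y t)\<^sup>2))"
    by (rule ext) (simp add: v_eq norm_vec2 x_def y_def)
  have "(x has_real_derivative x') (at t within {0..})" "(y has_real_derivative y') (at t within {0..})"
    using X_deriv[of 1 t 1] X_deriv[of 1 t 2] n t
    by (simp_all add: numeral_2_eq_2 x_def y_def x'_def y'_def)
  then have "((\<lambda>t. \<epsilon> * sqrt ((x t)\<^sup>2 + (y t)\<^sup>2)) has_real_derivative
    \<epsilon> * ((2 * x t * x' + 2 * y t * y') * (inverse (sqrt ((x t)\<^sup>2 + (y t)\<^sup>2)) / 2))) (at t within {0..})"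
    using sq by (auto intro!: derivative_eq_intros)
  moreover have "\<epsilon> * ((2 * x t * x' + 2 * y t * y') * (inverse (sqrt ((x t)\<^sup>2 + (y t)\<^sup>2)) / 2)) =
      (x t * x' + y t * y') / v t"
  proof -
    have "2 * x t * x' + 2 * y t * y' = 2 * (x t * x' + y t * y')"
      by simp
    moreover have "\<epsilon> * ((2 * A) * (inverse S / 2)) = A / (\<epsilon> * S)" for A S :: real
    proof -
      have "\<epsilon> * inverse S = inverse (\<epsilon> * S)"
        using \<epsilon> by auto
      then show ?thesis
        by (simp add: divide_inverse[of A])
    qed
    ultimately show ?thesis
      by (simp only: v)
  qed
  ultimately have "((\<lambda>t. \<epsilon> * sqrt ((x t)\<^sup>2 + (y t)\<^sup>2)) has_real_derivative (x t * x' + y t * y') / v t)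
      (at t within {0..})"
    by (simp only:)
  then show ?thesis
    unfolding v[symmetric] by (simp only: x_def y_def x'_def y'_def)
qed

lemma v_cont: "continuous_on {0..} v"
  using v_deriv by (intro DERIV_continuous_on) auto

text \<open>The quantities \<open>s\<^sub>i\<^sup>D\<close>, \<open>i \<ge> 2\<close>, are polynomials in \<open>1 / v\<close> and the derivatives of \<open>x\<^sup>D\<close>, hence
  bounded.\<close>

inductive alg :: "nat \<Rightarrow> (real \<Rightarrow> real) \<Rightarrow> bool" for m where
  alg_const: "alg m (\<lambda>t. c)"
| alg_inv: "alg m (\<lambda>t. inverse (v t))"
| alg_X: "1 \<le> j \<Longrightarrow> j \<le> m \<Longrightarrow> alg m (\<lambda>t. X j t $ c)"
| alg_add: "alg m f \<Longrightarrow> alg m g \<Longrightarrow> alg m (\<lambda>t. f t + g t)"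
| alg_mult: "alg m f \<Longrightarrow> alg m g \<Longrightarrow> alg m (\<lambda>t. f t * g t)"

lemma alg_mono: "alg m f \<Longrightarrow> m \<le> m' \<Longrightarrow> alg m' f"
  by (induction rule: alg.induct) (auto intro: alg.intros)

lemma alg_continuous: "alg m f \<Longrightarrow> m \<le> n + 1 \<Longrightarrow> continuous_on {0..} f"
  by (induction rule: alg.induct) (auto intro!: continuous_intros v_cont X_cont simp: v_nonzero)

lemma alg_bounded:
  assumes "alg m f" "m \<le> n + 1"
  shows "\<exists>B. \<forall>t\<ge>0. \<bar>f t\<bar> \<le> B"
  using assms
proof (induction rule: alg.induct)
  case alg_inv
  obtain c where c: "c > 0" "\<And>t. t \<ge> 0 \<Longrightarrow> c \<le> norm (X 1 t)"
    using speed_bound by blast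
  then have "\<bar>inverse (v t)\<bar> \<le> inverse c" if "t \<ge> 0" for t
    using that by (simp add: v_abs le_imp_inverse_le)
  then show ?case by blast
next
  case (alg_X j c)
  obtain B where "\<And>t. t \<ge> 0 \<Longrightarrow> norm (X j t) \<le> B"
    using X_bounded[of j] alg_X by auto
  then have "\<bar>X j t $ c\<bar> \<le> B" if "t \<ge> 0" for t
    using that component_le_norm_cart[of "X j t" c] by (meson order_trans)
  then show ?case by blast
next
  case (alg_add f g)
  then obtain B C where "\<And>t. t \<ge> 0 \<Longrightarrow> \<bar>f t\<bar> \<le> B" "\<And>t. t \<ge> 0 \<Longrightarrow> \<bar>g t\<bar> \<le> C"
    by blast
  then have "\<bar>f t + g t\<bar> \<le> B + C" if "t \<ge> 0" for t
    using that by (meson abs_triangle_ineq add_mono order_trans)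
  then show ?case by blast
next
  case (alg_mult f g)
  then obtain B C where BC: "\<And>t. t \<ge> 0 \<Longrightarrow> \<bar>f t\<bar> \<le> B" "\<And>t. t \<ge> 0 \<Longrightarrow> \<bar>g t\<bar> \<le> C"
    by blast
  have "\<bar>f t * g t\<bar> \<le> B * C" if "t \<ge> 0" for t
    unfolding abs_mult using BC[OF that] by (intro mult_mono) auto
  then show ?case by blast
qed auto

lemma alg_deriv:
  assumes "alg m f" "1 \<le> m" "m \<le> n"
  shows "\<exists>f'. alg (Suc m) f' \<and> (\<forall>t\<ge>0. (f has_real_derivative f' t) (at t within {0..}))"
  using assms
proof (induction rule: alg.induct)
  case (alg_const c)
  show ?case
    by (rule exI[of _ "\<lambda>t. 0"]) (auto intro: alg.alg_const)
next
  case alg_inv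
  \<comment> \<open>The derivative -v'/v^2; v' involves second derivatives of the reference, which
    order \<open>Suc m\<close> permits because m \<ge> 1.\<close>
  define f' where "f' t = (- 1) * (inverse (v t) * ((X 1 t $ 1 * X 2 t $ 1 + X 1 t $ 2 * X 2 t $ 2) * inverse (v t)) * inverse (v t))" for t
  have "alg (Suc m) f'"
    unfolding f'_def[abs_def] using alg_inv
    by (intro alg.alg_mult alg.alg_add alg.alg_inv alg.alg_X alg.alg_const) auto
  moreover have "((\<lambda>t. inverse (v t)) has_real_derivative f' t) (at t within {0..})" if "t \<ge> 0" for t
    using DERIV_inverse'[OF v_deriv[OF that] v_nonzero[OF that]]
    by (simp add: f'_def divide_inverse)
  ultimately show ?case by blast
next
  case (alg_X j c)
  then show ?case
    by (intro exI[of _ "\<lambda>t. X (Suc j) t $ c"]) (auto intro!: alg.alg_X X_deriv)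
next
  case (alg_add f g)
  then obtain f' g' where fg: "alg (Suc m) f'" "alg (Suc m) g'"
    "\<And>t. t \<ge> 0 \<Longrightarrow> (f has_real_derivative f' t) (at t within {0..})"
    "\<And>t. t \<ge> 0 \<Longrightarrow> (g has_real_derivative g' t) (at t within {0..})"
    by blast
  then show ?case
    by (intro exI[of _ "\<lambda>t. f' t + g' t"]) (auto intro!: alg.alg_add DERIV_add)
next
  case (alg_mult f g)
  then obtain f' g' where fg: "alg (Suc m) f'" "alg (Suc m) g'"
    "\<And>t. t \<ge> 0 \<Longrightarrow> (f has_real_derivative f' t) (at t within {0..})"
    "\<And>t. t \<ge> 0 \<Longrightarrow> (g has_real_derivative g' t) (at t within {0..})"
    by blast
  have "alg (Suc m) f" "alg (Suc m) g"
    using alg_mult.hyps alg_mono by auto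
  then show ?case
    using fg
    by (intro exI[of _ "\<lambda>t. f' t * g t + g' t * f t"]) (auto intro!: alg.alg_add alg.alg_mult DERIV_mult)
qed

section \<open>The heading of the reference\<close>

text \<open>The rotation rate of the velocity vector as a function of time alone. It turns the
  construction of the heading into an integration instead of a nonlinear equation.\<close>

definition \<omega> :: "real \<Rightarrow> real" where
  "\<omega> t = (X 1 t $ 1 * X 2 t $ 2 - X 1 t $ 2 * X 2 t $ 1) / (v t)\<^sup>2"

lemma \<omega>_cont: "continuous_on {0..} \<omega>"
  unfolding \<omega>_def using n by (intro continuous_intros v_cont X_cont) (auto simp: v_nonzero)

text \<open>Integrate \<omega>. The inner product p of the velocity, divided by v, with the unit
  vector of angle \<theta> has derivative 0 and starts at 1; equality in Cauchy-Schwarz then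
  identifies the two directions for all times.\<close>

lemma heading_exists:
  assumes init: "X 1 0 = v 0 *\<^sub>R vector [cos \<theta>0, sin \<theta>0]"
  obtains \<theta> where "\<theta> 0 = \<theta>0"
    "\<And>t. t \<ge> 0 \<Longrightarrow> X 1 t $ 1 = v t * cos (\<theta> t)" "\<And>t. t \<ge> 0 \<Longrightarrow> X 1 t $ 2 = v t * sin (\<theta> t)"
    "\<And>t. t \<ge> 0 \<Longrightarrow> (\<theta> has_real_derivative \<omega> t) (at t within {0..})"
proof -
  define \<theta> where "\<theta> t = \<theta>0 + integral {0..t} \<omega>" for t
  have \<theta>: "(\<theta> has_real_derivative \<omega> t) (at t within {0..})" if "t \<ge> 0" for t
  proof (rule DERIV_within_atLeast)
    have "((\<lambda>t. integral {0..t} \<omega>) has_real_derivative \<omega> t) (at t within {0..t+1})"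
      by (rule integral_has_real_derivative[OF continuous_on_subset[OF \<omega>_cont]]) (use that in auto)
    then show "(\<theta> has_real_derivative \<omega> t) (at t within {0..t+1})"
      unfolding \<theta>_def[abs_def] by (auto intro!: derivative_eq_intros)
  qed
  define p where "p t = inverse (v t) * (X 1 t $ 1 * cos (\<theta> t) + X 1 t $ 2 * sin (\<theta> t))" for t
  have p: "(p has_real_derivative 0) (at t within {0..})" if t: "t \<ge> 0" for t
  proof -
    define fx fy where "fx = (\<lambda>t. X 1 t $ 1)" and "fy = (\<lambda>t. X 1 t $ 2)"
    define x y x' y' r c s where "x = X 1 t $ 1" and "y = X 1 t $ 2" and "x' = X 2 t $ 1" and "y' = X 2 t $ 2"
      and "r = inverse (v t)" and "c = cos (\<theta> t)" and "s = sin (\<theta> t)"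
    have r: "r\<^sup>2 * (x\<^sup>2 + y\<^sup>2) = 1"
      unfolding r_def x_def y_def v_square[symmetric]
      using v_nonzero[OF t] by (simp flip: power_mult_distrib)
    have w: "\<omega> t = (x * y' - y * x') * r\<^sup>2"
      by (simp add: \<omega>_def r_def x_def y_def x'_def y'_def divide_inverse power_inverse)
    have X1: "(fx has_real_derivative x') (at t within {0..})" "(fy has_real_derivative y') (at t within {0..})"
      using X_deriv[of 1 t 1] X_deriv[of 1 t 2] n t
      by (simp_all add: numeral_2_eq_2 fx_def fy_def x'_def y'_def)
    have p: "p = (\<lambda>t. inverse (v t) * (fx t * cos (\<theta> t) + fy t * sin (\<theta> t)))"
      by (rule ext) (simp add: p_def fx_def fy_def)
    have vd: "(v has_real_derivative (x * x' + y * y') * r) (at t within {0..})"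
      using v_deriv[OF t] by (simp add: x_def y_def x'_def y'_def r_def divide_inverse)
    have "(p has_real_derivative - (r * ((x * x' + y * y') * r) * r) * (x * c + y * s) +
      r * ((x' * c + x * (- s * \<omega> t)) + (y' * s + y * (c * \<omega> t)))) (at t within {0..})"
      unfolding p
      by (rule DERIV_cong[OF DERIV_mult[OF DERIV_inverse'[OF vd v_nonzero[OF t]] DERIV_add[OF
                DERIV_mult[OF X1(1) DERIV_chain2[OF DERIV_cos \<theta>[OF t]]]
                DERIV_mult[OF X1(2) DERIV_chain2[OF DERIV_sin \<theta>[OF t]]]]]])
        (simp add: fx_def fy_def r_def x_def y_def c_def s_def algebra_simps)
    moreover have "- (r * ((x * x' + y * y') * r) * r) * (x * c + y * s) +
      r * ((x' * c + x * (- s * \<omega> t)) + (y' * s + y * (c * \<omega> t))) = 0"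
    proof -
      have "- (r * ((x * x' + y * y') * r) * r) * (x * c + y * s) +
        r * ((x' * c + x * (- s * \<omega> t)) + (y' * s + y * (c * \<omega> t))) =
        r * ((x' * c + y' * s) * (1 - r\<^sup>2 * (x\<^sup>2 + y\<^sup>2)))"
        unfolding w by algebra
      then show ?thesis by (simp add: r)
    qed
    ultimately show ?thesis by (simp only:)
  qed
  then obtain c where c: "\<And>t. t \<ge> 0 \<Longrightarrow> p t = c"
    using has_field_derivative_zero_constant[of "{0..}" p] by auto
  have v0: "v 0 \<noteq> 0" by (rule v_nonzero) simp
  have c0: "X 1 0 $ 1 = v 0 * cos \<theta>0" "X 1 0 $ 2 = v 0 * sin \<theta>0"
    unfolding init by simp_all
  have "v 0 * cos \<theta>0 * cos \<theta>0 + v 0 * sin \<theta>0 * sin \<theta>0 = v 0 * (cos \<theta>0 * cos \<theta>0 + sin \<theta>0 * sin \<theta>0)"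
    by (simp only: distrib_left mult.assoc)
  then have "p 0 = inverse (v 0) * v 0"
    unfolding p_def c0 by (simp add: \<theta>_def)
  then have p1: "p t = 1" if "t \<ge> 0" for t
    using c[OF that] c[of 0] v0 by simp
  \<comment> \<open>Expanding the squared distance and inserting p = 1 gives v^2 - 2 v v +
    v^2.\<close>
  have "(X 1 t $ 1 - v t * cos (\<theta> t))\<^sup>2 + (X 1 t $ 2 - v t * sin (\<theta> t))\<^sup>2 = 0" if t: "t \<ge> 0" for t
  proof -
    have "X 1 t $ 1 * cos (\<theta> t) + X 1 t $ 2 * sin (\<theta> t) = v t"
      using p1[OF t] v_nonzero[OF t] by (simp add: p_def field_simps)
    moreover have "(X 1 t $ 1 - v t * cos (\<theta> t))\<^sup>2 + (X 1 t $ 2 - v t * sin (\<theta> t))\<^sup>2 =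
      ((X 1 t $ 1)\<^sup>2 + (X 1 t $ 2)\<^sup>2) - 2 * v t * (X 1 t $ 1 * cos (\<theta> t) + X 1 t $ 2 * sin (\<theta> t)) +
      (v t)\<^sup>2 * ((sin (\<theta> t))\<^sup>2 + (cos (\<theta> t))\<^sup>2)"
      by algebra
    ultimately have "(X 1 t $ 1 - v t * cos (\<theta> t))\<^sup>2 + (X 1 t $ 2 - v t * sin (\<theta> t))\<^sup>2 =
        (v t)\<^sup>2 - 2 * v t * v t + (v t)\<^sup>2 * 1"
      by (simp only: v_square[symmetric] sin_cos_squared_add)
    then show ?thesis
      by (simp only: power2_eq_square mult.assoc)
  qed
  then have "X 1 t $ 1 = v t * cos (\<theta> t)" "X 1 t $ 2 = v t * sin (\<theta> t)" if "t \<ge> 0" for t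
    using that by (simp_all add: sum_power2_eq_zero_iff)
  then show ?thesis
    using that[of \<theta>] \<theta> by (simp add: \<theta>_def)
qed

lemma heading_rate:
  assumes "t \<ge> 0" "X 1 t $ 1 = v t * cos \<theta>" "X 1 t $ 2 = v t * sin \<theta>"
  shows "\<omega> t = (X 2 t $ 2 * cos \<theta> - X 2 t $ 1 * sin \<theta>) / v t"
  using v_nonzero[OF assms(1)] unfolding \<omega>_def assms(2,3)
  by (simp add: field_simps power2_eq_square)

lemma s1_ref_exists: "\<exists>s. is_s1_ref \<epsilon> xD s"
proof -
  have v0: "v 0 \<noteq> 0" by (rule v_nonzero) simp
  have "(X 1 0 $ 1 / v 0)\<^sup>2 + (X 1 0 $ 2 / v 0)\<^sup>2 = 1"
    unfolding power_divide add_divide_distrib[symmetric] v_square[symmetric] using v0 by simp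
  then obtain u where u: "0 \<le> u" "u < 2 * pi" "X 1 0 $ 1 / v 0 = cos u" "X 1 0 $ 2 / v 0 = sin u"
    using sincos_total_2pi by metis
  \<comment> \<open>The angle u lies in [0, 2 pi); for the sign + it is moved to the branch (-pi,
    pi].\<close>
  define \<theta>0 where "\<theta>0 = (if \<epsilon> = 1 \<and> u > pi then u - 2 * pi else u)"
  have range: "if \<epsilon> = 1 then -pi < \<theta>0 \<and> \<theta>0 \<le> pi else 0 \<le> \<theta>0 \<and> \<theta>0 < 2 * pi"
    using u(1,2) by (auto simp: \<theta>0_def)
  have "cos \<theta>0 = cos u" "sin \<theta>0 = sin u"
    by (simp_all add: \<theta>0_def cos_diff sin_diff)
  then have init: "X 1 0 = v 0 *\<^sub>R vector [cos \<theta>0, sin \<theta>0]"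
    using u(3,4) v0 by (simp add: vec_eq_iff forall_2 field_simps)
  obtain \<theta> where \<theta>: "\<theta> 0 = \<theta>0"
    "\<And>t. t \<ge> 0 \<Longrightarrow> X 1 t $ 1 = v t * cos (\<theta> t)" "\<And>t. t \<ge> 0 \<Longrightarrow> X 1 t $ 2 = v t * sin (\<theta> t)"
    "\<And>t. t \<ge> 0 \<Longrightarrow> (\<theta> has_real_derivative \<omega> t) (at t within {0..})"
    using heading_exists[OF init] by blast
  have "is_s1_ref \<epsilon> xD \<theta>"
    unfolding is_s1_ref_def
  proof (intro conjI allI impI)
    show "(\<theta> has_real_derivative ((tderiv ^^ 2) xD t $ 2 * cos (\<theta> t) - (tderiv ^^ 2) xD t $ 1 * sin (\<theta> t)) /
        v1_ref \<epsilon> xD t) (at t within {0..})" if "t \<ge> 0" for t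
      using \<theta>(4)[OF that] heading_rate[OF that \<theta>(2,3)[OF that]] unfolding X_def v_def by simp
    show "tderiv xD 0 = v1_ref \<epsilon> xD 0 *\<^sub>R vector [cos (\<theta> 0), sin (\<theta> 0)]"
      using init unfolding \<theta>(1) X_def v_def by simp
  qed (use range \<theta>(1) in auto)
  then show ?thesis by blast
qed

text \<open>\<open>s1_ref\<close> is an arbitrary choice, so only its differential equation and
  initial conditions are available. That equation is Lipschitz in s with a constant uniform in time,
  because the second derivative divided by v is bounded; Gronwall's inequality identifies s with the
  integrated heading.\<close>

lemma s1_ref_props:
  assumes t: "t \<ge> 0"
  shows s1_ref_cos: "X 1 t $ 1 = v t * cos (s1_ref \<epsilon> xD t)"
    and s1_ref_sin: "X 1 t $ 2 = v t * sin (s1_ref \<epsilon> xD t)"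
    and s1_ref_deriv: "(s1_ref \<epsilon> xD has_real_derivative \<omega> t) (at t within {0..})"
proof -
  define s where "s = s1_ref \<epsilon> xD"
  have "is_s1_ref \<epsilon> xD s"
    unfolding s_def s1_ref_def by (rule someI_ex[OF s1_ref_exists])
  then have s: "\<And>t. t \<ge> 0 \<Longrightarrow> (s has_real_derivative
      (X 2 t $ 2 * cos (s t) - X 2 t $ 1 * sin (s t)) / v t) (at t within {0..})"
    and init: "X 1 0 = v 0 *\<^sub>R vector [cos (s 0), sin (s 0)]"
    unfolding is_s1_ref_def X_def v_def by auto
  obtain \<theta> where \<theta>: "\<theta> 0 = s 0"
    "\<And>t. t \<ge> 0 \<Longrightarrow> X 1 t $ 1 = v t * cos (\<theta> t)" "\<And>t. t \<ge> 0 \<Longrightarrow> X 1 t $ 2 = v t * sin (\<theta> t)"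
    "\<And>t. t \<ge> 0 \<Longrightarrow> (\<theta> has_real_derivative \<omega> t) (at t within {0..})"
    using heading_exists[OF init] by blast
  have a: "alg 2 (\<lambda>t. X 2 t $ 1 * inverse (v t))" "alg 2 (\<lambda>t. X 2 t $ 2 * inverse (v t))"
    by (intro alg_mult alg_X alg_inv; simp)+
  obtain B where B: "\<And>t. t \<ge> 0 \<Longrightarrow> \<bar>X 2 t $ 1 * inverse (v t)\<bar> \<le> B"
    using alg_bounded[OF a(1)] n by auto
  obtain C where C: "\<And>t. t \<ge> 0 \<Longrightarrow> \<bar>X 2 t $ 2 * inverse (v t)\<bar> \<le> C"
    using alg_bounded[OF a(2)] n by auto
  have BC: "B + C \<ge> 0"
    using B[of 0] C[of 0] by simp
  have eq: "s t = \<theta> t" if t: "t \<ge> 0" for t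
  proof -
    have "s t - \<theta> t = 0"
    proof (rule differential_inequality_unique[where I = "{0::nat}" and d = "\<lambda>_ t. s t - \<theta> t" and L = "B + C" and i = 0])
      fix i :: nat and u assume u: "0 \<le> u" "u \<le> t"
      show "((\<lambda>t. s t - \<theta> t) has_real_derivative
        (X 2 u $ 2 * cos (s u) - X 2 u $ 1 * sin (s u)) / v u - \<omega> u) (at u within {0..t})"
        by (intro DERIV_diff DERIV_subset[OF s[OF u(1)]] DERIV_subset[OF \<theta>(4)[OF u(1)]]) auto
      have "(X 2 u $ 2 * cos (s u) - X 2 u $ 1 * sin (s u)) / v u - \<omega> u =
        X 2 u $ 2 * inverse (v u) * (cos (s u) - cos (\<theta> u)) - X 2 u $ 1 * inverse (v u) * (sin (s u) - sin (\<theta> u))"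
        unfolding heading_rate[OF u(1) \<theta>(2,3)[OF u(1)]] by (simp add: divide_inverse algebra_simps)
      also have "\<bar>\<dots>\<bar> \<le> \<bar>X 2 u $ 2 * inverse (v u)\<bar> * \<bar>cos (s u) - cos (\<theta> u)\<bar> + \<bar>X 2 u $ 1 * inverse (v u)\<bar> * \<bar>sin (s u) - sin (\<theta> u)\<bar>"
        unfolding abs_mult[symmetric] by (rule abs_triangle_ineq4)
      also have "\<dots> \<le> C * \<bar>s u - \<theta> u\<bar> + B * \<bar>s u - \<theta> u\<bar>"
        using B[OF u(1)] C[OF u(1)] by (intro add_mono mult_mono abs_sin_diff_le abs_cos_diff_le) auto
      finally show "\<bar>(X 2 u $ 2 * cos (s u) - X 2 u $ 1 * sin (s u)) / v u - \<omega> u\<bar> \<le>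
          (B + C) * (\<Sum>j\<in>{0::nat}. \<bar>s u - \<theta> u\<bar>)"
        by (simp add: algebra_simps)
    qed (use t \<theta>(1) BC in auto)
    then show ?thesis by simp
  qed
  show "X 1 t $ 1 = v t * cos (s1_ref \<epsilon> xD t)" "X 1 t $ 2 = v t * sin (s1_ref \<epsilon> xD t)"
    using \<theta>(2,3)[OF t] eq[OF t] by (simp_all add: s_def)
  show "(s1_ref \<epsilon> xD has_real_derivative \<omega> t) (at t within {0..})"
    using s[OF t] heading_rate[OF t \<theta>(2,3)[OF t]] eq[OF t] by (simp add: s_def)
qed

section \<open>Regularity and boundedness of the s_i^D\<close>

lemma s_ref_1: "s_ref \<epsilon> xD 1 = s1_ref \<epsilon> xD"
  by (simp add: s_ref_def)

lemma s_ref_Suc: "i \<ge> 1 \<Longrightarrow> s_ref \<epsilon> xD (Suc i) t = tderiv (s_ref \<epsilon> xD i) t / v t"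
  by (cases i) (auto simp: s_ref_def v_def)

lemma tderiv_real: "(f has_real_derivative D) (at t within {0..}) \<Longrightarrow> t \<ge> 0 \<Longrightarrow> tderiv f t = D"
  by (rule tderiv_eqI) (simp_all add: has_real_derivative_iff_has_vector_derivative)

text \<open>Each differentiation raises the order of the derivatives of the reference by one, so
  s_i^D uses orders up to i; this is where the n + 1 bounded derivatives enter. Index 1 is excluded
  because s_1^D is an angle, not a polynomial in these quantities.\<close>

lemma s_ref_alg:
  assumes "2 \<le> i" "i \<le> n + 1"
  shows "\<exists>g. alg i g \<and> (\<forall>t\<ge>0. s_ref \<epsilon> xD i t = g t)"
  using assms
proof (induction i rule: dec_induct)
  case base
  define g where "g t = (X 1 t $ 1 * X 2 t $ 2 + (- 1) * (X 1 t $ 2 * X 2 t $ 1)) *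
    (inverse (v t) * (inverse (v t) * inverse (v t)))" for t
  have "alg 2 g"
    unfolding g_def[abs_def] by (intro alg_mult alg_add alg_const alg_X alg_inv) auto
  moreover have "s_ref \<epsilon> xD 2 t = g t" if "t \<ge> 0" for t
    using s_ref_Suc[of 1 t] tderiv_real[OF s1_ref_deriv[OF that] that]
    by (simp add: s_ref_1[simplified] numeral_2_eq_2 g_def \<omega>_def divide_inverse power2_eq_square)
  ultimately show ?case by blast
next
  case (step i)
  then obtain g where g: "alg i g" "\<And>t. t \<ge> 0 \<Longrightarrow> s_ref \<epsilon> xD i t = g t" by auto
  obtain g' where g': "alg (Suc i) g'" "\<And>t. t \<ge> 0 \<Longrightarrow> (g has_real_derivative g' t) (at t within {0..})"
    using alg_deriv[OF g(1)] step by auto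
  have "s_ref \<epsilon> xD (Suc i) t = g' t * inverse (v t)" if t: "t \<ge> 0" for t
  proof -
    have "(s_ref \<epsilon> xD i has_real_derivative g' t) (at t within {0..})"
      by (rule has_field_derivative_transform_within[OF g'(2)[OF t] zero_less_one]) (use t g(2) in auto)
    then show ?thesis
      using s_ref_Suc[of i t] step.hyps tderiv_real[OF _ t] by (simp add: divide_inverse)
  qed
  moreover have "alg (Suc i) (\<lambda>t. g' t * inverse (v t))"
    by (intro alg_mult g'(1) alg_inv)
  ultimately show ?case by blast
qed

lemma s_ref_differentiable:
  assumes "1 \<le> i" "i \<le> n" "t \<ge> 0"
  obtains D where "(s_ref \<epsilon> xD i has_real_derivative D) (at t within {0..})"
proof (cases "i = 1")
  case True
  then show ?thesis
    using that s1_ref_deriv[OF assms(3)] by (simp add: s_ref_1[simplified])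
next
  case False
  then obtain g where g: "alg i g" "\<And>t. t \<ge> 0 \<Longrightarrow> s_ref \<epsilon> xD i t = g t"
    using s_ref_alg[of i] assms by auto
  obtain g' where g': "alg (Suc i) g'" "\<And>t. t \<ge> 0 \<Longrightarrow> (g has_real_derivative g' t) (at t within {0..})"
    using alg_deriv[OF g(1)] assms by auto
  have "(s_ref \<epsilon> xD i has_real_derivative g' t) (at t within {0..})"
    by (rule has_field_derivative_transform_within[OF g'(2)[OF assms(3)] zero_less_one]) (use assms g(2) in auto)
  then show ?thesis by (rule that)
qed

lemma s_ref_deriv:
  assumes "1 \<le> i" "i \<le> n" "t \<ge> 0"
  shows "(s_ref \<epsilon> xD i has_real_derivative v t * s_ref \<epsilon> xD (Suc i) t) (at t within {0..})"
proof -
  obtain D where D: "(s_ref \<epsilon> xD i has_real_derivative D) (at t within {0..})"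
    using s_ref_differentiable[OF assms] .
  then have "v t * s_ref \<epsilon> xD (Suc i) t = D"
    using s_ref_Suc[OF assms(1), of t] tderiv_real[OF D assms(3)] v_nonzero[OF assms(3)] by simp
  with D show ?thesis by simp
qed

lemma s_ref_cont:
  assumes "1 \<le> i" "i \<le> n + 1"
  shows "continuous_on {0..} (s_ref \<epsilon> xD i)"
proof (cases "i \<le> n")
  case True
  then show ?thesis
    using s_ref_deriv[OF assms(1) True] by (intro DERIV_continuous_on) auto
next
  case False
  then obtain g where g: "alg i g" "\<And>t. t \<ge> 0 \<Longrightarrow> s_ref \<epsilon> xD i t = g t"
    using s_ref_alg[of i] assms n by auto
  show ?thesis
    using alg_continuous[OF g(1) assms(2)] by (rule continuous_on_eq) (simp add: g(2))
qed

lemma s_ref_bounded: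
  obtains R where "\<And>i t. 2 \<le> i \<Longrightarrow> i \<le> n + 1 \<Longrightarrow> t \<ge> 0 \<Longrightarrow> \<bar>s_ref \<epsilon> xD i t\<bar> \<le> R"
proof -
  have "\<exists>B. 2 \<le> i \<longrightarrow> i \<le> n + 1 \<longrightarrow> (\<forall>t\<ge>0. \<bar>s_ref \<epsilon> xD i t\<bar> \<le> B)" for i
    using s_ref_alg[of i] alg_bounded[of i] by metis
  then obtain B where B: "\<And>i t. 2 \<le> i \<Longrightarrow> i \<le> n + 1 \<Longrightarrow> t \<ge> 0 \<Longrightarrow> \<bar>s_ref \<epsilon> xD i t\<bar> \<le> B i"
    by metis
  show ?thesis
  proof (rule that[of "\<Sum>i=2..n+1. \<bar>B i\<bar>"])
    fix i t assume i: "2 \<le> i" "i \<le> n + 1" "(t::real) \<ge> 0"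
    have "\<bar>B i\<bar> \<le> (\<Sum>i=2..n+1. \<bar>B i\<bar>)"
      using i by (intro member_le_sum) auto
    then show "\<bar>s_ref \<epsilon> xD i t\<bar> \<le> (\<Sum>i=2..n+1. \<bar>B i\<bar>)"
      using B[OF i] by linarith
  qed
qed

lemma v_ref_eq:
  assumes "t \<ge> 0"
  shows "v_ref n \<epsilon> xD t $ 1 = v t" "v_ref n \<epsilon> xD t $ 2 = v t * s_ref \<epsilon> xD (Suc n) t"
  using s_ref_Suc[OF n, of t] v_nonzero[OF assms] by (simp_all add: v_ref_def v_def)

end

section \<open>The chained form of the kinematic model\<close>

lemma tan_shift: "m = 0 \<or> m = 1 \<Longrightarrow> tan (real m * pi + x) = tan x"
  and cos_shift: "m = 0 \<or> m = 1 \<Longrightarrow> cos (real m * pi + x) = (if m = 0 then cos x else - cos x)"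
  for m :: nat
  by (auto simp: add.commute[of pi] tan_periodic_pi cos_add)

locale truck =
  fixes n :: nat and l :: "nat \<Rightarrow> real"
  assumes n: "n \<ge> 1" and l: "\<And>i. 1 \<le> i \<Longrightarrow> i < n \<Longrightarrow> l i > 0"
begin

text \<open>A common domain containing the cells of all modes, so that the differential calculus
  need not be repeated for each mode.\<close>

definition U :: "(nat \<Rightarrow> real) set" where
  "U = {y. \<forall>i\<in>{2..n}. cos (y i) \<noteq> 0}"

text \<open>Moving a single coordinate slightly stays in U, so partial derivatives at points of U
  see only values on U.\<close>

lemma partial_cong:
  assumes y: "y \<in> U" and fg: "\<And>y. y \<in> U \<Longrightarrow> f y = g y"
  shows "partial j f y = partial j g y"
proof -
  have "\<forall>\<^sub>F t in nhds (y j). y(j := t) \<in> U"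
  proof (cases "j \<in> {2..n}")
    case True
    have "\<forall>\<^sub>F t in nhds (y j). cos t \<noteq> 0"
      using y True by (intro tendsto_imp_eventually_ne[of _ "cos (y j)"] tendsto_cos filterlim_ident) (auto simp: U_def)
    then show ?thesis
      by (rule eventually_mono) (use y in \<open>auto simp: U_def\<close>)
  next
    case False
    then show ?thesis
      using y by (intro always_eventually) (auto simp: U_def)
  qed
  then show ?thesis
    unfolding partial_def by (intro deriv_cong_ev refl) (auto elim!: eventually_mono simp: fg)
qed

definition Lf :: "nat \<Rightarrow> (nat \<Rightarrow> real) \<Rightarrow> real" where
  "Lf k = (lie n (h1 n l) ^^ k) (\<lambda>y. y 1)"

lemma Lf_0: "Lf 0 = (\<lambda>y. y 1)"
  by (simp add: Lf_def)

lemma Lf_Suc: "Lf (Suc k) y = (\<Sum>j=1..n. partial j (Lf k) y * h1 n l y j)"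
  by (simp add: Lf_def lie_def)

lemma partial_coord: "partial j (\<lambda>y. y i) y = (if j = i then 1 else 0)"
  by (simp add: partial_def)

lemma smooth_sec_prod:
  assumes "m \<le> n"
  shows "smooth {2..m} U (\<lambda>y. \<Prod>k=2..m. 1 / cos (y k))"
  using assms by (intro smooth_prod smooth_divide smooth_const smooth_cos smooth_coord) (auto simp: U_def)

lemma smooth_eta:
  assumes "1 \<le> i" "i < n"
  shows "smooth {2..i+1} U (eta l i)"
proof (cases "i = 1")
  case True
  have "smooth {2..i+1} U (\<lambda>y. tan (y 2) / l 1)"
    using l[of 1] assms True
    by (intro smooth_divide smooth_const smooth_tan smooth_coord) (auto simp: U_def)
  then show ?thesis
    by (simp add: eta_def[abs_def] True)
next
  case False
  have "l i \<noteq> 0" "l (i - 1) \<noteq> 0"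
    by (rule less_imp_neq[OF l, symmetric]; use assms False in linarith)+
  then have "smooth {2..i+1} U (\<lambda>y. (tan (y (i + 1)) / l i - sin (y i) / l (i - 1)) * (\<Prod>k=2..i. 1 / cos (y k)))"
    using assms False
    by (intro smooth_mult smooth_diff smooth_divide smooth_const smooth_tan smooth_sin smooth_coord
        smooth_mono[OF smooth_sec_prod]) (auto simp: U_def)
  then show ?thesis
    using False by (simp add: eta_def[abs_def])
qed

text \<open>\<open>L\<^sub>h\<^sub>1\<^sup>k y\<^sub>1\<close> is affine in \<open>tan y\<^sub>k\<^sub>+\<^sub>1\<close>, with coefficients depending on \<open>y\<^sub>2, \<dots>, y\<^sub>k\<close> only; this
  is what makes \<open>S\<close> explicitly invertible on each cell.\<close>

definition is_coef :: "nat \<Rightarrow> ((nat \<Rightarrow> real) \<Rightarrow> real) \<times> ((nat \<Rightarrow> real) \<Rightarrow> real) \<Rightarrow> bool" where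
  "is_coef k p \<longleftrightarrow> smooth {2..k} U (fst p) \<and> smooth {2..k} U (snd p) \<and> (\<forall>y\<in>U. fst p y \<noteq> 0) \<and>
     (\<forall>y\<in>U. Lf k y = fst p y * tan (y (k + 1)) + snd p y)"

lemma affine_in_tan:
  assumes "smooth {2..k} U g" "smooth {2..k} U r" "2 \<le> k + 1" "k + 1 \<le> n"
    and y: "y \<in> U"
  shows "smooth {2..k+1} U (\<lambda>y. g y * tan (y (k + 1)) + r y)"
    and "partial (k + 1) (\<lambda>y. g y * tan (y (k + 1)) + r y) y = g y * inverse ((cos (y (k + 1)))\<^sup>2)"
proof -
  show "smooth {2..k+1} U (\<lambda>y. g y * tan (y (k + 1)) + r y)"
    using assms(3,4)
    by (intro smooth_add smooth_mult smooth_tan smooth_coord smooth_mono[OF assms(1)] smooth_mono[OF assms(2)])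
      (auto simp: U_def)
  have c: "g (y(k + 1 := t)) = g y" "r (y(k + 1 := t)) = r y" for t
    by (rule smooth_local[OF assms(1)] smooth_local[OF assms(2)]; simp)+
  have "cos (y (k + 1)) \<noteq> 0"
    using y assms(3,4) by (auto simp: U_def)
  then have "((\<lambda>t. g y * tan t + r y) has_real_derivative g y * inverse ((cos (y (k + 1)))\<^sup>2)) (at (y (k + 1)))"
    by (auto intro!: derivative_eq_intros)
  then show "partial (k + 1) (\<lambda>y. g y * tan (y (k + 1)) + r y) y = g y * inverse ((cos (y (k + 1)))\<^sup>2)"
    unfolding partial_def c by (auto intro: DERIV_imp_deriv)
qed

text \<open>Apply L_{h1} to g tan y_{k+1} + r. The variable y_{k+2} enters only through
  \<eta>_{k+1}, which is itself affine in tan y_{k+2}; the contributions with smaller index go into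
  the new remainder.\<close>

lemma coef_exists:
  assumes "1 \<le> k" "k < n"
  shows "\<exists>p. is_coef k p"
  using assms
proof (induction k rule: dec_induct)
  case base
  have "Lf 1 y = (1 / l 1) * tan (y 2) + 0" for y
  proof -
    have "Lf 1 y = (\<Sum>j=1..n. if j = 1 then h1 n l y j else 0)"
      unfolding One_nat_def Lf_Suc Lf_0 partial_coord by (intro sum.cong) auto
    also have "\<dots> = eta l 1 y"
      using base n by (simp add: h1_def)
    finally show ?thesis
      by (simp add: eta_def)
  qed
  then have "is_coef 1 (\<lambda>y. 1 / l 1, \<lambda>y. 0)"
    using l[of 1] base by (auto simp: is_coef_def numeral_2_eq_2 intro: smooth_const)
  then show ?case by blast
next
  case (step k)
  then obtain g r where g: "smooth {2..k} U g" and r: "smooth {2..k} U r"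
    and g0: "\<And>y. y \<in> U \<Longrightarrow> g y \<noteq> 0" and L: "\<And>y. y \<in> U \<Longrightarrow> Lf k y = g y * tan (y (k + 1)) + r y"
    unfolding is_coef_def by auto
  define P where "P = (\<lambda>y. g y * tan (y (k + 1)) + r y)"
  have k: "2 \<le> k + 1" "k + 1 \<le> n" "k + 1 < n" using step by auto
  have U: "(\<lambda>_. 0) \<in> U" by (simp add: U_def)
  have P: "smooth {2..k+1} U P"
    unfolding P_def by (rule affine_in_tan(1)[OF g r k(1,2) U])
  have "\<exists>p. smooth {2..k+1} U p \<and> (\<forall>y\<in>U. pd j P y = p y)" for j
    by (rule smooth_pd_ex[OF finite_atLeastAtMost P, of j]) blast
  then obtain p where p: "\<And>j. smooth {2..k+1} U (p j)" "\<And>j y. y \<in> U \<Longrightarrow> pd j P y = p j y"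
    by metis
  have part: "partial j (Lf k) y = pd j P y" if "y \<in> U" for j y
    using partial_cong[OF that, of "Lf k" P j] L by (simp add: P_def partial_eq_pd)
  define Q where "Q y = (\<Prod>m=2..k+1. 1 / cos (y m))" for y :: "nat \<Rightarrow> real"
  have Q: "smooth {2..k+1} U Q"
    unfolding Q_def[abs_def] by (rule smooth_sec_prod[OF k(2)])
  have Q0: "Q y \<noteq> 0" if "y \<in> U" for y
    using that k unfolding Q_def by (auto simp: U_def)
  \<comment> \<open>The squared secant is the derivative of tan y_{k+1}, and Q is the product of
    secants in \<eta>_{k+1}. Neither vanishes, so the leading coefficient stays nonzero.\<close>
  define g' where "g' y = g y * inverse ((cos (y (k + 1)))\<^sup>2) * Q y / l (k + 1)" for y
  define r' where "r' y = (\<Sum>j=2..k. p j y * eta l j y) -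
      g y * inverse ((cos (y (k + 1)))\<^sup>2) * (sin (y (k + 1)) / l k) * Q y" for y
  have lk: "l k > 0" "l (k + 1) > 0"
    using l[of k] l[of "k + 1"] step by auto
  have gk: "smooth {2..k+1} U g"
    by (rule smooth_mono[OF g]) auto
  have ck: "smooth {2..k+1} U (\<lambda>y. inverse ((cos (y (k + 1)))\<^sup>2))"
    using k by (intro smooth_inverse smooth_power smooth_cos smooth_coord) (auto simp: U_def)
  have "smooth {2..k+1} U g'"
    unfolding g'_def[abs_def] using lk by (intro smooth_divide smooth_mult smooth_const gk ck Q) auto
  moreover have "smooth {2..k+1} U r'"
    unfolding r'_def[abs_def] using lk k
    by (intro smooth_diff smooth_sum smooth_mult smooth_divide smooth_const smooth_sin smooth_coord gk ck Q p(1)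
        smooth_mono[OF smooth_eta]) auto
  moreover have "g' y \<noteq> 0" if "y \<in> U" for y
    using g0[OF that] Q0[OF that] lk that k by (auto simp: g'_def U_def)
  moreover have "Lf (Suc k) y = g' y * tan (y (Suc k + 1)) + r' y" if y: "y \<in> U" for y
  proof -
    have zero: "pd j P y = 0" if "j \<notin> {2..k+1}" for j
      by (rule pd_outside[OF P that])
    have "Lf (Suc k) y = (\<Sum>j=1..n. pd j P y * h1 n l y j)"
      unfolding Lf_Suc part[OF y] ..
    also have "\<dots> = (\<Sum>j=2..k+1. pd j P y * h1 n l y j)"
      using k by (intro sum.mono_neutral_right) (auto simp: zero)
    also have "\<dots> = (\<Sum>j=2..k+1. pd j P y * eta l j y)"
      using k by (intro sum.cong) (auto simp: h1_def)
    also have "\<dots> = (\<Sum>j=2..k. p j y * eta l j y) + pd (k + 1) P y * eta l (k + 1) y"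
      using k by (simp add: p(2)[OF y])
    also have "pd (k + 1) P y = g y * inverse ((cos (y (k + 1)))\<^sup>2)"
      unfolding P_def partial_eq_pd[symmetric] by (rule affine_in_tan(2)[OF g r k(1,2) y])
    also have "eta l (k + 1) y = (tan (y (Suc k + 1)) / l (k + 1) - sin (y (k + 1)) / l k) * Q y"
      using step by (simp add: eta_def Q_def)
    finally show ?thesis
      by (simp add: g'_def r'_def algebra_simps)
  qed
  ultimately have "is_coef (Suc k) (g', r')"
    by (auto simp: is_coef_def)
  then show ?case by blast
qed

definition coef_g :: "nat \<Rightarrow> (nat \<Rightarrow> real) \<Rightarrow> real" where "coef_g k = fst (SOME p. is_coef k p)"
definition coef_r :: "nat \<Rightarrow> (nat \<Rightarrow> real) \<Rightarrow> real" where "coef_r k = snd (SOME p. is_coef k p)"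

lemma coef:
  assumes "1 \<le> k" "k < n"
  shows "smooth {2..k} U (coef_g k)" "smooth {2..k} U (coef_r k)" "y \<in> U \<Longrightarrow> coef_g k y \<noteq> 0"
    "y \<in> U \<Longrightarrow> Lf k y = coef_g k y * tan (y (k + 1)) + coef_r k y"
proof -
  define p where "p = (SOME p. is_coef k p)"
  have c: "coef_g k = fst p" "coef_r k = snd p"
    by (simp_all add: coef_g_def coef_r_def p_def)
  have "is_coef k p"
    unfolding p_def by (rule someI_ex[OF coef_exists[OF assms]])
  then have "smooth {2..k} U (coef_g k) \<and> smooth {2..k} U (coef_r k) \<and> (\<forall>y\<in>U. coef_g k y \<noteq> 0) \<and>
     (\<forall>y\<in>U. Lf k y = coef_g k y * tan (y (k + 1)) + coef_r k y)"
    unfolding c is_coef_def .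
  then show "smooth {2..k} U (coef_g k)" "smooth {2..k} U (coef_r k)" "y \<in> U \<Longrightarrow> coef_g k y \<noteq> 0"
    "y \<in> U \<Longrightarrow> Lf k y = coef_g k y * tan (y (k + 1)) + coef_r k y" by blast+
qed

lemma Lf_smooth:
  assumes "1 \<le> k" "k < n"
  obtains P where "smooth {2..k+1} U P" "\<And>y. y \<in> U \<Longrightarrow> Lf k y = P y"
    "\<And>y. y \<in> U \<Longrightarrow> partial (k + 1) P y = coef_g k y * inverse ((cos (y (k + 1)))\<^sup>2)"
proof -
  have U: "(\<lambda>_. 0) \<in> U" by (simp add: U_def)
  have k: "2 \<le> k + 1" "k + 1 \<le> n" using assms by auto
  show ?thesis
    by (rule that[OF affine_in_tan(1)[OF coef(1,2)[OF assms] k U] coef(4)[OF assms]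
          affine_in_tan(2)[OF coef(1,2)[OF assms] k]])
qed

lemma partial_Lf_outside:
  assumes "k < n" "y \<in> U" "j > k + 1"
  shows "partial j (Lf k) y = 0"
proof (cases "k = 0")
  case True
  then show ?thesis
    using assms by (simp add: Lf_0 partial_coord)
next
  case False
  then have "1 \<le> k" by simp
  obtain P where P: "smooth {2..k+1} U P" "\<And>y. y \<in> U \<Longrightarrow> Lf k y = P y"
    by (rule Lf_smooth[OF \<open>1 \<le> k\<close> assms(1)]) blast
  then show ?thesis
    using partial_cong[OF assms(2) P(2), where j = j] pd_outside[OF P(1), of j y] assms(3)
    by (simp add: partial_eq_pd)
qed

lemma partial_Lf_diag:
  assumes "k < n" "y \<in> U"
  shows "partial (k + 1) (Lf k) y \<noteq> 0"
proof (cases "k = 0")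
  case True
  then show ?thesis
    by (simp add: Lf_0 partial_coord)
next
  case False
  then have "1 \<le> k" by simp
  obtain P where P: "\<And>y. y \<in> U \<Longrightarrow> Lf k y = P y"
    "\<And>y. y \<in> U \<Longrightarrow> partial (k + 1) P y = coef_g k y * inverse ((cos (y (k + 1)))\<^sup>2)"
    by (rule Lf_smooth[OF \<open>1 \<le> k\<close> assms(1)]) blast
  have "cos (y (k + 1)) \<noteq> 0"
    using assms False by (auto simp: U_def)
  then show ?thesis
    using coef(3)[OF \<open>1 \<le> k\<close> assms(1,2)]
    by (simp only: partial_cong[OF assms(2) P(1), where j = "k + 1"] P(2)[OF assms(2)]) simp
qed

text \<open>\<open>Lf k\<close> agrees with a smooth function only on U; the curve must stay there
  for the derivative to carry over.\<close>

lemma Lf_chain: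
  assumes "k < n" and S: "\<And>\<tau>. \<tau> \<in> S \<Longrightarrow> y \<tau> \<in> U" and t: "t \<in> S"
    and d: "\<And>j. 1 \<le> j \<Longrightarrow> j \<le> n \<Longrightarrow> ((\<lambda>\<tau>. y \<tau> j) has_real_derivative d j) (at t within S)"
  shows "((\<lambda>\<tau>. Lf k (y \<tau>)) has_real_derivative (\<Sum>j=1..n. partial j (Lf k) (y t) * d j)) (at t within S)"
proof -
  obtain P where P: "smooth {1..n} U P" "\<And>y. y \<in> U \<Longrightarrow> Lf k y = P y"
  proof (cases "k = 0")
    case True
    show ?thesis
      by (rule that[of "\<lambda>y. y 1"]) (use n in \<open>auto intro: smooth_coord simp: True Lf_0\<close>)
  next
    case False
    then have "1 \<le> k" by simp
    obtain P where P: "smooth {2..k+1} U P" "\<And>y. y \<in> U \<Longrightarrow> Lf k y = P y"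
      by (rule Lf_smooth[OF \<open>1 \<le> k\<close> assms(1)]) blast
    then show ?thesis
      using assms(1) by (intro that[OF smooth_mono[OF P(1)] P(2)]) auto
  qed
  have "((\<lambda>\<tau>. P (y \<tau>)) has_real_derivative (\<Sum>j\<in>{1..n}. pd j P (y t) * d j)) (at t within S)"
    by (rule smooth_chain[where c = y, OF _ P(1) S[OF t]]) (use d in auto)
  moreover have "pd j P (y t) = partial j (Lf k) (y t)" for j
    using partial_cong[OF S[OF t] P(2), where j = j] by (simp add: partial_eq_pd)
  ultimately have "((\<lambda>\<tau>. P (y \<tau>)) has_real_derivative (\<Sum>j=1..n. partial j (Lf k) (y t) * d j)) (at t within S)"
    by simp
  then show ?thesis
    by (rule has_field_derivative_transform_within[OF _ zero_less_one t]) (simp add: P(2) S)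
qed

definition Fp :: "(nat \<Rightarrow> real) \<Rightarrow> real" where "Fp = Lf n"
definition Fq :: "(nat \<Rightarrow> real) \<Rightarrow> real" where "Fq y = partial n (Lf (n - 1)) y"

lemma lie_h2: "lie n (h2 n) f y = partial n f y"
proof -
  have "lie n (h2 n) f y = (\<Sum>j=1..n. if j = n then partial j f y else 0)"
    unfolding lie_def h2_def by (intro sum.cong) auto
  then show ?thesis
    using n by simp
qed

lemma Fq_nonzero: "y \<in> U \<Longrightarrow> Fq y \<noteq> 0"
  using partial_Lf_diag[of "n - 1" y] n by (simp add: Fq_def)

text \<open>The point is the variable set {2..n}: the entries of F do not depend on y_1, the one
  coordinate that may be unbounded along a reference.\<close>

lemma Fp_Fq_smooth:
  obtains P Q where "smooth {2..n} U P" "smooth {2..n} U Q"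
    "\<And>y. y \<in> U \<Longrightarrow> Fp y = P y" "\<And>y. y \<in> U \<Longrightarrow> Fq y = Q y"
proof (cases "n = 1")
  case True
  have "Lf n = Lf (Suc 0)" "Lf (n - 1) = Lf 0"
    by (rule arg_cong[where f = Lf]; use True in simp)+
  note L = this
  have h: "h1 n l y j = 0" for y j
    using True by (auto simp: h1_def)
  have "Fp y = 0" for y
    unfolding Fp_def L Lf_Suc h by simp
  moreover have "Fq y = 1" for y
    unfolding Fq_def L Lf_0 partial_coord using True by simp
  ultimately have "Fp y = 0" "Fq y = 1" for y
    by auto
  then show ?thesis
    by (intro that[of "\<lambda>_. 0" "\<lambda>_. 1"]) (auto intro: smooth_const)
next
  case False
  define k where "k = n - 1"
  have k: "1 \<le> k" "k < n" "n = k + 1" "n = Suc k" using False n by (auto simp: k_def)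
  obtain P0 where P0: "smooth {2..k+1} U P0" "\<And>y. y \<in> U \<Longrightarrow> Lf k y = P0 y"
    by (rule Lf_smooth[OF k(1,2)]) blast
  have "\<exists>p. smooth {2..n} U p \<and> (\<forall>y\<in>U. pd j P0 y = p y)" for j
    by (rule smooth_pd_ex[OF finite_atLeastAtMost P0(1), of j]) (use k(3) in auto)
  then obtain p where p: "\<And>j. smooth {2..n} U (p j)" "\<And>j y. y \<in> U \<Longrightarrow> pd j P0 y = p j y"
    by metis
  have part: "partial j (Lf k) y = p j y" if "y \<in> U" for j y
    using partial_cong[OF that P0(2), where j = j] p(2)[OF that] by (simp add: partial_eq_pd)
  have "Fp y = (\<Sum>j=1..k. p j y * eta l j y)" if "y \<in> U" for y
  proof -
    have "Fp y = (\<Sum>j=1..n. p j y * h1 n l y j)"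
      unfolding Fp_def by (subst k(4)) (simp only: Lf_Suc part[OF that])
    also have "\<dots> = (\<Sum>j=1..k. p j y * h1 n l y j)"
      using k by (intro sum.mono_neutral_right) (auto simp: h1_def)
    also have "\<dots> = (\<Sum>j=1..k. p j y * eta l j y)"
      using k by (intro sum.cong) (auto simp: h1_def)
    finally show ?thesis .
  qed
  moreover have "Fq y = p n y" if "y \<in> U" for y
    using part[OF that] by (simp add: Fq_def k_def)
  moreover have "smooth {2..n} U (\<lambda>y. \<Sum>j=1..k. p j y * eta l j y)"
    using k by (intro smooth_sum smooth_mult p(1) smooth_mono[OF smooth_eta]) auto
  ultimately show ?thesis
    using p(1) by (intro that) auto
qed

section \<open>The input transformation F\<close>

lemma F_mat_eq: "F_mat n l y = vector [vector [1, 0], vector [Fp y, Fq y]]"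
  by (simp add: F_mat_def Fp_def Fq_def lie_h2 Lf_def)

lemma F_mat_mult: "F_mat n l y *v u = vector [u $ 1, Fp y * u $ 1 + Fq y * u $ 2]"
  by (simp add: F_mat_eq vec_eq_iff forall_2 matrix_vector_mult_def sum_2)

lemma F2_mat_mult: "F2_mat n l y *v u = vector [0, Fp y * u $ 1 + Fq y * u $ 2]"
  by (simp add: F2_mat_def F_mat_eq vec_eq_iff forall_2 matrix_vector_mult_def matrix_matrix_mult_def sum_2)

lemma F_mat_inv:
  assumes "y \<in> U"
  shows "matrix_inv (F_mat n l y) *v v = vector [v $ 1, (v $ 2 - Fp y * v $ 1) / Fq y]"
proof -
  have q: "Fq y \<noteq> 0" by (rule Fq_nonzero[OF assms])
  have "matrix_inv (F_mat n l y) = vector [vector [1, 0], vector [- Fp y / Fq y, 1 / Fq y]]"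
    by (rule matrix_inv_eqI)
      (use q in \<open>simp_all add: F_mat_eq vec_eq_iff forall_2 matrix_matrix_mult_def mat_def sum_2\<close>)
  then show ?thesis
    using q by (simp add: vec_eq_iff forall_2 matrix_vector_mult_def sum_2 field_simps)
qed

lemma S_map_eq: "S_map n l y = (\<lambda>i\<in>{1..n}. Lf (i - 1) y)"
  by (simp add: S_map_def Lf_def)

lemma mode_cases: "\<mu> \<in> modes n \<Longrightarrow> 1 \<le> i \<Longrightarrow> i < n \<Longrightarrow> \<mu> i = 0 \<or> \<mu> i = 1"
  by (auto simp: modes_def PiE_iff)

lemma cell_subset_U: "\<mu> \<in> modes n \<Longrightarrow> cell n \<mu> \<subseteq> U"
proof
  fix y assume \<mu>: "\<mu> \<in> modes n" and y: "y \<in> cell n \<mu>"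
  have "cos (y i) \<noteq> 0" if i: "i \<in> {2..n}" for i
  proof -
    obtain k where k: "i = k + 1" "1 \<le> k" "k < n" using i by (cases i) auto
    have m: "\<mu> (i - 1) = 0 \<or> \<mu> (i - 1) = 1"
      using mode_cases[OF \<mu> k(2,3)] k(1) by simp
    define x where "x = y i - real (\<mu> (i - 1)) * pi"
    have "real (\<mu> (i - 1)) * pi - pi/2 < y i \<and> y i < real (\<mu> (i - 1)) * pi + pi/2"
      using y i unfolding cell_def by blast
    then have "-(pi/2) < x" "x < pi/2"
      unfolding x_def by linarith+
    then have "cos x > 0"
      by (intro cos_gt_zero_pi) auto
    moreover have "cos (real (\<mu> (i - 1)) * pi + x) = (if \<mu> (i - 1) = 0 then cos x else - cos x)"
      by (rule cos_shift[OF m])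
    moreover have "real (\<mu> (i - 1)) * pi + x = y i"
      by (simp add: x_def)
    ultimately show ?thesis
      by (metis less_irrefl neg_0_equal_iff_equal)
  qed
  then show "y \<in> U" by (simp add: U_def)
qed

subsection \<open>The inverse of \<open>S\<close> on a cell\<close>

text \<open>Only the coordinates \<open>1, \<dots>, m + 1\<close> of \<open>T \<mu> m s\<close> are meaningful. The others are \<open>0\<close>, which keeps
  it in \<open>U\<close>.\<close>

fun T :: "(nat \<Rightarrow> nat) \<Rightarrow> nat \<Rightarrow> (nat \<Rightarrow> real) \<Rightarrow> nat \<Rightarrow> real" where
  "T \<mu> 0 s = (\<lambda>k. if k = 1 then s 1 else 0)"
| "T \<mu> (Suc m) s = (T \<mu> m s)(m + 2 := real (\<mu> (m + 1)) * pi +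
     arctan ((s (m + 2) - coef_r (m + 1) (T \<mu> m s)) * inverse (coef_g (m + 1) (T \<mu> m s))))"

definition Y :: "(nat \<Rightarrow> nat) \<Rightarrow> (nat \<Rightarrow> real) \<Rightarrow> nat \<Rightarrow> real" where
  "Y \<mu> s = (\<lambda>i\<in>{1..n}. T \<mu> (n - 1) s i)"

lemma T_stable: "m \<le> m' \<Longrightarrow> j \<le> m + 1 \<Longrightarrow> T \<mu> m' s j = T \<mu> m s j"
  by (induction m' rule: dec_induct) auto

lemma T_1: "T \<mu> m s 1 = s 1"
  using T_stable[of 0 m 1 \<mu> s] by simp

lemma T_in_U:
  assumes "\<mu> \<in> modes n"
  shows "m < n \<Longrightarrow> T \<mu> m s \<in> U"
proof (induction m)
  case 0
  show ?case by (auto simp: U_def)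
next
  case (Suc m)
  have "cos (real (\<mu> (m + 1)) * pi + arctan x) \<noteq> 0" for x
    using cos_shift[OF mode_cases[OF assms], of "m + 1" "arctan x"] Suc.prems by (auto split: if_splits)
  then show ?case
    using Suc by (auto simp: U_def)
qed

lemma T_smooth:
  assumes \<mu>: "\<mu> \<in> modes n"
  shows "m < n \<Longrightarrow> 2 \<le> j \<Longrightarrow> smooth {2..m+1} UNIV (\<lambda>s. T \<mu> m s j)"
proof (induction m arbitrary: j)
  case 0
  then show ?case by (auto intro: smooth_const)
next
  case (Suc m)
  have k: "1 \<le> m + 1" "m + 1 < n" using Suc.prems by auto
  have "smooth {2..m+1} UNIV (\<lambda>s. coef_g (m + 1) (T \<mu> m s))" "smooth {2..m+1} UNIV (\<lambda>s. coef_r (m + 1) (T \<mu> m s))"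
    using Suc.prems(1) by (intro smooth_compose[OF coef(1)[OF k]] smooth_compose[OF coef(2)[OF k]] Suc.IH T_in_U[OF \<mu>]; simp)+
  then have gr: "smooth {2..Suc m+1} UNIV (\<lambda>s. coef_g (m + 1) (T \<mu> m s))" "smooth {2..Suc m+1} UNIV (\<lambda>s. coef_r (m + 1) (T \<mu> m s))"
    by (auto elim!: smooth_mono)
  show ?case
  proof (cases "j = m + 2")
    case True
    have "smooth {2..Suc m+1} UNIV (\<lambda>s. real (\<mu> (m + 1)) * pi +
     arctan ((s (m + 2) - coef_r (m + 1) (T \<mu> m s)) * inverse (coef_g (m + 1) (T \<mu> m s))))"
      using coef(3)[OF k] T_in_U[OF \<mu>] Suc.prems(1)
      by (intro smooth_add smooth_const smooth_arctan smooth_mult smooth_diff smooth_inverse smooth_coord gr) auto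
    then show ?thesis using True by simp
  next
    case False
    have "smooth {2..Suc m+1} UNIV (\<lambda>s. T \<mu> m s j)"
      by (rule smooth_mono[OF Suc.IH]) (use Suc.prems in auto)
    then show ?thesis
      using False by simp
  qed
qed

lemma Y_apply: "1 \<le> i \<Longrightarrow> i \<le> n \<Longrightarrow> Y \<mu> s i = T \<mu> (n - 1) s i"
  by (simp add: Y_def)

lemma Y_1: "Y \<mu> s 1 = s 1"
  using n T_1[of \<mu> "n - 1" s] by (simp add: Y_apply)

lemma Y_in_U: "\<mu> \<in> modes n \<Longrightarrow> Y \<mu> s \<in> U"
  using T_in_U[of \<mu> "n - 1" s] n by (auto simp: U_def Y_apply)

text \<open>For j \<ge> 2 the coordinate depends on s_2, ..., s_n only; the heading s_1 reappears
  unchanged as y_1. Estimates on compact sets therefore need no bound on s_1.\<close>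

lemma Y_smooth:
  assumes "\<mu> \<in> modes n" "2 \<le> j" "j \<le> n"
  shows "smooth {2..n} UNIV (\<lambda>s. Y \<mu> s j)"
  using T_smooth[OF assms(1) _ assms(2), of "n - 1"] assms n by (simp add: Y_apply)

lemma Y_step:
  assumes "1 \<le> k" "k < n"
  shows "Y \<mu> s (k + 1) = real (\<mu> k) * pi + arctan ((s (k + 1) - coef_r k (Y \<mu> s)) * inverse (coef_g k (Y \<mu> s)))"
proof -
  obtain m where m: "k = Suc m" using assms by (cases k) auto
  have eq: "T \<mu> m s j = Y \<mu> s j" if "j \<in> {2..k}" for j
    using that assms m T_stable[of m "n - 1" j \<mu> s] by (simp add: Y_apply)
  have "coef_r k (T \<mu> m s) = coef_r k (Y \<mu> s)" "coef_g k (T \<mu> m s) = coef_g k (Y \<mu> s)"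
    by (rule smooth_local[OF coef(2)[OF assms] eq] smooth_local[OF coef(1)[OF assms] eq]; assumption)+
  moreover have "Y \<mu> s (k + 1) = T \<mu> (Suc m) s (k + 1)"
    using T_stable[of "Suc m" "n - 1" "k + 1" \<mu> s] assms m by (simp add: Y_apply del: T.simps)
  ultimately show ?thesis
    using m by simp
qed

lemma Lf_Y:
  assumes \<mu>: "\<mu> \<in> modes n" and k: "k < n"
  shows "Lf k (Y \<mu> s) = s (k + 1)"
proof (cases "k = 0")
  case True
  then show ?thesis using Y_1 by (simp add: Lf_0)
next
  case False
  then have k1: "1 \<le> k" by simp
  show ?thesis
    unfolding coef(4)[OF k1 k Y_in_U[OF \<mu>]] Y_step[OF k1 k] tan_shift[OF mode_cases[OF \<mu> k1 k]] tan_arctan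
    using coef(3)[OF k1 k Y_in_U[OF \<mu>, of s]] by (simp add: field_simps)
qed

lemma Y_in_cell:
  assumes \<mu>: "\<mu> \<in> modes n"
  shows "Y \<mu> s \<in> cell n \<mu>"
proof -
  have "real (\<mu> (i - 1)) * pi - pi/2 < Y \<mu> s i \<and> Y \<mu> s i < real (\<mu> (i - 1)) * pi + pi/2"
    if i: "i \<in> {2..n}" for i
  proof -
    obtain k where k: "i = k + 1" "1 \<le> k" "k < n" using i by (cases i) auto
    obtain x where "Y \<mu> s i = real (\<mu> k) * pi + arctan x"
      using Y_step[OF k(2,3)] k(1) by blast
    then show ?thesis
      using arctan_lbound[of x] arctan_ubound[of x] k(1) by simp
  qed
  then show ?thesis
    by (auto simp: cell_def Y_def PiE_def)
qed

lemma Y_local: "\<mu> \<in> modes n \<Longrightarrow> (\<And>j. 1 \<le> j \<Longrightarrow> j \<le> n \<Longrightarrow> s j = s' j) \<Longrightarrow> Y \<mu> s = Y \<mu> s'"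
proof (rule ext)
  fix i assume \<mu>: "\<mu> \<in> modes n" and s: "\<And>j. 1 \<le> j \<Longrightarrow> j \<le> n \<Longrightarrow> s j = s' j"
  consider "i = 1" | "2 \<le> i" "i \<le> n" | "i \<notin> {1..n}" by force
  then show "Y \<mu> s i = Y \<mu> s' i"
  proof cases
    case 1
    then show ?thesis using Y_1 s n by simp
  next
    case 2
    show ?thesis
      by (rule smooth_local[OF Y_smooth[OF \<mu> 2]]) (use s in auto)
  next
    case 3
    then show ?thesis
      by (simp only: Y_def restrict_apply if_False)
  qed
qed

text \<open>Strong induction: once y_2, ..., y_k are recovered the coefficients agree, and arctan
  inverts tan on the interval of length pi around \<mu>_k pi that defines the cell.\<close>

lemma Y_Lf:
  assumes \<mu>: "\<mu> \<in> modes n" and y: "y \<in> cell n \<mu>"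
  shows "Y \<mu> (\<lambda>i. Lf (i - 1) y) = y"
proof -
  define s where "s = (\<lambda>i. Lf (i - 1) y)"
  have U: "y \<in> U" using cell_subset_U[OF \<mu>] y by auto
  have "k < n \<Longrightarrow> Y \<mu> s (k + 1) = y (k + 1)" for k
  proof (induction k rule: less_induct)
    case (less k)
    show ?case
    proof (cases "k = 0")
      case True
      then show ?thesis
        using Y_1[of \<mu> s] by (simp add: s_def Lf_0)
    next
      case False
      then have k: "1 \<le> k" "k < n" using less by auto
      have eq: "Y \<mu> s j = y j" if "j \<in> {2..k}" for j
        using less.IH[of "j - 1"] that k by auto
      have c: "coef_r k (Y \<mu> s) = coef_r k y" "coef_g k (Y \<mu> s) = coef_g k y"
        by (rule smooth_local[OF coef(2)[OF k] eq] smooth_local[OF coef(1)[OF k] eq]; assumption)+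
      define x where "x = y (k + 1) - real (\<mu> k) * pi"
      have x: "- (pi/2) < x" "x < pi/2"
        using y k by (auto simp: cell_def x_def dest!: bspec[of _ _ "k + 1"])
      have yx: "y (k + 1) = real (\<mu> k) * pi + x"
        by (simp add: x_def)
      have "tan (y (k + 1)) = tan x"
        unfolding yx by (rule tan_shift[OF mode_cases[OF \<mu> k]])
      then have "s (k + 1) = coef_g k y * tan x + coef_r k y"
        using coef(4)[OF k U] by (simp add: s_def)
      then have "(s (k + 1) - coef_r k y) * inverse (coef_g k y) = tan x"
        using coef(3)[OF k U] by (simp add: field_simps)
      then show ?thesis
        unfolding Y_step[OF k] c using x by (simp add: arctan_tan yx[simplified])
    qed
  qed
  then have "Y \<mu> s i = y i" if "i \<in> {1..n}" for i
    using that by (cases i) auto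
  then show ?thesis
    using y by (intro ext) (auto simp: s_def cell_def Y_def PiE_def extensional_def)
qed

lemma inv_into_S_map:
  assumes \<mu>: "\<mu> \<in> modes n"
  shows "inv_into (cell n \<mu>) (S_map n l) (\<lambda>i\<in>{1..n}. s i) = Y \<mu> s"
proof -
  have inv: "Y \<mu> (S_map n l y) = y" if "y \<in> cell n \<mu>" for y
  proof -
    have "Y \<mu> (S_map n l y) = Y \<mu> (\<lambda>i. Lf (i - 1) y)"
      by (rule Y_local[OF \<mu>]) (simp add: S_map_eq)
    then show ?thesis
      using Y_Lf[OF \<mu> that] by simp
  qed
  have S: "S_map n l (Y \<mu> s) = (\<lambda>i\<in>{1..n}. s i)"
    unfolding S_map_eq by (rule restrict_ext) (use Lf_Y[OF \<mu>] in \<open>auto simp: Suc_le_eq\<close>)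
  have "inj_on (S_map n l) (cell n \<mu>)"
    by (rule inj_on_inverseI[of _ "Y \<mu>"]) (rule inv)
  then show ?thesis
    unfolding S[symmetric] using Y_in_cell[OF \<mu>] by (rule inv_into_f_f)
qed

subsection \<open>Equivalence with the chained form\<close>

text \<open>The field h1 advances \<open>Lf k\<close> to the next iterate, while h2 moves only y_n,
  on which \<open>Lf k\<close> depends only for k = n - 1.\<close>

lemma chained_of_model:
  assumes S: "\<And>\<tau>. \<tau> \<in> S \<Longrightarrow> y \<tau> \<in> U" and t: "t \<in> S"
    and d: "\<And>j. 1 \<le> j \<Longrightarrow> j \<le> n \<Longrightarrow>
      ((\<lambda>\<tau>. y \<tau> j) has_real_derivative u1 * h1 n l (y t) j + u2 * h2 n (y t) j) (at t within S)"
    and k: "k < n"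
  shows "((\<lambda>\<tau>. Lf k (y \<tau>)) has_real_derivative
    (if k + 1 < n then u1 * Lf (k + 1) (y t) else u1 * Fp (y t) + u2 * Fq (y t))) (at t within S)"
proof (rule DERIV_cong[OF Lf_chain[OF k S t d]])
  have "(\<Sum>j=1..n. partial j (Lf k) (y t) * (u1 * h1 n l (y t) j + u2 * h2 n (y t) j)) =
    u1 * Lf (Suc k) (y t) + u2 * lie n (h2 n) (Lf k) (y t)"
    by (simp add: Lf_Suc lie_def sum.distrib sum_distrib_left algebra_simps)
  also have "\<dots> = (if k + 1 < n then u1 * Lf (k + 1) (y t) else u1 * Fp (y t) + u2 * Fq (y t))"
  proof (cases "k + 1 < n")
    case True
    then show ?thesis
      using partial_Lf_outside[OF k S[OF t], of n] by (simp add: lie_h2)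
  next
    case False
    have "Lf (Suc k) = Lf n" "Lf (n - 1) = Lf k"
      by (rule arg_cong[where f = Lf]; use k False in simp)+
    then show ?thesis
      using False by (simp only: lie_h2 Fp_def Fq_def if_False)
  qed
  finally show "(\<Sum>j=1..n. partial j (Lf k) (y t) * (u1 * h1 n l (y t) j + u2 * h2 n (y t) j)) =
    (if k + 1 < n then u1 * Lf (k + 1) (y t) else u1 * Fp (y t) + u2 * Fq (y t))" .
qed

text \<open>The Jacobian of \<open>S\<close> is lower triangular with nonzero diagonal, so the derivatives of \<open>S(y)\<close>
  determine those of \<open>y\<close>.\<close>

lemma model_of_chained:
  assumes \<mu>: "\<mu> \<in> modes n" and t: "t \<in> S"
    and nontriv: "at t within S \<noteq> bot"
    and s: "\<And>k. k < n \<Longrightarrow> ((\<lambda>\<tau>. s \<tau> (k + 1)) has_real_derivative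
      (if k + 1 < n then u1 * s t (k + 2) else u1 * Fp (Y \<mu> (s t)) + u2 * Fq (Y \<mu> (s t)))) (at t within S)"
    and j: "1 \<le> j" "j \<le> n"
  shows "((\<lambda>\<tau>. Y \<mu> (s \<tau>) j) has_real_derivative
    u1 * h1 n l (Y \<mu> (s t)) j + u2 * h2 n (Y \<mu> (s t)) j) (at t within S)"
proof -
  define y where "y \<tau> = Y \<mu> (s \<tau>)" for \<tau>
  define e where "e j = u1 * h1 n l (y t) j + u2 * h2 n (y t) j" for j
  have U: "y \<tau> \<in> U" for \<tau>
    using Y_in_U[OF \<mu>] by (simp add: y_def)
  have "\<exists>d. 1 \<le> j \<longrightarrow> j \<le> n \<longrightarrow> ((\<lambda>\<tau>. y \<tau> j) has_real_derivative d) (at t within S)" for j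
  proof (cases "2 \<le> j \<and> j \<le> n")
    case True
    have "\<exists>s'. \<forall>i\<in>{2..n}. ((\<lambda>\<tau>. s \<tau> i) has_real_derivative s' i) (at t within S)"
    proof (intro exI ballI)
      fix i assume "i \<in> {2..n}"
      then show "((\<lambda>\<tau>. s \<tau> i) has_real_derivative
          (if i < n then u1 * s t (i + 1) else u1 * Fp (Y \<mu> (s t)) + u2 * Fq (Y \<mu> (s t)))) (at t within S)"
        using s[of "i - 1"] by (auto split: if_splits)
    qed
    then obtain s' where s': "\<And>i. i \<in> {2..n} \<Longrightarrow> ((\<lambda>\<tau>. s \<tau> i) has_real_derivative s' i) (at t within S)"
      by blast
    have "((\<lambda>\<tau>. Y \<mu> (s \<tau>) j) has_real_derivative (\<Sum>i\<in>{2..n}. pd i (\<lambda>s. Y \<mu> s j) (s t) * s' i)) (at t within S)"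
      by (rule smooth_chain[OF _ Y_smooth[OF \<mu>]]) (use True s' in auto)
    then show ?thesis
      unfolding y_def by blast
  next
    case False
    then show ?thesis
      using s[of 0] n Y_1 by (cases "j = 1") (auto simp: y_def Suc_le_eq not_le)
  qed
  then obtain d where d: "\<And>j. 1 \<le> j \<Longrightarrow> j \<le> n \<Longrightarrow> ((\<lambda>\<tau>. y \<tau> j) has_real_derivative d j) (at t within S)"
    by metis
  have Lfy: "Lf k (y \<tau>) = s \<tau> (k + 1)" if "k < n" for k \<tau>
    unfolding y_def by (rule Lf_Y[OF \<mu> that])
  \<comment> \<open>The actual derivatives d and the desired ones e give the same derivative of
    s_{k+1}: for d by the chain rule and uniqueness of the derivative, for e by the Lie derivative
    identity.\<close>
  have sum0: "(\<Sum>j=1..n. partial j (Lf k) (y t) * (d j - e j)) = 0" if k: "k < n" for k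
  proof -
    have "((\<lambda>\<tau>. s \<tau> (k + 1)) has_real_derivative (\<Sum>j=1..n. partial j (Lf k) (y t) * d j)) (at t within S)"
      using Lf_chain[OF k U t d] by (simp only: Lfy[OF k])
    then have "(\<Sum>j=1..n. partial j (Lf k) (y t) * d j) =
      (if k + 1 < n then u1 * s t (k + 2) else u1 * Fp (y t) + u2 * Fq (y t))"
      using s[OF k] unfolding y_def[symmetric] has_real_derivative_iff_has_vector_derivative
      by (intro trans[OF vector_derivative_within[OF nontriv, symmetric] vector_derivative_within[OF nontriv]])
    moreover have "(\<Sum>j=1..n. partial j (Lf k) (y t) * e j) =
      (if k + 1 < n then u1 * s t (k + 2) else u1 * Fp (y t) + u2 * Fq (y t))"
    proof -
      have "(\<Sum>j=1..n. partial j (Lf k) (y t) * e j) = u1 * Lf (Suc k) (y t) + u2 * lie n (h2 n) (Lf k) (y t)"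
        by (simp add: e_def Lf_Suc lie_def sum.distrib sum_distrib_left algebra_simps)
      also have "\<dots> = (if k + 1 < n then u1 * s t (k + 2) else u1 * Fp (y t) + u2 * Fq (y t))"
      proof (cases "k + 1 < n")
        case True
        then show ?thesis
          using partial_Lf_outside[OF k U, of n t] Lfy[of "k + 1" t] by (simp add: lie_h2)
      next
        case False
        have "Lf (Suc k) = Lf n" "Lf (n - 1) = Lf k"
          by (rule arg_cong[where f = Lf]; use k False in simp)+
        then show ?thesis
          using False by (simp only: lie_h2 Fp_def Fq_def if_False)
      qed
      finally show ?thesis .
    qed
    ultimately show ?thesis
      by (simp add: right_diff_distrib sum_subtractf)
  qed
  have "k < n \<Longrightarrow> d (k + 1) = e (k + 1)" for k
  proof (induction k rule: less_induct)
    case (less k)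
    have "partial j (Lf k) (y t) * (d j - e j) = 0" if "j \<in> {1..n} - {k + 1}" for j
    proof (cases "j > k + 1")
      case True
      then show ?thesis
        using partial_Lf_outside[OF less.prems U True, of t] by simp
    next
      case False
      then have "j - 1 < k" "j - 1 + 1 = j" using that by auto
      then show ?thesis
        using less.IH[of "j - 1"] less.prems by simp
    qed
    then have "(\<Sum>j\<in>{1..n} - {k + 1}. partial j (Lf k) (y t) * (d j - e j)) = 0"
      by (intro sum.neutral) blast
    then have "partial (k + 1) (Lf k) (y t) * (d (k + 1) - e (k + 1)) = 0"
      using sum0[OF less.prems] less.prems
        sum.remove[of "{1..n}" "k + 1" "\<lambda>j. partial j (Lf k) (y t) * (d j - e j)"]
      by (simp only: finite_atLeastAtMost) simp
    then show ?case
      using partial_Lf_diag[OF less.prems U, of t] by simp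
  qed
  from this[of "j - 1"] have "d j = e j"
    using j by simp
  then show ?thesis
    using d[OF j] by (simp add: y_def e_def)
qed

end

section \<open>The configuration manifold\<close>

text \<open>The angle is arcsin(Im z) on the right half circle and its reflection pi - arcsin(Im z)
  on the left one.\<close>

lemma circle_angle:
  assumes z: "norm z = 1" "Re z \<noteq> 0"
  defines "m \<equiv> (if Re z > 0 then 0 else 1 :: nat)"
  shows "\<exists>\<phi>. z = cis \<phi> \<and> real m * pi - pi/2 < \<phi> \<and> \<phi> < real m * pi + pi/2"
proof -
  have sq: "(Re z)\<^sup>2 + (Im z)\<^sup>2 = 1"
    using z(1) by (simp add: cmod_def)
  have "(Re z)\<^sup>2 > 0"
    using z(2) by simp
  then have "(Im z)\<^sup>2 < 1"
    using sq by linarith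
  then have im: "-1 < Im z" "Im z < 1"
    unfolding abs_square_less_1 by auto
  define b where "b = arcsin (Im z)"
  have b: "-(pi/2) < b" "b < pi/2"
    using arcsin_lt_bounded[OF im] by (auto simp: b_def)
  have sb: "sin b = Im z"
    using im by (simp add: b_def)
  have "cos b = sqrt ((Re z)\<^sup>2)"
    using im cos_arcsin[of "Im z"] by (simp add: b_def flip: sq)
  then have cb: "cos b = \<bar>Re z\<bar>" by simp
  show ?thesis
  proof (cases "Re z > 0")
    case True
    then show ?thesis
      using b sb cb by (intro exI[of _ b]) (auto simp: m_def complex_eq_iff)
  next
    case False
    then show ?thesis
      using b sb cb z(2) by (intro exI[of _ "pi - b"]) (auto simp: m_def complex_eq_iff)
  qed
qed

lemma K_set_eq_image:
  assumes n: "n \<ge> 1"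
  shows "K_set n = to_Q n ` (\<Union>\<mu>\<in>modes n. M_cell n \<mu>)"
proof
  \<comment> \<open>Only \<open>cell_subset_U\<close> is used, and it does not involve the lengths,
    so any positive value serves.\<close>
  interpret truck n "\<lambda>_. 1"
    by unfold_locales (use n in auto)
  show "to_Q n ` (\<Union>\<mu>\<in>modes n. M_cell n \<mu>) \<subseteq> K_set n"
  proof
    fix p assume "p \<in> to_Q n ` (\<Union>\<mu>\<in>modes n. M_cell n \<mu>)"
    then obtain \<mu> x y where p: "p = to_Q n (x, y)" and "\<mu> \<in> modes n" "(x, y) \<in> M_cell n \<mu>"
      by auto
    then have "\<And>i. i \<in> {2..n} \<Longrightarrow> cos (y i) \<noteq> 0"
      using cell_subset_U unfolding M_cell_def U_def by blast
    then show "p \<in> K_set n"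
      by (simp add: p to_Q_def K_set_def Q_topology_def)
  qed
  show "K_set n \<subseteq> to_Q n ` (\<Union>\<mu>\<in>modes n. M_cell n \<mu>)"
  proof
    fix q assume q: "q \<in> K_set n"
    obtain x y1 \<theta> where q_eq: "q = (x, y1, \<theta>)" by (cases q)
    have \<theta>: "\<theta> \<in> {2..n} \<rightarrow>\<^sub>E sphere 0 1" "\<And>i. i \<in> {2..n} \<Longrightarrow> Re (\<theta> i) \<noteq> 0"
      using q unfolding q_eq K_set_def Q_topology_def by auto
    define \<mu> where "\<mu> = (\<lambda>i\<in>{1..n-1}. if Re (\<theta> (i + 1)) > 0 then 0 else 1 :: nat)"
    have "\<exists>\<phi>. i \<in> {2..n} \<longrightarrow> \<theta> i = cis \<phi> \<and> real (\<mu> (i - 1)) * pi - pi/2 < \<phi> \<and> \<phi> < real (\<mu> (i - 1)) * pi + pi/2" for i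
    proof (cases "i \<in> {2..n}")
      case True
      then obtain k where k: "i = k + 1" "1 \<le> k" "k < n" by (cases i) auto
      have "norm (\<theta> i) = 1"
        using \<theta>(1) True by (auto simp: PiE_iff)
      moreover have "k \<le> n - 1"
        using k by linarith
      then have "\<mu> (i - 1) = (if Re (\<theta> i) > 0 then 0 else 1)"
        using k by (simp add: \<mu>_def)
      ultimately show ?thesis
        using circle_angle[of "\<theta> i"] \<theta>(2)[OF True] by simp
    qed auto
    then obtain f where f: "\<And>i. i \<in> {2..n} \<Longrightarrow> \<theta> i = cis (f i) \<and>
        real (\<mu> (i - 1)) * pi - pi/2 < f i \<and> f i < real (\<mu> (i - 1)) * pi + pi/2"
      by metis
    define y where "y = (\<lambda>i\<in>{1..n}. if i = 1 then y1 else f i)"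
    have "y \<in> cell n \<mu>"
      using f by (auto simp: cell_def y_def)
    moreover have "\<mu> \<in> modes n"
      by (auto simp: modes_def \<mu>_def)
    moreover have "to_Q n (x, y) = q"
    proof -
      have "(\<lambda>i\<in>{2..n}. cis (y i)) = \<theta>"
        using f \<theta>(1) by (intro ext) (auto simp: y_def PiE_iff extensional_def)
      then show ?thesis
        using n by (simp add: to_Q_def q_eq y_def)
    qed
    ultimately show "q \<in> to_Q n ` (\<Union>\<mu>\<in>modes n. M_cell n \<mu>)"
      unfolding M_cell_def by (intro image_eqI[of _ _ "(x, y)"]) auto
  qed
qed

text \<open>At a point with cos \<phi> = 0, turning by a small h > 0 gives real part -sin \<phi> sin
  h, which is nonzero. Such points converge to the given one.\<close>

lemma circle_dense: "top_of_set (sphere 0 1) closure_of {z \<in> sphere 0 1. Re z \<noteq> 0} = sphere (0::complex) 1"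
proof -
  have "z \<in> closure {z \<in> sphere 0 1. Re z \<noteq> 0}" if z: "z \<in> sphere 0 1" for z :: complex
  proof (cases "Re z = 0")
    case False
    then show ?thesis
      by (intro subsetD[OF closure_subset]) (use z in auto)
  next
    case True
    have "norm z = 1"
      using z by simp
    then have "z \<noteq> 0" "sgn z = z"
      by (auto simp only: sgn_div_norm inverse_1 scaleR_one norm_zero zero_neq_one)
    then have "z = cis (Arg z)"
      using cis_Arg[of z] by argo
    then obtain \<phi> where \<phi>: "z = cis \<phi>" ..
    have c: "cos \<phi> = 0" using True unfolding \<phi> by simp
    then have s: "sin \<phi> \<noteq> 0"
      using sin_cos_squared_add[of \<phi>] by auto
    define x where "x k = cis (\<phi> + inverse (real (Suc k)))" for k
    have "x k \<in> {z \<in> sphere 0 1. Re z \<noteq> 0}" for k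
    proof -
      have "0 < inverse (real (Suc k))" "inverse (real (Suc k)) < pi"
        using pi_gt3 le_imp_inverse_le[of 1 "real (Suc k)"] by simp_all
      then have "sin (inverse (real (Suc k))) > 0"
        by (rule sin_gt_zero)
      then show ?thesis
        using c s by (simp add: x_def cos_add)
    qed
    moreover have "x \<longlonglongrightarrow> z"
    proof -
      have "(\<lambda>k. \<phi> + inverse (real (Suc k))) \<longlonglongrightarrow> \<phi> + 0"
        by (intro tendsto_intros LIMSEQ_inverse_real_of_nat)
      then show ?thesis
        unfolding x_def \<phi> by (simp add: tendsto_cis)
    qed
    ultimately show ?thesis
      unfolding closure_sequential by blast
  qed
  moreover have "sphere 0 1 \<inter> {z \<in> sphere 0 1. Re z \<noteq> 0} = {z \<in> sphere 0 1. Re z \<noteq> 0}"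
    by auto
  ultimately show ?thesis
    unfolding closure_of_subtopology by auto
qed

text \<open>The closure of a product is the product of the closures, so density reduces to a single
  circle.\<close>

lemma K_set_dense: "Q_topology n closure_of K_set n = topspace (Q_topology n)"
proof -
  have "K_set n = UNIV \<times> UNIV \<times> ({2..n} \<rightarrow>\<^sub>E {z \<in> sphere 0 1. Re z \<noteq> 0})"
    by (auto simp: K_set_def Q_topology_def PiE_iff extensional_def)
  then show ?thesis
    by (simp only: Q_topology_def closure_of_Times closure_of_product_topology circle_dense) simp
qed

lemma mode_of_eq:
  assumes n: "n \<ge> 1" and \<mu>: "\<mu> \<in> modes n" and q: "q \<in> M_cell n \<mu>"
  shows "mode_of n q = \<mu>"
  unfolding mode_of_def
proof (rule the_equality)
  fix \<mu>' assume \<mu>': "\<mu>' \<in> modes n \<and> q \<in> M_cell n \<mu>'"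
  have "\<mu>' i = \<mu> i" for i
  proof (cases "i \<in> {1..n-1}")
    case True
    then have "i + 1 \<in> {2..n}" by auto
    have "\<forall>j\<in>{2..n}. real (\<nu> (j - 1)) * pi - pi/2 < snd q j \<and> snd q j < real (\<nu> (j - 1)) * pi + pi/2"
      if "q \<in> M_cell n \<nu>" for \<nu>
      using that unfolding M_cell_def cell_def by (simp add: mem_Times_iff)
    from bspec[OF this[OF q] \<open>i + 1 \<in> {2..n}\<close>] bspec[OF this[OF conjunct2[OF \<mu>']] \<open>i + 1 \<in> {2..n}\<close>]
    have "real (\<mu> i) * pi - pi/2 < snd q (i + 1)" "snd q (i + 1) < real (\<mu> i) * pi + pi/2"
      "real (\<mu>' i) * pi - pi/2 < snd q (i + 1)" "snd q (i + 1) < real (\<mu>' i) * pi + pi/2"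
      by simp_all
    moreover have "\<mu> i \<in> {0, 1}" "\<mu>' i \<in> {0, 1}"
      using True \<mu> \<mu>' unfolding modes_def by (auto simp: PiE_iff)
    ultimately show ?thesis by auto
  next
    case False
    then show ?thesis
      using \<mu> \<mu>' unfolding modes_def by (auto simp: PiE_iff extensional_def)
  qed
  then show "\<mu>' = \<mu>" by blast
qed (use \<mu> q in auto)

section \<open>The closed loop\<close>

locale closed_loop = truck n l + reference n \<epsilon> xD + backstepping n \<gamma> \<epsilon> \<delta>
  for n l \<epsilon> xD \<gamma> \<delta> +
  fixes \<mu> :: "nat \<Rightarrow> nat"
  assumes \<mu>: "\<mu> \<in> modes n"
begin

abbreviation sD :: "real \<Rightarrow> nat \<Rightarrow> real" where "sD t i \<equiv> s_ref \<epsilon> xD i t"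

text \<open>The default 0 makes every coordinate continuous, as \<open>error_system\<close> asks for
  all indices.\<close>

definition aD :: "real \<Rightarrow> nat \<Rightarrow> real" where
  "aD t j = (if 1 \<le> j \<and> j \<le> n + 1 then sD t j else 0)"

text \<open>The notion \<open>error_solution\<close> for this reference, stated without the
  constants \<nu>0, \<nu>1, R that the locale would require to be fixed.\<close>

definition err :: "real set \<Rightarrow> (real \<Rightarrow> nat \<Rightarrow> real) \<Rightarrow> bool" where
  "err S z \<longleftrightarrow> (\<forall>t\<in>S. \<forall>k. 1 \<le> k \<longrightarrow> k \<le> n + 2 \<longrightarrow>
     ((\<lambda>s. z s k) has_real_derivative \<bar>v t\<bar> * rhs (aD t) (z t) k) (at t within S))"

lemma \<epsilon>_v: "\<epsilon> * \<bar>v t\<bar> = v t" "\<bar>v t\<bar> * \<epsilon> = v t"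
  using v_eq_abs(1)[of t] by (simp_all add: mult.commute)

lemma abs_v_mult:
  "\<bar>v t\<bar> * (- \<epsilon> * c + d) = \<bar>v t\<bar> * d - v t * c" "\<bar>v t\<bar> * (d - \<epsilon> * c) = \<bar>v t\<bar> * d - v t * c"
proof -
  have "\<bar>v t\<bar> * (- \<epsilon> * c + d) = \<bar>v t\<bar> * d - (\<bar>v t\<bar> * \<epsilon>) * c" "\<bar>v t\<bar> * (d - \<epsilon> * c) = \<bar>v t\<bar> * d - (\<bar>v t\<bar> * \<epsilon>) * c"
    by (simp_all add: algebra_simps)
  then show "\<bar>v t\<bar> * (- \<epsilon> * c + d) = \<bar>v t\<bar> * d - v t * c" "\<bar>v t\<bar> * (d - \<epsilon> * c) = \<bar>v t\<bar> * d - v t * c"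
    unfolding \<epsilon>_v(2) .
qed

lemma xD_deriv:
  assumes t: "t \<ge> 0"
  shows "((\<lambda>\<tau>. xD \<tau> $ 1) has_real_derivative v t * cos (sD t 1)) (at t within {0..})"
    and "((\<lambda>\<tau>. xD \<tau> $ 2) has_real_derivative v t * sin (sD t 1)) (at t within {0..})"
proof -
  have X0: "X 0 = xD" by (simp add: X_def)
  have "((\<lambda>\<tau>. X 0 \<tau> $ c) has_real_derivative X 1 t $ c) (at t within {0..})" for c
    using X_deriv[of 0 t c] t by simp
  from this[of 1] this[of 2]
  show "((\<lambda>\<tau>. xD \<tau> $ 1) has_real_derivative v t * cos (sD t 1)) (at t within {0..})"
    "((\<lambda>\<tau>. xD \<tau> $ 2) has_real_derivative v t * sin (sD t 1)) (at t within {0..})"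
    unfolding s1_ref_cos[OF t] s1_ref_sin[OF t] s_ref_1 X0 .
qed

lemma speed_upper: obtains c where "\<And>t. t \<ge> 0 \<Longrightarrow> \<bar>v t\<bar> \<le> c"
  using X_bounded[of 1] unfolding v_abs by auto

lemma error_system_ex:
  "\<exists>\<nu>0 \<nu>1 R. error_system n \<gamma> \<epsilon> \<delta> (\<lambda>t. \<bar>v t\<bar>) aD \<nu>0 \<nu>1 R"
proof -
  obtain \<nu>0 where \<nu>0: "\<nu>0 > 0" "\<And>t. t \<ge> 0 \<Longrightarrow> \<nu>0 \<le> \<bar>v t\<bar>"
    using speed_bound v_abs by metis
  obtain \<nu>1 where \<nu>1: "\<And>t. t \<ge> 0 \<Longrightarrow> \<bar>v t\<bar> \<le> \<nu>1"
    using speed_upper by blast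
  obtain R where R: "\<And>i t. 2 \<le> i \<Longrightarrow> i \<le> n + 1 \<Longrightarrow> t \<ge> 0 \<Longrightarrow> \<bar>s_ref \<epsilon> xD i t\<bar> \<le> R"
    using s_ref_bounded by blast
  have "error_system n \<gamma> \<epsilon> \<delta> (\<lambda>t. \<bar>v t\<bar>) aD \<nu>0 \<nu>1 R"
  proof unfold_locales
    show "continuous_on {0..} (\<lambda>t. \<bar>v t\<bar>)"
      by (intro continuous_on_rabs v_cont)
    show "continuous_on {0..} (\<lambda>t. aD t j)" for j
    proof (cases "1 \<le> j \<and> j \<le> n + 1")
      case True
      then show ?thesis
        using s_ref_cont[of j] by (simp add: aD_def)
    next
      case False
      then have "(\<lambda>t. aD t j) = (\<lambda>t. 0)"
        by (auto simp: aD_def)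
      then show ?thesis
        by (metis continuous_on_const)
    qed
    show "\<bar>aD t j\<bar> \<le> R" if "2 \<le> j" "j \<le> n + 1" "t \<ge> 0" for j t
      using R[OF that] that by (simp add: aD_def)
    show "((\<lambda>t. aD t j) has_real_derivative \<bar>v t\<bar> * (\<epsilon> * aD t (j + 1))) (at t within {0..})"
      if "1 \<le> j" "j \<le> n" "t \<ge> 0" for j t
      using s_ref_deriv[OF that] that \<epsilon>_v(2)[of t] by (simp add: aD_def flip: mult.assoc)
  qed (use \<nu>0 \<nu>1 in auto)
  then show ?thesis by blast
qed

text \<open>The tracking error in flat storage: \<sigma>_j sits at index j + 2, and the j-th
  component of S is \<open>Lf (j - 1)\<close>, whence the two offsets.\<close>

definition Z :: "real \<Rightarrow> coords \<Rightarrow> nat \<Rightarrow> real" where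
  "Z t q k = (if k = 1 then fst q $ 1 - xD t $ 1 else if k = 2 then fst q $ 2 - xD t $ 2
     else Lf (k - 3) (snd q) - sD t (k - 2))"

text \<open>Together with \<open>ctrl2\<close>, the inputs v_1 and v_2 of the chained form, that is,
  the control law before F(y)^{-1} is applied.\<close>

definition ctrl1 :: "real \<Rightarrow> (nat \<Rightarrow> real) \<Rightarrow> real" where
  "ctrl1 t z = \<bar>v t\<bar> * lam \<gamma> \<epsilon> (aD t) z"

definition ctrl2 :: "real \<Rightarrow> (nat \<Rightarrow> real) \<Rightarrow> real" where
  "ctrl2 t z = \<bar>v t\<bar> * alpha n \<gamma> \<delta> \<epsilon> n (aD t) z + v t * sD t (n + 1)"

lemma lam_local:
  assumes "z 1 = z' 1" "z 2 = z' 2" "a 1 = a' 1"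
  shows "lam \<gamma> \<epsilon> a z = lam \<gamma> \<epsilon> a' z'"
proof (rule smooth_az_local[OF smooth_az_lam[OF w]])
  fix j :: nat assume "1 \<le> j" "j \<le> 2"
  then have "j = 1 \<or> j = 2" by auto
  then show "z j = z' j" using assms by auto
qed (use assms in auto)

lemma ctrl_local:
  assumes "\<And>k. 1 \<le> k \<Longrightarrow> k \<le> n + 2 \<Longrightarrow> z k = z' k"
  shows "ctrl1 t z = ctrl1 t z'" "ctrl2 t z = ctrl2 t z'"
proof -
  have "lam \<gamma> \<epsilon> (aD t) z = lam \<gamma> \<epsilon> (aD t) z'"
    by (rule lam_local) (use assms in auto)
  then show "ctrl1 t z = ctrl1 t z'" by (simp add: ctrl1_def)
  have "alpha n \<gamma> \<delta> \<epsilon> n (aD t) z = alpha n \<gamma> \<delta> \<epsilon> n (aD t) z'"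
    by (rule smooth_az_local[OF smooth_az_alpha]) (use assms in auto)
  then show "ctrl2 t z = ctrl2 t z'" by (simp add: ctrl2_def)
qed

lemma y_ref_eq: "y_ref n l \<epsilon> \<mu> xD t = Y \<mu> (sD t)"
  unfolding y_ref_def by (rule inv_into_S_map[OF \<mu>])

lemma u_ref_eq:
  assumes "t \<ge> 0"
  shows "u_ref n l \<epsilon> \<mu> xD t =
    vector [v t, (v t * sD t (n + 1) - Fp (Y \<mu> (sD t)) * v t) / Fq (Y \<mu> (sD t))]"
  unfolding u_ref_def y_ref_eq F_mat_inv[OF Y_in_U[OF \<mu>]] using v_ref_eq[OF assms] by simp

text \<open>On the reference side F(y^D) u^D gives back v^D, so \<Psi> sees only quantities of the
  chained form. Membership in the cell selects the mode used by the law.\<close>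

lemma U_law_eq:
  assumes t: "t \<ge> 0" and q: "q \<in> M_cell n \<mu>"
  shows "U_law n l \<gamma> \<delta> \<epsilon> t q xD =
    vector [ctrl1 t (Z t q), (ctrl2 t (Z t q) - Fp (snd q) * ctrl1 t (Z t q)) / Fq (snd q)]"
proof -
  obtain x y where q_eq: "q = (x, y)" by (cases q)
  have y: "y \<in> cell n \<mu>" using q by (simp add: q_eq M_cell_def)
  then have yU: "y \<in> U" using cell_subset_U[OF \<mu>] by blast
  define yD where "yD = Y \<mu> (sD t)"
  have yDU: "yD \<in> U" unfolding yD_def by (rule Y_in_U[OF \<mu>])
  define uD where "uD = u_ref n l \<epsilon> \<mu> xD t"
  have uD: "uD $ 1 = v t" "F_mat n l yD *v uD = vector [v t, v t * sD t (n + 1)]"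
    "F2_mat n l yD *v uD = vector [0, v t * sD t (n + 1)]"
    using Fq_nonzero[OF yDU]
    unfolding F_mat_mult F2_mat_mult by (simp_all add: uD_def u_ref_eq[OF t] yD_def)
  have vt: "v t \<noteq> 0" by (rule v_nonzero[OF t])
  have sgn: "sgn (v t) = \<epsilon>"
    using X_1_nonzero[OF t] \<epsilon> by (auto simp: v_eq sgn_mult)
  have S_yD: "S_map n l yD i = sD t i" if "1 \<le> i" "i \<le> n" for i
    using Lf_Y[OF \<mu>, of "i - 1" "sD t"] that by (simp add: S_map_eq yD_def)
  have S_y: "S_map n l y i = Lf (i - 1) y" if "1 \<le> i" "i \<le> n" for i
    using that by (simp add: S_map_eq)
  define z where "z = (\<lambda>k. if k = 1 then (x - xD t) $ 1 else if k = 2 then (x - xD t) $ 2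
    else S_map n l y (k - 2) - S_map n l yD (k - 2))"
  \<comment> \<open>The last entry v_2^D / v_1^D equals s_{n+1}^D, because v_2^D = v_1^D s_{n+1}^D
    and v_1^D does not vanish.\<close>
  define a where "a = (\<lambda>i. if i \<le> n then S_map n l yD i else v t * sD t (n + 1) / v t)"
  have Psi: "Psi n \<gamma> \<delta> (x - xD t) (\<lambda>i. S_map n l y i - S_map n l yD i) (S_map n l yD) (F_mat n l yD *v uD) =
    vector [lam \<gamma> \<epsilon> a z, alpha n \<gamma> \<delta> \<epsilon> n a z]"
    unfolding Psi_def uD(2) Let_def vector_2 sgn z_def a_def ..
  have zk: "z k = Z t q k" if "1 \<le> k" "k \<le> n + 2" for k
    using S_y[of "k - 2"] S_yD[of "k - 2"] that
    by (cases "k = 1 \<or> k = 2") (auto simp: z_def Z_def q_eq numeral_3_eq_3)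
  have ak: "a j = aD t j" if "1 \<le> j" "j \<le> n + 1" for j
  proof (cases "j \<le> n")
    case True
    then show ?thesis
      using S_yD[of j] that by (simp add: a_def aD_def)
  next
    case False
    then have "j = n + 1" using that by simp
    then show ?thesis
      using vt by (simp add: a_def aD_def)
  qed
  have lam: "lam \<gamma> \<epsilon> a z = lam \<gamma> \<epsilon> (aD t) (Z t q)"
    by (rule lam_local) (use zk ak in auto)
  have alpha: "alpha n \<gamma> \<delta> \<epsilon> n a z = alpha n \<gamma> \<delta> \<epsilon> n (aD t) (Z t q)"
    by (rule smooth_az_local[OF smooth_az_alpha]) (use zk ak in auto)
  have "U_law n l \<gamma> \<delta> \<epsilon> t q xD = matrix_inv (F_mat n l y) *v
      (\<bar>v t\<bar> *\<^sub>R vector [lam \<gamma> \<epsilon> (aD t) (Z t q), alpha n \<gamma> \<delta> \<epsilon> n (aD t) (Z t q)] + vector [0, v t * sD t (n + 1)])"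
    unfolding U_law_def q_eq
    unfolding mode_of_eq[OF n \<mu> q, unfolded q_eq] maneuver_def Phi_def y_ref_eq
    unfolding prod.case yD_def[symmetric] uD_def[symmetric] Psi uD(1,3) lam[unfolded q_eq] alpha[unfolded q_eq] ..
  also have "\<dots> = vector [ctrl1 t (Z t q), (ctrl2 t (Z t q) - Fp y * ctrl1 t (Z t q)) / Fq y]"
    unfolding F_mat_inv[OF yU] by (simp add: ctrl1_def ctrl2_def)
  finally show ?thesis by (simp add: q_eq)
qed

text \<open>Subtract the chained equations of the reference from those of the closed loop; the
  relation |v| \<epsilon> = v matches the result with \<open>rhs\<close>.\<close>

lemma err_of_solution:
  assumes sol: "closed_loop_solution n l \<gamma> \<delta> \<epsilon> xD I q" and I: "I \<subseteq> {0..}"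
    and cell: "\<And>t. t \<in> I \<Longrightarrow> q t \<in> M_cell n \<mu>"
  shows "err I (\<lambda>t. Z t (q t))"
  unfolding err_def
proof (intro ballI allI impI)
  fix t k assume t: "t \<in> I" and k: "1 \<le> k" "k \<le> n + 2"
  have t0: "t \<ge> 0" using t I by auto
  define y where "y = (\<lambda>\<tau>. snd (q \<tau>))"
  define z where "z = Z t (q t)"
  define u where "u = U_law n l \<gamma> \<delta> \<epsilon> t (q t) xD"
  have yU: "y \<tau> \<in> U" if "\<tau> \<in> I" for \<tau>
    using cell[OF that] cell_subset_U[OF \<mu>] by (auto simp: y_def M_cell_def mem_Times_iff)
  have q0: "Fq (y t) \<noteq> 0" by (rule Fq_nonzero[OF yU[OF t]])
  have u: "u $ 1 = ctrl1 t z" "u $ 1 * Fp (y t) + u $ 2 * Fq (y t) = ctrl2 t z"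
    using q0 unfolding u_def U_law_eq[OF t0 cell[OF t]] by (simp_all add: z_def y_def)
  have s: "((\<lambda>\<tau>. fst (q \<tau>) $ 1) has_real_derivative u $ 1 * cos (y t 1)) (at t within I)"
      "((\<lambda>\<tau>. fst (q \<tau>) $ 2) has_real_derivative u $ 1 * sin (y t 1)) (at t within I)"
      "\<And>i. i \<in> {1..n-1} \<Longrightarrow> ((\<lambda>\<tau>. y \<tau> i) has_real_derivative u $ 1 * eta l i (y t)) (at t within I)"
      "((\<lambda>\<tau>. y \<tau> n) has_real_derivative u $ 2) (at t within I)"
    using sol t unfolding closed_loop_solution_def Let_def u_def y_def by blast+
  have xD: "((\<lambda>\<tau>. xD \<tau> $ 1) has_real_derivative v t * cos (sD t 1)) (at t within I)"
    "((\<lambda>\<tau>. xD \<tau> $ 2) has_real_derivative v t * sin (sD t 1)) (at t within I)"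
    by (rule DERIV_subset[OF xD_deriv(1)[OF t0] I], rule DERIV_subset[OF xD_deriv(2)[OF t0] I])
  have a1: "aD t 1 = sD t 1" and z3: "aD t 1 + z 3 = y t 1"
    using n by (simp_all add: aD_def z_def Z_def y_def Lf_0)
  have y_deriv: "((\<lambda>\<tau>. y \<tau> j) has_real_derivative u $ 1 * h1 n l (y t) j + u $ 2 * h2 n (y t) j) (at t within I)"
    if j: "1 \<le> j" "j \<le> n" for j
  proof (cases "j = n")
    case True
    then show ?thesis using s(4) by (simp add: h1_def h2_def)
  next
    case False
    then have "j \<in> {1..n-1}" using j by auto
    from s(3)[OF this] show ?thesis
      using False j by (simp add: h1_def h2_def)
  qed
  show "((\<lambda>\<tau>. Z \<tau> (q \<tau>) k) has_real_derivative \<bar>v t\<bar> * rhs (aD t) (Z t (q t)) k) (at t within I)"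
    unfolding z_def[symmetric]
  proof -
    have "k = 1 \<or> k = 2 \<or> (\<exists>j. 1 \<le> j \<and> j \<le> n \<and> k = j + 2)"
      using k by presburger
    then consider "k = 1" | "k = 2" | j where "1 \<le> j" "j \<le> n" "k = j + 2"
      by blast
    then show "((\<lambda>\<tau>. Z \<tau> (q \<tau>) k) has_real_derivative \<bar>v t\<bar> * rhs (aD t) z k) (at t within I)"
    proof cases
      case 1
      have "((\<lambda>\<tau>. fst (q \<tau>) $ 1 - xD \<tau> $ 1) has_real_derivative
          u $ 1 * cos (y t 1) - v t * cos (sD t 1)) (at t within I)"
        by (intro DERIV_diff s xD)
      moreover have "u $ 1 * cos (y t 1) - v t * cos (sD t 1) = \<bar>v t\<bar> * rhs (aD t) z 1"
        unfolding rhs_xi abs_v_mult z3 unfolding u ctrl1_def a1 by (simp only: mult.assoc)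
      ultimately show ?thesis
        by (simp add: 1 Z_def)
    next
      case 2
      have "((\<lambda>\<tau>. fst (q \<tau>) $ 2 - xD \<tau> $ 2) has_real_derivative
          u $ 1 * sin (y t 1) - v t * sin (sD t 1)) (at t within I)"
        by (intro DERIV_diff s xD)
      moreover have "u $ 1 * sin (y t 1) - v t * sin (sD t 1) = \<bar>v t\<bar> * rhs (aD t) z 2"
        unfolding rhs_xi abs_v_mult z3 unfolding u ctrl1_def a1 by (simp only: mult.assoc)
      ultimately show ?thesis
        by (simp add: 2 Z_def)
    next
      case (3 j)
      have j: "j - 1 < n" "j - 1 + 1 = j" using 3 by auto
      have Zk: "Z \<tau> (q \<tau>) k = Lf (j - 1) (y \<tau>) - sD \<tau> j" for \<tau>
        using 3 by (simp add: Z_def y_def numeral_3_eq_3)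
      have "((\<lambda>\<tau>. Lf (j - 1) (y \<tau>) - sD \<tau> j) has_real_derivative
        (if j - 1 + 1 < n then u $ 1 * Lf (j - 1 + 1) (y t) else u $ 1 * Fp (y t) + u $ 2 * Fq (y t)) -
        v t * sD t (Suc j)) (at t within I)"
        by (intro DERIV_diff chained_of_model[OF yU t y_deriv j(1)] DERIV_subset[OF s_ref_deriv[OF 3(1,2) t0] I])
      moreover have "(if j - 1 + 1 < n then u $ 1 * Lf (j - 1 + 1) (y t) else u $ 1 * Fp (y t) + u $ 2 * Fq (y t)) -
        v t * sD t (Suc j) = \<bar>v t\<bar> * rhs (aD t) z k"
      proof (cases "j < n")
        case True
        have "z (j + 3) + aD t (j + 1) = Lf j (y t)"
          using True 3 by (simp add: aD_def z_def Z_def y_def)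
        moreover have "aD t (j + 1) = sD t (Suc j)"
          using True by (simp add: aD_def)
        ultimately show ?thesis
          unfolding j(2) 3(3) rhs_sigma[OF 3(1) True] u(1) ctrl1_def using True \<epsilon>_v(2)[of t]
          by (simp add: algebra_simps)
      next
        case False
        then have jn: "j = n" using 3 by simp
        have "\<not> j - 1 + 1 < n"
          using jn j(2) by simp
        then show ?thesis
          unfolding 3(3) jn rhs_last by (simp only: jn u(2) ctrl2_def if_False) simp
      qed
      ultimately show ?thesis
        unfolding Zk by (simp only:)
    qed
  qed
qed

section \<open>From error solutions back to closed-loop solutions\<close>

text \<open>The inverse of \<open>Z t\<close> on the cell. Its values lie in the cell for every z,
  so a solution built from an error solution cannot leave the cell.\<close>

definition config_of :: "real \<Rightarrow> (nat \<Rightarrow> real) \<Rightarrow> coords" where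
  "config_of t z = (vector [xD t $ 1 + z 1, xD t $ 2 + z 2], Y \<mu> (\<lambda>i. sD t i + z (i + 2)))"

lemma config_of_cell: "config_of t z \<in> M_cell n \<mu>"
  using Y_in_cell[OF \<mu>] by (simp add: config_of_def M_cell_def)

lemma Z_config_of:
  assumes "1 \<le> k" "k \<le> n + 2"
  shows "Z t (config_of t z) k = z k"
proof -
  have "k = 1 \<or> k = 2 \<or> (\<exists>j. j < n \<and> k = j + 3)"
    using assms by presburger
  then consider "k = 1" | "k = 2" | j where "j < n" "k = j + 3"
    by blast
  then show ?thesis
  proof cases
    case (3 j)
    then show ?thesis
      using Lf_Y[OF \<mu> 3(1), of "\<lambda>i. sD t i + z (i + 2)"] by (simp add: Z_def config_of_def numeral_3_eq_3)
  qed (simp_all add: Z_def config_of_def)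
qed

lemma config_of_Z:
  assumes q: "q \<in> M_cell n \<mu>" and z: "\<And>k. 1 \<le> k \<Longrightarrow> k \<le> n + 2 \<Longrightarrow> z k = Z t q k"
  shows "config_of t z = q"
proof -
  have "Y \<mu> (\<lambda>i. sD t i + z (i + 2)) = Y \<mu> (\<lambda>i. Lf (i - 1) (snd q))"
  proof (rule Y_local[OF \<mu>])
    fix j assume j: "1 \<le> j" "j \<le> n"
    then show "sD t j + z (j + 2) = Lf (j - 1) (snd q)"
      using z[of "j + 2"] by (simp add: Z_def numeral_3_eq_3)
  qed
  also have "\<dots> = snd q"
    using q by (intro Y_Lf[OF \<mu>]) (auto simp: M_cell_def)
  finally have "snd (config_of t z) = snd q"
    by (simp add: config_of_def)
  moreover have "fst (config_of t z) = fst q"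
    using z[of 1] z[of 2] by (simp add: config_of_def vec_eq_iff forall_2 Z_def)
  ultimately show ?thesis
    by (rule prod_eqI[rotated])
qed

lemma solution_of_err:
  assumes err: "err {0..} z"
  shows "closed_loop_solution n l \<gamma> \<delta> \<epsilon> xD {0..} (\<lambda>t. config_of t (z t))"
  unfolding closed_loop_solution_def
proof (intro ballI conjI)
  fix t :: real assume t: "t \<in> {0..}"
  then have t0: "t \<ge> 0" by simp
  define s where "s = (\<lambda>\<tau> i. sD \<tau> i + z \<tau> (i + 2))"
  define y where "y = Y \<mu> (s t)"
  define u where "u = U_law n l \<gamma> \<delta> \<epsilon> t (config_of t (z t)) xD"
  show "config_of t (z t) \<in> (\<Union>\<mu>\<in>modes n. M_cell n \<mu>)"
    using config_of_cell \<mu> by blast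
  have snd: "snd (config_of \<tau> (z \<tau>)) = Y \<mu> (s \<tau>)" for \<tau>
    by (simp add: config_of_def s_def)
  have y_1: "y 1 = sD t 1 + z t 3"
    unfolding y_def Y_1 by (simp add: s_def numeral_3_eq_3)
  have a1: "aD t 1 = sD t 1" using n by (simp add: aD_def)
  have q0: "Fq y \<noteq> 0" unfolding y_def by (rule Fq_nonzero[OF Y_in_U[OF \<mu>]])
  have c: "ctrl1 t (Z t (config_of t (z t))) = ctrl1 t (z t)" "ctrl2 t (Z t (config_of t (z t))) = ctrl2 t (z t)"
    by (rule ctrl_local; rule Z_config_of; assumption)+
  have u: "u $ 1 = ctrl1 t (z t)" "u $ 1 * Fp y + u $ 2 * Fq y = ctrl2 t (z t)"
    using q0 unfolding u_def U_law_eq[OF t0 config_of_cell] c snd y_def[symmetric] by simp_all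
  have zd: "((\<lambda>\<tau>. z \<tau> k) has_real_derivative \<bar>v t\<bar> * rhs (aD t) (z t) k) (at t within {0..})"
    if "1 \<le> k" "k \<le> n + 2" for k
    using err t that unfolding err_def by blast
  have yd: "((\<lambda>\<tau>. Y \<mu> (s \<tau>) j) has_real_derivative u $ 1 * h1 n l y j + u $ 2 * h2 n y j) (at t within {0..})"
    if "1 \<le> j" "j \<le> n" for j
    unfolding y_def
  proof (rule model_of_chained[OF \<mu> t at_within_atLeast_neq_bot[OF t0] _ that])
    fix k assume k: "k < n"
    have "((\<lambda>\<tau>. s \<tau> (k + 1)) has_real_derivative v t * sD t (Suc (k + 1)) + \<bar>v t\<bar> * rhs (aD t) (z t) (k + 3)) (at t within {0..})"
      using DERIV_add[OF s_ref_deriv[of "k + 1" t] zd[of "k + 3"]] k t0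
      by (simp add: s_def numeral_3_eq_3)
    moreover have "v t * sD t (Suc (k + 1)) + \<bar>v t\<bar> * rhs (aD t) (z t) (k + 3) =
      (if k + 1 < n then u $ 1 * s t (k + 2) else u $ 1 * Fp (Y \<mu> (s t)) + u $ 2 * Fq (Y \<mu> (s t)))"
    proof (cases "k + 1 < n")
      case True
      have "rhs (aD t) (z t) (k + 3) = lam \<gamma> \<epsilon> (aD t) (z t) * (z t (k + 4) + aD t (k + 2)) - \<epsilon> * aD t (k + 2)"
        using rhs_sigma[of "k + 1" "aD t" "z t"] True by (simp add: numeral_eq_Suc)
      moreover have "z t (k + 4) + aD t (k + 2) = s t (k + 2)" "aD t (k + 2) = sD t (Suc (k + 1))"
        using True by (simp_all add: aD_def s_def numeral_eq_Suc)
      ultimately have "\<bar>v t\<bar> * rhs (aD t) (z t) (k + 3) =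
          \<bar>v t\<bar> * (lam \<gamma> \<epsilon> (aD t) (z t) * s t (k + 2)) - v t * sD t (Suc (k + 1))"
        by (simp only: abs_v_mult)
      then show ?thesis
        using True unfolding u(1) ctrl1_def by (simp add: mult.assoc)
    next
      case False
      then have "k + 3 = n + 2" "Suc (k + 1) = n + 1" using k by auto
      then show ?thesis
        using False u(2) unfolding y_def ctrl2_def by (simp only: rhs_last if_False)
    qed
    ultimately show "((\<lambda>\<tau>. s \<tau> (k + 1)) has_real_derivative
      (if k + 1 < n then u $ 1 * s t (k + 2) else u $ 1 * Fp (Y \<mu> (s t)) + u $ 2 * Fq (Y \<mu> (s t)))) (at t within {0..})"
      by (simp only:)
  qed
  have x1: "((\<lambda>\<tau>. fst (config_of \<tau> (z \<tau>)) $ 1) has_real_derivative u $ 1 * cos (y 1)) (at t within {0..})"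
  proof -
    have "((\<lambda>\<tau>. xD \<tau> $ 1 + z \<tau> 1) has_real_derivative v t * cos (sD t 1) + \<bar>v t\<bar> * rhs (aD t) (z t) 1) (at t within {0..})"
      by (intro DERIV_add xD_deriv[OF t0] zd) auto
    moreover have "v t * cos (sD t 1) + \<bar>v t\<bar> * rhs (aD t) (z t) 1 = u $ 1 * cos (y 1)"
      unfolding rhs_xi abs_v_mult u ctrl1_def a1 y_1 by (simp add: mult.assoc)
    ultimately show ?thesis by (simp add: config_of_def)
  qed
  have x2: "((\<lambda>\<tau>. fst (config_of \<tau> (z \<tau>)) $ 2) has_real_derivative u $ 1 * sin (y 1)) (at t within {0..})"
  proof -
    have "((\<lambda>\<tau>. xD \<tau> $ 2 + z \<tau> 2) has_real_derivative v t * sin (sD t 1) + \<bar>v t\<bar> * rhs (aD t) (z t) 2) (at t within {0..})"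
      by (intro DERIV_add xD_deriv[OF t0] zd) auto
    moreover have "v t * sin (sD t 1) + \<bar>v t\<bar> * rhs (aD t) (z t) 2 = u $ 1 * sin (y 1)"
      unfolding rhs_xi abs_v_mult u ctrl1_def a1 y_1 by (simp add: mult.assoc)
    ultimately show ?thesis by (simp add: config_of_def)
  qed
  have yi: "((\<lambda>\<tau>. Y \<mu> (s \<tau>) i) has_real_derivative u $ 1 * eta l i y) (at t within {0..})" if "i \<in> {1..n-1}" for i
  proof -
    have "1 \<le> i" "i < n" using that by auto
    then show ?thesis
      using yd[of i] by (simp add: h1_def h2_def)
  qed
  have yn: "((\<lambda>\<tau>. Y \<mu> (s \<tau>) n) has_real_derivative u $ 2) (at t within {0..})"
    using yd[of n] n by (simp add: h1_def h2_def)
  show "let y = snd (config_of t (z t)); u = U_law n l \<gamma> \<delta> \<epsilon> t (config_of t (z t)) xD in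
         ((\<lambda>\<tau>. fst (config_of \<tau> (z \<tau>)) $ 1) has_real_derivative u $ 1 * cos (y 1)) (at t within {0..}) \<and>
         ((\<lambda>\<tau>. fst (config_of \<tau> (z \<tau>)) $ 2) has_real_derivative u $ 1 * sin (y 1)) (at t within {0..}) \<and>
         (\<forall>i\<in>{1..n-1}. ((\<lambda>\<tau>. snd (config_of \<tau> (z \<tau>)) i) has_real_derivative u $ 1 * eta l i y) (at t within {0..})) \<and>
         ((\<lambda>\<tau>. snd (config_of \<tau> (z \<tau>)) n) has_real_derivative u $ 2) (at t within {0..})"
    unfolding Let_def u_def[symmetric] snd y_def[symmetric] using x1 x2 yi yn by blast
qed

text \<open>Needed for uniqueness, as a competing solution is only required to lie in the union of
  the cells. Its angles are continuous and their cosines never vanish, whereas the cosine is 0 at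
  both ends of each cell interval; by connectedness the interval is never left.\<close>

lemma solution_stays_in_cell:
  assumes sol: "closed_loop_solution n l \<gamma> \<delta> \<epsilon> xD {0..<b} q" and q0: "q 0 \<in> M_cell n \<mu>"
    and t: "0 \<le> t" "t < b"
  shows "q t \<in> M_cell n \<mu>"
proof -
  define y where "y = (\<lambda>\<tau>. snd (q \<tau>))"
  have in_cells: "\<exists>\<mu>'\<in>modes n. y \<tau> \<in> cell n \<mu>'" if "\<tau> \<in> {0..<b}" for \<tau>
    using sol that unfolding closed_loop_solution_def M_cell_def y_def by (auto simp: mem_Times_iff)
  then have yU: "y \<tau> \<in> U" if "\<tau> \<in> {0..<b}" for \<tau>
    using that cell_subset_U by blast
  have "real (\<mu> (i - 1)) * pi - pi/2 < y t i \<and> y t i < real (\<mu> (i - 1)) * pi + pi/2"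
    if i: "i \<in> {2..n}" for i
  proof -
    have "\<exists>D. ((\<lambda>\<tau>. y \<tau> i) has_real_derivative D) (at \<tau> within {0..<b})" if "\<tau> \<in> {0..<b}" for \<tau>
    proof (cases "i = n")
      case True
      then show ?thesis
        using sol that unfolding closed_loop_solution_def Let_def y_def by blast
    next
      case False
      then have "i \<in> {1..n-1}" using i by auto
      then show ?thesis
        using sol that unfolding closed_loop_solution_def Let_def y_def by blast
    qed
    then have "continuous_on {0..<b} (\<lambda>\<tau>. y \<tau> i)"
      unfolding continuous_on_eq_continuous_within by (meson DERIV_continuous)
    then have "continuous_on {0..t} (\<lambda>\<tau>. y \<tau> i)"
      by (rule continuous_on_subset) (use t in auto)
    then have conn: "connected ((\<lambda>\<tau>. y \<tau> i) ` {0..t})"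
      by (rule connected_continuous_image) simp
    have img: "y 0 i \<in> (\<lambda>\<tau>. y \<tau> i) ` {0..t}" "y t i \<in> (\<lambda>\<tau>. y \<tau> i) ` {0..t}"
      using t by auto
    have nz: "cos c \<noteq> 0" if "c \<in> (\<lambda>\<tau>. y \<tau> i) ` {0..t}" for c
      using that yU t i unfolding U_def by fastforce
    obtain k where k: "i = k + 1" "1 \<le> k" "k < n" using i by (cases i) auto
    have m: "\<mu> (i - 1) = 0 \<or> \<mu> (i - 1) = 1"
      using mode_cases[OF \<mu> k(2,3)] k(1) by simp
    define lo hi where "lo = real (\<mu> (i - 1)) * pi - pi/2" and "hi = real (\<mu> (i - 1)) * pi + pi/2"
    have "cos lo = 0" "cos hi = 0"
      using cos_shift[OF m, of "- (pi/2)"] cos_shift[OF m, of "pi/2"] by (simp_all add: lo_def hi_def)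
    then have no: "lo \<notin> (\<lambda>\<tau>. y \<tau> i) ` {0..t}" "hi \<notin> (\<lambda>\<tau>. y \<tau> i) ` {0..t}"
      using nz by blast+
    have init: "lo < y 0 i" "y 0 i < hi"
      using q0 i by (auto simp: y_def M_cell_def cell_def mem_Times_iff lo_def hi_def)
    have "lo < y t i"
    proof (rule ccontr)
      assume "\<not> lo < y t i"
      then have "lo \<in> {y t i..y 0 i}" using init by auto
      then show False
        using connected_contains_Icc[OF conn img(2,1)] no by blast
    qed
    moreover have "y t i < hi"
    proof (rule ccontr)
      assume "\<not> y t i < hi"
      then have "hi \<in> {y 0 i..y t i}" using init by auto
      then show False
        using connected_contains_Icc[OF conn img] no by blast
    qed
    ultimately show ?thesis by (simp add: lo_def hi_def)
  qed
  moreover have "y t \<in> {1..n} \<rightarrow>\<^sub>E UNIV"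
    using in_cells[of t] t by (auto simp: cell_def)
  ultimately show ?thesis
    by (simp add: M_cell_def cell_def y_def mem_Times_iff)
qed

end

section \<open>Limits of positions, angles and controls\<close>

lemma tendsto_0_mult_bounded:
  fixes f g :: "'a \<Rightarrow> real"
  assumes "(f \<longlongrightarrow> 0) F" "\<forall>\<^sub>F t in F. \<bar>g t\<bar> \<le> M"
  shows "((\<lambda>t. f t * g t) \<longlongrightarrow> 0) F"
proof (rule Lim_null_comparison)
  show "\<forall>\<^sub>F t in F. norm (f t * g t) \<le> \<bar>f t\<bar> * M"
    using assms(2) by (rule eventually_mono) (simp add: abs_mult mult_left_mono)
  show "((\<lambda>t. \<bar>f t\<bar> * M) \<longlongrightarrow> 0) F"
    using assms(1) by (intro tendsto_mult_left_zero tendsto_rabs_zero)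
qed

context closed_loop
begin

lemma smooth_ref_bounded:
  assumes "smooth {2..n} UNIV f"
  obtains M where "\<And>t. t \<ge> 0 \<Longrightarrow> \<bar>f (sD t)\<bar> \<le> M"
proof -
  obtain R where R: "\<And>i t. 2 \<le> i \<Longrightarrow> i \<le> n + 1 \<Longrightarrow> t \<ge> 0 \<Longrightarrow> \<bar>s_ref \<epsilon> xD i t\<bar> \<le> R"
    using s_ref_bounded by blast
  obtain M where M: "\<And>x. (\<And>i. i \<in> {2..n} \<Longrightarrow> \<bar>x i\<bar> \<le> R) \<Longrightarrow> \<bar>f x\<bar> \<le> M"
    by (rule smooth_bounded[OF assms, of R]) blast
  show ?thesis
    by (rule that[of M], rule M) (use R in auto)
qed

context
  fixes z :: "real \<Rightarrow> nat \<Rightarrow> real"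
  assumes z0: "\<And>k. 1 \<le> k \<Longrightarrow> k \<le> n + 2 \<Longrightarrow> ((\<lambda>t. z t k) \<longlongrightarrow> 0) at_top"
begin

text \<open>The function depends only on indices 2, ..., n, where the reference stays within R.
  Eventually the error is below 1, so both arguments lie in the box of radius R + 1, with one
  Lipschitz constant.\<close>

lemma smooth_diff_tendsto_0:
  assumes "smooth {2..n} UNIV f"
  shows "((\<lambda>t. f (\<lambda>i. sD t i + z t (i + 2)) - f (sD t)) \<longlongrightarrow> 0) at_top"
proof -
  obtain R where R: "\<And>i t. 2 \<le> i \<Longrightarrow> i \<le> n + 1 \<Longrightarrow> t \<ge> 0 \<Longrightarrow> \<bar>s_ref \<epsilon> xD i t\<bar> \<le> R"
    using s_ref_bounded by blast
  obtain L where L: "L \<ge> 0" "\<And>x y. (\<And>i. i \<in> {2..n} \<Longrightarrow> \<bar>x i\<bar> \<le> R + 1) \<Longrightarrow> (\<And>i. i \<in> {2..n} \<Longrightarrow> \<bar>y i\<bar> \<le> R + 1)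
    \<Longrightarrow> \<bar>f x - f y\<bar> \<le> L * (\<Sum>i\<in>{2..n}. \<bar>x i - y i\<bar>)"
    by (rule smooth_Lipschitz[OF finite_atLeastAtMost assms, of "R + 1"]) blast
  have "\<forall>\<^sub>F t in at_top. \<bar>z t (i + 2)\<bar> < 1" if "i \<in> {2..n}" for i
    using order_tendstoD(2)[OF tendsto_rabs_zero[OF z0[of "i + 2"]], of 1] that by simp
  then have "\<forall>\<^sub>F t in at_top. \<forall>i\<in>{2..n}. \<bar>z t (i + 2)\<bar> < 1"
    by (intro eventually_ball_finite) auto
  then have "\<forall>\<^sub>F t in at_top. norm (f (\<lambda>i. sD t i + z t (i + 2)) - f (sD t)) \<le> L * (\<Sum>i\<in>{2..n}. \<bar>z t (i + 2)\<bar>)"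
    using eventually_ge_at_top[of 0]
  proof eventually_elim
    case (elim t)
    have b: "\<bar>sD t i\<bar> \<le> R" "\<bar>z t (i + 2)\<bar> < 1" if "i \<in> {2..n}" for i
      using R[of i t] elim that by auto
    have "\<bar>f (\<lambda>i. sD t i + z t (i + 2)) - f (sD t)\<bar> \<le> L * (\<Sum>i\<in>{2..n}. \<bar>sD t i + z t (i + 2) - sD t i\<bar>)"
      by (rule L(2)) (use b in fastforce)+
    then show ?case by simp
  qed
  moreover have "((\<lambda>t. L * (\<Sum>i\<in>{2..n}. \<bar>z t (i + 2)\<bar>)) \<longlongrightarrow> 0) at_top"
    by (intro tendsto_mult_right_zero tendsto_null_sum tendsto_rabs_zero z0) auto
  ultimately show ?thesis
    by (rule Lim_null_comparison)
qed

lemma position_tendsto: "((\<lambda>t. fst (config_of t (z t)) - xD t) \<longlongrightarrow> 0) at_top"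
proof (rule vec_tendstoI)
  fix i :: 2
  have "((\<lambda>t. (fst (config_of t (z t)) - xD t) $ 1) \<longlongrightarrow> 0) at_top"
    "((\<lambda>t. (fst (config_of t (z t)) - xD t) $ 2) \<longlongrightarrow> 0) at_top"
    using z0[of 1] z0[of 2] by (simp_all add: config_of_def)
  then show "((\<lambda>t. (fst (config_of t (z t)) - xD t) $ i) \<longlongrightarrow> 0 $ i) at_top"
    using exhaust_2[of i] by auto
qed

lemma angles_tendsto: "((\<lambda>t. dist_y n (snd (config_of t (z t))) (Y \<mu> (sD t))) \<longlongrightarrow> 0) at_top"
  unfolding dist_y_def
proof (intro tendsto_null_sum tendsto_rabs_zero)
  fix i assume i: "i \<in> {1..n}"
  show "((\<lambda>t. snd (config_of t (z t)) i - Y \<mu> (sD t) i) \<longlongrightarrow> 0) at_top"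
  proof (cases "i = 1")
    case True
    have "snd (config_of t (z t)) 1 - Y \<mu> (sD t) 1 = z t 3" for t
      unfolding config_of_def snd_conv Y_1 by (simp add: numeral_3_eq_3)
    then show ?thesis
      using z0[of 3] n unfolding True by simp
  next
    case False
    then show ?thesis
      using smooth_diff_tendsto_0[OF Y_smooth[OF \<mu>, of i]] i by (simp add: config_of_def)
  qed
qed

text \<open>The reference control is bounded but need not converge, so limits cannot be inserted
  into the formula for u. The difference is expanded into terms that each contain a factor tending
  to 0 and otherwise bounded factors.\<close>

lemma control_tendsto:
  assumes lam: "((\<lambda>t. lam \<gamma> \<epsilon> (aD t) (z t)) \<longlongrightarrow> \<epsilon>) at_top"
    and alpha: "((\<lambda>t. alpha n \<gamma> \<delta> \<epsilon> n (aD t) (z t)) \<longlongrightarrow> 0) at_top"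
  shows "((\<lambda>t. U_law n l \<gamma> \<delta> \<epsilon> t (config_of t (z t)) xD - u_ref n l \<epsilon> \<mu> xD t) \<longlongrightarrow> 0) at_top"
proof -
  obtain P Q where PQ: "smooth {2..n} U P" "smooth {2..n} U Q"
    "\<And>y. y \<in> U \<Longrightarrow> Fp y = P y" "\<And>y. y \<in> U \<Longrightarrow> Fq y = Q y"
    by (rule Fp_Fq_smooth) blast
  define A where "A s = P (Y \<mu> s)" for s
  define B where "B s = inverse (Q (Y \<mu> s))" for s
  have YU: "Y \<mu> s \<in> U" for s by (rule Y_in_U[OF \<mu>])
  have AB: "Fp (Y \<mu> s) = A s" "c / Fq (Y \<mu> s) = c * B s" for s c
    using PQ(3,4)[OF YU] by (simp_all add: A_def B_def divide_inverse)
  have A: "smooth {2..n} UNIV A"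
    unfolding A_def by (intro smooth_compose[OF PQ(1)] Y_smooth[OF \<mu>] YU) auto
  have B: "smooth {2..n} UNIV B"
    unfolding B_def using Fq_nonzero[OF YU] PQ(4)[OF YU]
    by (intro smooth_inverse smooth_compose[OF PQ(2)] Y_smooth[OF \<mu>] YU) auto
  define s where "s t = (\<lambda>i. sD t i + z t (i + 2))" for t
  obtain c where c: "\<And>t. t \<ge> 0 \<Longrightarrow> \<bar>v t\<bar> \<le> c"
    using speed_upper by blast
  obtain R where R: "\<And>i t. 2 \<le> i \<Longrightarrow> i \<le> n + 1 \<Longrightarrow> t \<ge> 0 \<Longrightarrow> \<bar>s_ref \<epsilon> xD i t\<bar> \<le> R"
    using s_ref_bounded by blast
  obtain MA where MA: "\<And>t. t \<ge> 0 \<Longrightarrow> \<bar>A (sD t)\<bar> \<le> MA"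
    using smooth_ref_bounded[OF A] by blast
  obtain MB where MB: "\<And>t. t \<ge> 0 \<Longrightarrow> \<bar>B (sD t)\<bar> \<le> MB"
    using smooth_ref_bounded[OF B] by blast
  have ev: "\<forall>\<^sub>F t in at_top. \<bar>f t\<bar> \<le> M" if "\<And>t. t \<ge> 0 \<Longrightarrow> \<bar>f t\<bar> \<le> M" for f :: "real \<Rightarrow> real" and M
    using that by (rule eventually_mono[OF eventually_ge_at_top[of 0]])
  define D1 where "D1 t = ctrl1 t (z t) - v t" for t
  define D2 where "D2 t = ctrl2 t (z t) - v t * sD t (n + 1)" for t
  define DA where "DA t = A (s t) - A (sD t)" for t
  define DB where "DB t = B (s t) - B (sD t)" for t
  have D1: "(D1 \<longlongrightarrow> 0) at_top"
  proof -
    have "D1 = (\<lambda>t. (lam \<gamma> \<epsilon> (aD t) (z t) - \<epsilon>) * \<bar>v t\<bar>)"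
      using \<epsilon>_v(1) by (intro ext) (simp add: D1_def ctrl1_def algebra_simps)
    moreover have "((\<lambda>t. (lam \<gamma> \<epsilon> (aD t) (z t) - \<epsilon>) * \<bar>v t\<bar>) \<longlongrightarrow> 0) at_top"
      by (rule tendsto_0_mult_bounded[OF LIM_zero[OF lam] ev]) (use c in auto)
    ultimately show ?thesis by (simp only:)
  qed
  have D2: "(D2 \<longlongrightarrow> 0) at_top"
  proof -
    have "D2 = (\<lambda>t. alpha n \<gamma> \<delta> \<epsilon> n (aD t) (z t) * \<bar>v t\<bar>)"
      by (rule ext) (simp add: D2_def ctrl2_def)
    moreover have "((\<lambda>t. alpha n \<gamma> \<delta> \<epsilon> n (aD t) (z t) * \<bar>v t\<bar>) \<longlongrightarrow> 0) at_top"
      by (rule tendsto_0_mult_bounded[OF alpha ev]) (use c in auto)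
    ultimately show ?thesis by (simp only:)
  qed
  have DA: "(DA \<longlongrightarrow> 0) at_top" and DB: "(DB \<longlongrightarrow> 0) at_top"
    using smooth_diff_tendsto_0[OF A] smooth_diff_tendsto_0[OF B] by (simp_all add: DA_def[abs_def] DB_def[abs_def] s_def)
  \<comment> \<open>With \<open>M0\<close> the reference numerator, \<open>N + M0\<close> is the
    closed-loop numerator: \<open>N\<close> collects all terms that contain one of the differences
    \<open>D1\<close>, \<open>D2\<close>, \<open>DA\<close>.\<close>
  define N where "N t = D2 t - D1 t * A (sD t) - DA t * D1 t - DA t * v t" for t
  define M0 where "M0 t = v t * sD t (n + 1) - A (sD t) * v t" for t
  have N: "(N \<longlongrightarrow> 0) at_top"
  proof -
    have "(N \<longlongrightarrow> 0 - 0 - 0 * 0 - 0) at_top"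
      unfolding N_def[abs_def]
      by (intro tendsto_diff D2 tendsto_0_mult_bounded[OF D1 ev[OF MA]] tendsto_mult[OF DA D1]
          tendsto_0_mult_bounded[OF DA ev[OF c]])
    then show ?thesis by simp
  qed
  have M0: "\<bar>M0 t\<bar> \<le> c * R + MA * c" if t: "t \<ge> 0" for t
  proof -
    have "\<bar>M0 t\<bar> \<le> \<bar>v t\<bar> * \<bar>sD t (n + 1)\<bar> + \<bar>A (sD t)\<bar> * \<bar>v t\<bar>"
      unfolding M0_def abs_mult[symmetric] by (rule abs_triangle_ineq4)
    also have "\<dots> \<le> c * R + MA * c"
      using c[OF t] R[of "n + 1" t] MA[OF t] n t by (intro add_mono mult_mono) auto
    finally show ?thesis .
  qed
  have "((\<lambda>t. N t * DB t + N t * B (sD t) + DB t * M0 t) \<longlongrightarrow> 0 * 0 + 0 + 0) at_top"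
    by (intro tendsto_add tendsto_mult[OF N DB] tendsto_0_mult_bounded[OF N ev[OF MB]]
        tendsto_0_mult_bounded[OF DB ev[OF M0]])
  then have lim2: "((\<lambda>t. N t * DB t + N t * B (sD t) + DB t * M0 t) \<longlongrightarrow> 0) at_top"
    by simp
  have U: "U_law n l \<gamma> \<delta> \<epsilon> t (config_of t (z t)) xD - u_ref n l \<epsilon> \<mu> xD t =
    vector [D1 t, N t * DB t + N t * B (sD t) + DB t * M0 t]" if t: "t \<ge> 0" for t
  proof -
    have "ctrl1 t (Z t (config_of t (z t))) = ctrl1 t (z t)" "ctrl2 t (Z t (config_of t (z t))) = ctrl2 t (z t)"
      by (rule ctrl_local; rule Z_config_of; assumption)+
    moreover have "snd (config_of t (z t)) = Y \<mu> (s t)"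
      by (simp add: config_of_def s_def)
    ultimately have "U_law n l \<gamma> \<delta> \<epsilon> t (config_of t (z t)) xD =
        vector [ctrl1 t (z t), (ctrl2 t (z t) - A (s t) * ctrl1 t (z t)) * B (s t)]"
      unfolding U_law_eq[OF t config_of_cell] by (simp only: AB)
    moreover have "u_ref n l \<epsilon> \<mu> xD t = vector [v t, M0 t * B (sD t)]"
      unfolding u_ref_eq[OF t] AB M0_def ..
    moreover have "(ctrl2 t (z t) - A (s t) * ctrl1 t (z t)) * B (s t) - M0 t * B (sD t) =
        N t * DB t + N t * B (sD t) + DB t * M0 t"
      unfolding N_def M0_def D1_def D2_def DA_def DB_def by (simp add: algebra_simps)
    ultimately show ?thesis
      by (simp add: vec_eq_iff forall_2 D1_def)
  qed
  have "((\<lambda>t. vector [D1 t, N t * DB t + N t * B (sD t) + DB t * M0 t] :: real^2) \<longlongrightarrow> 0) at_top"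
  proof (rule vec_tendstoI)
    fix i :: 2
    show "((\<lambda>t. (vector [D1 t, N t * DB t + N t * B (sD t) + DB t * M0 t] :: real^2) $ i) \<longlongrightarrow> 0 $ i) at_top"
      using exhaust_2[of i] D1 lim2 by auto
  qed
  then show ?thesis
    by (rule Lim_transform_eventually)
      (rule eventually_mono[OF eventually_ge_at_top[of 0]], simp only: U)
qed

end

lemma stabilization:
  assumes q0: "q0 \<in> M_cell n \<mu>"
  shows "\<exists>q. closed_loop_solution n l \<gamma> \<delta> \<epsilon> xD {0..} q \<and> q 0 = q0 \<and>
        (\<forall>T q'. closed_loop_solution n l \<gamma> \<delta> \<epsilon> xD {0..<T} q' \<and> q' 0 = q0 \<longrightarrow>
                 (\<forall>t\<in>{0..<T}. q' t = q t)) \<and>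
        (\<forall>t\<ge>0. q t \<in> M_cell n \<mu>) \<and>
        ((\<lambda>t. fst (q t) - xD t) \<longlongrightarrow> 0) at_top \<and>
        ((\<lambda>t. dist_y n (snd (q t)) (y_ref n l \<epsilon> \<mu> xD t)) \<longlongrightarrow> 0) at_top \<and>
        ((\<lambda>t. U_law n l \<gamma> \<delta> \<epsilon> t (q t) xD - u_ref n l \<epsilon> \<mu> xD t) \<longlongrightarrow> 0) at_top \<and>
        (\<forall>t\<ge>0. \<epsilon> * U_law n l \<gamma> \<delta> \<epsilon> t (q t) xD $ 1 > 0)"
proof -
  obtain \<nu>0 \<nu>1 R where "error_system n \<gamma> \<epsilon> \<delta> (\<lambda>t. \<bar>v t\<bar>) aD \<nu>0 \<nu>1 R"
    using error_system_ex by blast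
  then interpret E: error_system n \<gamma> \<epsilon> \<delta> "\<lambda>t. \<bar>v t\<bar>" aD \<nu>0 \<nu>1 R .
  have E: "E.error_solution S z \<longleftrightarrow> err S z" for S z
    unfolding E.error_solution_def err_def ..
  obtain z where z: "E.error_solution {0..} z" "\<And>k. 1 \<le> k \<Longrightarrow> k \<le> n + 2 \<Longrightarrow> z 0 k = Z 0 q0 k"
    by (rule E.error_solution_exists[of "Z 0 q0"]) blast
  define q where "q t = config_of t (z t)" for t
  have init: "q 0 = q0"
    unfolding q_def by (rule config_of_Z[OF q0 z(2)])
  have sol: "closed_loop_solution n l \<gamma> \<delta> \<epsilon> xD {0..} q"
    unfolding q_def by (rule solution_of_err[OF z(1)[unfolded E]])
  have zk: "((\<lambda>t. z t k) \<longlongrightarrow> 0) at_top" if "1 \<le> k" "k \<le> n + 2" for k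
    by (rule E.error_tendsto_0[OF z(1) that])
  have unique: "q' t = q t"
    if q': "closed_loop_solution n l \<gamma> \<delta> \<epsilon> xD {0..<T} q'" "q' 0 = q0" and t: "t \<in> {0..<T}" for T q' t
  proof -
    have cell: "q' t \<in> M_cell n \<mu>" if "t \<in> {0..<T}" for t
      using solution_stays_in_cell[OF q'(1), of t] q'(2) q0 that by auto
    have err: "E.error_solution {0..<T} (\<lambda>t. Z t (q' t))"
      unfolding E by (rule err_of_solution[OF q'(1) _ cell]) auto
    have "z t k = Z t (q' t) k" if "1 \<le> k" "k \<le> n + 2" for k
      by (rule E.error_solution_unique[OF E.error_solution_subset[OF z(1)] err])
        (use t q'(2) z(2) that in auto)
    then show ?thesis
      unfolding q_def by (intro config_of_Z[OF cell[OF t], symmetric])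
  qed
  have "\<epsilon> * U_law n l \<gamma> \<delta> \<epsilon> t (q t) xD $ 1 > 0" if t: "t \<ge> 0" for t
  proof -
    have "\<epsilon> * U_law n l \<gamma> \<delta> \<epsilon> t (q t) xD $ 1 = \<bar>v t\<bar> * (\<epsilon> * lam \<gamma> \<epsilon> (aD t) (Z t (q t)))"
      unfolding q_def U_law_eq[OF t config_of_cell] by (simp add: ctrl1_def)
    moreover have "\<bar>v t\<bar> * (\<epsilon> * lam \<gamma> \<epsilon> (aD t) (Z t (q t))) > 0"
      using v_nonzero[OF t] by (intro mult_pos_pos[OF _ lam_cos_sin(3)[OF w]]) simp
    ultimately show ?thesis by (simp only:)
  qed
  moreover have "((\<lambda>t. fst (q t) - xD t) \<longlongrightarrow> 0) at_top"
    unfolding q_def by (rule position_tendsto[OF zk])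
  moreover have "((\<lambda>t. dist_y n (snd (q t)) (y_ref n l \<epsilon> \<mu> xD t)) \<longlongrightarrow> 0) at_top"
    unfolding q_def y_ref_eq by (rule angles_tendsto[OF zk])
  moreover have "((\<lambda>t. U_law n l \<gamma> \<delta> \<epsilon> t (q t) xD - u_ref n l \<epsilon> \<mu> xD t) \<longlongrightarrow> 0) at_top"
    unfolding q_def
    by (rule control_tendsto[OF zk E.lam_tendsto[OF z(1)] E.alpha_tendsto_0[OF z(1) order_refl zk]])
  moreover have "q t \<in> M_cell n \<mu>" for t
    unfolding q_def by (rule config_of_cell)
  ultimately show ?thesis
    using init sol unique by (intro exI[of _ q] conjI) blast+
qed

end

theorem mainTheorem3:
  fixes n :: nat and l \<delta> :: "nat \<Rightarrow> real" and \<gamma> :: real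
  assumes "n \<ge> 1"
    and "\<forall>i\<in>{1..n-1}. l i > 0"
    and "\<gamma> > 0"
    and "\<forall>i\<in>{1..n}. \<delta> i > 0"
  shows "K_set n = to_Q n ` (\<Union>\<mu>\<in>modes n. M_cell n \<mu>) \<and>
    Q_topology n closure_of K_set n = topspace (Q_topology n) \<and>
    (\<forall>\<epsilon>\<in>{1, -1}. \<forall>\<mu>\<in>modes n. \<forall>xD. strongly_admissible n xD \<longrightarrow> (\<forall>q0\<in>M_cell n \<mu>.
      \<exists>q. closed_loop_solution n l \<gamma> \<delta> \<epsilon> xD {0..} q \<and> q 0 = q0 \<and>
        (\<forall>T q'. closed_loop_solution n l \<gamma> \<delta> \<epsilon> xD {0..<T} q' \<and> q' 0 = q0 \<longrightarrow>
                 (\<forall>t\<in>{0..<T}. q' t = q t)) \<and>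
        (\<forall>t\<ge>0. q t \<in> M_cell n \<mu>) \<and>
        (case maneuver n l \<epsilon> \<mu> xD of (qD, uD) \<Rightarrow>
          ((\<lambda>t. fst (q t) - xD t) \<longlongrightarrow> 0) at_top \<and>
          ((\<lambda>t. dist_y n (snd (q t)) (snd (qD t))) \<longlongrightarrow> 0) at_top \<and>
          ((\<lambda>t. U_law n l \<gamma> \<delta> \<epsilon> t (q t) xD - uD t) \<longlongrightarrow> 0) at_top) \<and>
        (\<forall>t\<ge>0. (\<epsilon> = 1 \<longrightarrow> U_law n l \<gamma> \<delta> \<epsilon> t (q t) xD $ 1 > 0) \<and>
                (\<epsilon> = -1 \<longrightarrow> U_law n l \<gamma> \<delta> \<epsilon> t (q t) xD $ 1 < 0))))"
proof (intro conjI ballI allI impI)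
  show "K_set n = to_Q n ` (\<Union>\<mu>\<in>modes n. M_cell n \<mu>)"
    by (rule K_set_eq_image[OF assms(1)])
  show "Q_topology n closure_of K_set n = topspace (Q_topology n)"
    by (rule K_set_dense)
  fix \<epsilon> :: real and \<mu> xD q0
  assume \<epsilon>: "\<epsilon> \<in> {1, -1}" and "\<mu> \<in> modes n" "strongly_admissible n xD" and q0: "q0 \<in> M_cell n \<mu>"
  then interpret closed_loop n l \<epsilon> xD \<gamma> \<delta> \<mu>
    using assms by unfold_locales auto
  obtain q where q: "closed_loop_solution n l \<gamma> \<delta> \<epsilon> xD {0..} q" "q 0 = q0"
    "\<forall>T q'. closed_loop_solution n l \<gamma> \<delta> \<epsilon> xD {0..<T} q' \<and> q' 0 = q0 \<longrightarrow> (\<forall>t\<in>{0..<T}. q' t = q t)"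
    "\<forall>t\<ge>0. q t \<in> M_cell n \<mu>"
    "((\<lambda>t. fst (q t) - xD t) \<longlongrightarrow> 0) at_top"
    "((\<lambda>t. dist_y n (snd (q t)) (y_ref n l \<epsilon> \<mu> xD t)) \<longlongrightarrow> 0) at_top"
    "((\<lambda>t. U_law n l \<gamma> \<delta> \<epsilon> t (q t) xD - u_ref n l \<epsilon> \<mu> xD t) \<longlongrightarrow> 0) at_top"
    "\<forall>t\<ge>0. \<epsilon> * U_law n l \<gamma> \<delta> \<epsilon> t (q t) xD $ 1 > 0"
    using stabilization[OF q0] by blast
  have "\<forall>t\<ge>0. (\<epsilon> = 1 \<longrightarrow> U_law n l \<gamma> \<delta> \<epsilon> t (q t) xD $ 1 > 0) \<and>
      (\<epsilon> = -1 \<longrightarrow> U_law n l \<gamma> \<delta> \<epsilon> t (q t) xD $ 1 < 0)"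
    using q(8) by auto
  then show "\<exists>q. closed_loop_solution n l \<gamma> \<delta> \<epsilon> xD {0..} q \<and> q 0 = q0 \<and>
        (\<forall>T q'. closed_loop_solution n l \<gamma> \<delta> \<epsilon> xD {0..<T} q' \<and> q' 0 = q0 \<longrightarrow>
                 (\<forall>t\<in>{0..<T}. q' t = q t)) \<and>
        (\<forall>t\<ge>0. q t \<in> M_cell n \<mu>) \<and>
        (case maneuver n l \<epsilon> \<mu> xD of (qD, uD) \<Rightarrow>
          ((\<lambda>t. fst (q t) - xD t) \<longlongrightarrow> 0) at_top \<and>
          ((\<lambda>t. dist_y n (snd (q t)) (snd (qD t))) \<longlongrightarrow> 0) at_top \<and>
          ((\<lambda>t. U_law n l \<gamma> \<delta> \<epsilon> t (q t) xD - uD t) \<longlongrightarrow> 0) at_top) \<and>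
        (\<forall>t\<ge>0. (\<epsilon> = 1 \<longrightarrow> U_law n l \<gamma> \<delta> \<epsilon> t (q t) xD $ 1 > 0) \<and>
                (\<epsilon> = -1 \<longrightarrow> U_law n l \<gamma> \<delta> \<epsilon> t (q t) xD $ 1 < 0))"
    using q(1-7) by (intro exI[of _ q]) (simp add: maneuver_def)
qed

end
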